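(* Let $A = R(\sigma, f)$ be a generalized Weyl algebra of the type described in the context. Let $A' = R(\sigma, f')$ where $f'$ is obtained from $f$ by replacing any one irreducible factor $(z-\beta)$ of $f$ by $\sigma(z-\beta)$; that is, $f' = \sigma(z-\beta)\cdot f/(z-\beta)$ for some root $\beta$ of $f$. Then $\operatorname{QGrMod}\text{-}A \equiv \operatorname{QGrMod}\text{-}A'$.
   Context: $\Bbbk$ is an algebraically closed field of characteristic zero; equivalences are $\Bbbk$-linear. Either (1) $R=\Bbbk[z]$ and $\sigma(z)=z+1$, or (2) $R=\Bbbk[z,z^{-1}]$ and $\sigma(z)=\xi z$ with $\xi\in\Bbbk^\times$ not a root of unity. $f\in\Bbbk[z]$ is monic, and in case (2) $f(0)\neq0$. For $f \in R$, the generalized Weyl algebra $R(\sigma,f)$ is the quotient of $R\langle x,y\rangle$ by $xy=f$, $yx=\sigma^{-1}(f)$, $xr=\sigma(r)x$, $yr=\sigma^{-1}(r)y$ for $r\in R$, with $\mathbb{Z}$-grading $\deg x=1$, $\deg y=-1$, $\deg r=0$; rescaling $f$ by a unit of $R$ gives an isomorphic algebra. $\operatorname{GrMod}\text{-}A$ is the category of $\mathbb{Z}$-graded right $A$-modules with degree-$0$ maps; a graded module is torsion if it is the sum of its finite-dimensional submodules; $\operatorname{QGrMod}\text{-}A$ is the quotient of $\operatorname{GrMod}\text{-}A$ by the Serre subcategory of torsion modules. *)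

theory Defs
  imports
    "HOL-Algebra.QuotRing"
    "HOL-Algebra.Algebraic_Closure_Type"
    "HOL-Computational_Algebra.Polynomial"
    "HOL-Library.Poly_Mapping"
begin

section \<open>Graded algebras and graded right modules\<close>

text \<open>
  A \<open>\<int>\<close>-graded algebra over a field \<open>'k\<close>: a ring, its structure map \<open>'k \<Rightarrow> A\<close>, and its
  homogeneous components.
\<close>

record ('k, 'a) gr_algebra = "'a ring" +
  scal :: "'k \<Rightarrow> 'a"
  grade :: "int \<Rightarrow> 'a set"

text \<open>
  As for \<^type>\<open>module\<close> in HOL-Algebra, the additive group of a module is stored in a ring
  record whose fields for multiplication and one are meaningless.
\<close>

record ('a, 'm) gr_module = "'m ring" +
  ract :: "'m \<Rightarrow> 'a \<Rightarrow> 'm" (infixl \<open>\<triangleleft>\<index>\<close> 70)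
  component :: "int \<Rightarrow> 'm set"

definition homogeneous_decomposition ::
    "('a, 'm) gr_module \<Rightarrow> (int \<Rightarrow> 'm) \<Rightarrow> 'm \<Rightarrow> bool" where
  "homogeneous_decomposition M c m \<longleftrightarrow>
     (\<forall>n. c n \<in> component M n) \<and> finite {n. c n \<noteq> \<zero>\<^bsub>M\<^esub>} \<and>
     m = (\<Oplus>\<^bsub>M\<^esub>n\<in>{n. c n \<noteq> \<zero>\<^bsub>M\<^esub>}. c n)"

locale graded_right_module = A?: ring A + M?: abelian_group M
  for A :: "('k, 'a) gr_algebra" (structure) and M :: "('a, 'm) gr_module" (structure) +
  assumes ract_closed: "\<lbrakk>m \<in> carrier M; a \<in> carrier A\<rbrakk> \<Longrightarrow> m \<triangleleft>\<^bsub>M\<^esub> a \<in> carrier M"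
    and ract_add_left: "\<lbrakk>m \<in> carrier M; m' \<in> carrier M; a \<in> carrier A\<rbrakk> \<Longrightarrow>
      (m \<oplus>\<^bsub>M\<^esub> m') \<triangleleft>\<^bsub>M\<^esub> a = m \<triangleleft>\<^bsub>M\<^esub> a \<oplus>\<^bsub>M\<^esub> m' \<triangleleft>\<^bsub>M\<^esub> a"
    and ract_add_right: "\<lbrakk>m \<in> carrier M; a \<in> carrier A; b \<in> carrier A\<rbrakk> \<Longrightarrow>
      m \<triangleleft>\<^bsub>M\<^esub> (a \<oplus>\<^bsub>A\<^esub> b) = m \<triangleleft>\<^bsub>M\<^esub> a \<oplus>\<^bsub>M\<^esub> m \<triangleleft>\<^bsub>M\<^esub> b"
    and ract_assoc: "\<lbrakk>m \<in> carrier M; a \<in> carrier A; b \<in> carrier A\<rbrakk> \<Longrightarrow>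
      m \<triangleleft>\<^bsub>M\<^esub> (a \<otimes>\<^bsub>A\<^esub> b) = (m \<triangleleft>\<^bsub>M\<^esub> a) \<triangleleft>\<^bsub>M\<^esub> b"
    and ract_one: "m \<in> carrier M \<Longrightarrow> m \<triangleleft>\<^bsub>M\<^esub> \<one>\<^bsub>A\<^esub> = m"
    and component_subgroup: "additive_subgroup (component M n) M"
    and component_ract: "\<lbrakk>m \<in> component M i; a \<in> grade A j\<rbrakk> \<Longrightarrow>
      m \<triangleleft>\<^bsub>M\<^esub> a \<in> component M (i + j)"
    and component_direct_sum: "m \<in> carrier M \<Longrightarrow> \<exists>!c. homogeneous_decomposition M c m"

definition graded_submodule ::
    "('k, 'a) gr_algebra \<Rightarrow> ('a, 'm) gr_module \<Rightarrow> 'm set \<Rightarrow> bool" where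
  "graded_submodule A M W \<longleftrightarrow>
     additive_subgroup W M \<and>
     (\<forall>w\<in>W. \<forall>a\<in>carrier A. w \<triangleleft>\<^bsub>M\<^esub> a \<in> W) \<and>
     (\<forall>w\<in>W. \<exists>c. homogeneous_decomposition M c w \<and> (\<forall>n. c n \<in> W))"

definition sub_gr_module :: "('a, 'm) gr_module \<Rightarrow> 'm set \<Rightarrow> ('a, 'm) gr_module" where
  "sub_gr_module M W = M\<lparr>carrier := W, component := (\<lambda>n. W \<inter> component M n)\<rparr>"

text \<open>
  The quotient module \<open>M/W\<close>, whose elements are the cosets of \<open>W\<close>; \<open>(W + m) a = W + m a\<close>.
\<close>

definition quot_gr_module :: "('a, 'm) gr_module \<Rightarrow> 'm set \<Rightarrow> ('a, 'm set) gr_module" where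
  "quot_gr_module M W =
     ring.extend (M Quot W)
       (gr_module.fields
          (\<lambda>C a. W <+>\<^bsub>M\<^esub> ((\<lambda>m. m \<triangleleft>\<^bsub>M\<^esub> a) ` C))
          (\<lambda>n. (\<lambda>m. W +>\<^bsub>M\<^esub> m) ` component M n))"

lemma quot_gr_module_simps:
  "carrier (quot_gr_module M W) = a_rcosets\<^bsub>M\<^esub> W"
  "ring.zero (quot_gr_module M W) = W"
  "ring.add (quot_gr_module M W) = set_add M"
  "ract (quot_gr_module M W) C a = W <+>\<^bsub>M\<^esub> ((\<lambda>m. m \<triangleleft>\<^bsub>M\<^esub> a) ` C)"
  "component (quot_gr_module M W) n = (\<lambda>m. W +>\<^bsub>M\<^esub> m) ` component M n"
  by (auto simp: quot_gr_module_def gr_module.defs ring.defs FactRing_def)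

definition gr_hom ::
    "('k, 'a) gr_algebra \<Rightarrow> ('a, 'm) gr_module \<Rightarrow> ('a, 'n) gr_module \<Rightarrow> ('m \<Rightarrow> 'n) set" where
  "gr_hom A M N = {\<phi> \<in> carrier M \<rightarrow>\<^sub>E carrier N.
     (\<forall>m\<in>carrier M. \<forall>m'\<in>carrier M. \<phi> (m \<oplus>\<^bsub>M\<^esub> m') = \<phi> m \<oplus>\<^bsub>N\<^esub> \<phi> m') \<and>
     (\<forall>m\<in>carrier M. \<forall>a\<in>carrier A. \<phi> (m \<triangleleft>\<^bsub>M\<^esub> a) = \<phi> m \<triangleleft>\<^bsub>N\<^esub> a) \<and>
     (\<forall>n. \<forall>m\<in>component M n. \<phi> m \<in> component N n)}"

definition finite_dimensional ::
    "('k, 'a) gr_algebra \<Rightarrow> ('a, 'm) gr_module \<Rightarrow> 'm set \<Rightarrow> bool" where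
  "finite_dimensional A M W \<longleftrightarrow>
     (\<exists>B. finite B \<and> B \<subseteq> W \<and>
       (\<forall>w\<in>W. \<exists>c :: 'm \<Rightarrow> 'k. w = (\<Oplus>\<^bsub>M\<^esub>b\<in>B. b \<triangleleft>\<^bsub>M\<^esub> scal A (c b))))"

definition torsion :: "('k, 'a) gr_algebra \<Rightarrow> ('a, 'm) gr_module \<Rightarrow> bool" where
  "torsion A M \<longleftrightarrow>
     (\<forall>m\<in>carrier M. \<exists>\<F> w. finite \<F> \<and>
        (\<forall>W\<in>\<F>. graded_submodule A M W \<and> finite_dimensional A M W \<and> w W \<in> W) \<and>
        m = (\<Oplus>\<^bsub>M\<^esub>W\<in>\<F>. w W))"


section \<open>Linear categories and their equivalences\<close>

text \<open>
  Composition is indexed by objects: \<open>Comp \<C> U V W g f\<close> is \<open>g \<circ> f\<close> for \<open>f : U \<rightarrow> V\<close> and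
  \<open>g : V \<rightarrow> W\<close>. Hom-sets need not be disjoint.
\<close>

record ('k, 'o, 'h) linear_cat =
  Obj :: "'o set"
  Hom :: "'o \<Rightarrow> 'o \<Rightarrow> 'h set"
  Ident :: "'o \<Rightarrow> 'h"
  Comp :: "'o \<Rightarrow> 'o \<Rightarrow> 'o \<Rightarrow> 'h \<Rightarrow> 'h \<Rightarrow> 'h"
  Hom_add :: "'o \<Rightarrow> 'o \<Rightarrow> 'h \<Rightarrow> 'h \<Rightarrow> 'h"
  Hom_scale :: "'o \<Rightarrow> 'o \<Rightarrow> 'k \<Rightarrow> 'h \<Rightarrow> 'h"

definition linear_functor ::
    "('k, 'o, 'h) linear_cat \<Rightarrow> ('k, 'p, 'i) linear_cat \<Rightarrow>
     ('o \<Rightarrow> 'p) \<Rightarrow> ('o \<Rightarrow> 'o \<Rightarrow> 'h \<Rightarrow> 'i) \<Rightarrow> bool" where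
  "linear_functor \<C> \<D> F\<^sub>o F\<^sub>m \<longleftrightarrow>
     (\<forall>U\<in>Obj \<C>. F\<^sub>o U \<in> Obj \<D>) \<and>
     (\<forall>U\<in>Obj \<C>. F\<^sub>m U U (Ident \<C> U) = Ident \<D> (F\<^sub>o U)) \<and>
     (\<forall>U\<in>Obj \<C>. \<forall>V\<in>Obj \<C>. \<forall>f\<in>Hom \<C> U V. F\<^sub>m U V f \<in> Hom \<D> (F\<^sub>o U) (F\<^sub>o V)) \<and>
     (\<forall>U\<in>Obj \<C>. \<forall>V\<in>Obj \<C>. \<forall>W\<in>Obj \<C>. \<forall>f\<in>Hom \<C> U V. \<forall>g\<in>Hom \<C> V W.
        F\<^sub>m U W (Comp \<C> U V W g f) = Comp \<D> (F\<^sub>o U) (F\<^sub>o V) (F\<^sub>o W) (F\<^sub>m V W g) (F\<^sub>m U V f)) \<and>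
     (\<forall>U\<in>Obj \<C>. \<forall>V\<in>Obj \<C>. \<forall>f\<in>Hom \<C> U V. \<forall>g\<in>Hom \<C> U V.
        F\<^sub>m U V (Hom_add \<C> U V f g) = Hom_add \<D> (F\<^sub>o U) (F\<^sub>o V) (F\<^sub>m U V f) (F\<^sub>m U V g)) \<and>
     (\<forall>U\<in>Obj \<C>. \<forall>V\<in>Obj \<C>. \<forall>c. \<forall>f\<in>Hom \<C> U V.
        F\<^sub>m U V (Hom_scale \<C> U V c f) = Hom_scale \<D> (F\<^sub>o U) (F\<^sub>o V) c (F\<^sub>m U V f))"

definition isomorphism :: "('k, 'o, 'h) linear_cat \<Rightarrow> 'o \<Rightarrow> 'o \<Rightarrow> 'h \<Rightarrow> bool" where
  "isomorphism \<C> U V f \<longleftrightarrow>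
     f \<in> Hom \<C> U V \<and>
     (\<exists>g\<in>Hom \<C> V U. Comp \<C> U V U g f = Ident \<C> U \<and> Comp \<C> V U V f g = Ident \<C> V)"

definition natural_isomorphism ::
    "('k, 'o, 'h) linear_cat \<Rightarrow> ('k, 'p, 'i) linear_cat \<Rightarrow>
     ('o \<Rightarrow> 'p) \<Rightarrow> ('o \<Rightarrow> 'o \<Rightarrow> 'h \<Rightarrow> 'i) \<Rightarrow>
     ('o \<Rightarrow> 'p) \<Rightarrow> ('o \<Rightarrow> 'o \<Rightarrow> 'h \<Rightarrow> 'i) \<Rightarrow> ('o \<Rightarrow> 'i) \<Rightarrow> bool" where
  "natural_isomorphism \<C> \<D> F\<^sub>o F\<^sub>m G\<^sub>o G\<^sub>m \<eta> \<longleftrightarrow>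
     (\<forall>U\<in>Obj \<C>. isomorphism \<D> (F\<^sub>o U) (G\<^sub>o U) (\<eta> U)) \<and>
     (\<forall>U\<in>Obj \<C>. \<forall>V\<in>Obj \<C>. \<forall>f\<in>Hom \<C> U V.
        Comp \<D> (F\<^sub>o U) (F\<^sub>o V) (G\<^sub>o V) (\<eta> V) (F\<^sub>m U V f) =
        Comp \<D> (F\<^sub>o U) (G\<^sub>o U) (G\<^sub>o V) (G\<^sub>m U V f) (\<eta> U))"

definition linear_equivalent ::
    "('k, 'o, 'h) linear_cat \<Rightarrow> ('k, 'p, 'i) linear_cat \<Rightarrow> bool" where
  "linear_equivalent \<C> \<D> \<longleftrightarrow>
     (\<exists>F\<^sub>o F\<^sub>m G\<^sub>o G\<^sub>m \<eta> \<epsilon>.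
        linear_functor \<C> \<D> F\<^sub>o F\<^sub>m \<and> linear_functor \<D> \<C> G\<^sub>o G\<^sub>m \<and>
        natural_isomorphism \<C> \<C>
          (\<lambda>U. U) (\<lambda>U V f. f)
          (\<lambda>U. G\<^sub>o (F\<^sub>o U)) (\<lambda>U V f. G\<^sub>m (F\<^sub>o U) (F\<^sub>o V) (F\<^sub>m U V f)) \<eta> \<and>
        natural_isomorphism \<D> \<D>
          (\<lambda>U. F\<^sub>o (G\<^sub>o U)) (\<lambda>U V f. F\<^sub>m (G\<^sub>o U) (G\<^sub>o V) (G\<^sub>m U V f))
          (\<lambda>U. U) (\<lambda>U V f. f) \<epsilon>)"


section \<open>The quotient of the graded module category by the torsion modules\<close>

text \<open>
  Morphisms from \<open>M\<close> to \<open>N\<close> in the quotient by a Serre subcategory \<open>\<T>\<close> are the direct limit of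
  \<open>Hom(M', N/N')\<close> over the graded submodules \<open>M' \<le> M\<close> and \<open>N' \<le> N\<close> with \<open>M/M'\<close> and \<open>N'\<close> in \<open>\<T>\<close>.
  Representatives are triples \<open>(M', N', \<phi>)\<close>; the values of \<open>\<phi>\<close> are cosets of \<open>N'\<close>.
\<close>

type_synonym 'm qrep = "'m set \<times> 'm set \<times> ('m \<Rightarrow> 'm set)"

definition cotorsion_submodules ::
    "('k, 'a) gr_algebra \<Rightarrow> ('a, 'm) gr_module \<Rightarrow> 'm set set" where
  "cotorsion_submodules A M =
     {M'. graded_submodule A M M' \<and> torsion A (quot_gr_module M M')}"

definition torsion_submodules ::
    "('k, 'a) gr_algebra \<Rightarrow> ('a, 'm) gr_module \<Rightarrow> 'm set set" where
  "torsion_submodules A N =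
     {N'. graded_submodule A N N' \<and> torsion A (sub_gr_module N N')}"

definition qreps ::
    "('k, 'a) gr_algebra \<Rightarrow> ('a, 'm) gr_module \<Rightarrow> ('a, 'm) gr_module \<Rightarrow> 'm qrep set" where
  "qreps A M N = {(M', N', \<phi>).
     M' \<in> cotorsion_submodules A M \<and> N' \<in> torsion_submodules A N \<and>
     \<phi> \<in> gr_hom A (sub_gr_module M M') (quot_gr_module N N')}"

text \<open>
  The transition map \<open>Hom(M', N/N') \<rightarrow> Hom(M'', N/N'')\<close> for \<open>M'' \<le> M'\<close> and \<open>N' \<le> N''\<close>, induced by
  the inclusion and the projection.
\<close>

definition transition ::
    "('a, 'm) gr_module \<Rightarrow> 'm set \<Rightarrow> 'm set \<Rightarrow> ('m \<Rightarrow> 'm set) \<Rightarrow> 'm \<Rightarrow> 'm set" where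
  "transition N M'' N'' \<phi> = (\<lambda>m\<in>M''. N'' <+>\<^bsub>N\<^esub> \<phi> m)"

definition qrel ::
    "('k, 'a) gr_algebra \<Rightarrow> ('a, 'm) gr_module \<Rightarrow> ('a, 'm) gr_module \<Rightarrow>
     ('m qrep \<times> 'm qrep) set" where
  "qrel A M N = {((M1, N1, \<phi>1), (M2, N2, \<phi>2)).
     (M1, N1, \<phi>1) \<in> qreps A M N \<and> (M2, N2, \<phi>2) \<in> qreps A M N \<and>
     (\<exists>M3\<in>cotorsion_submodules A M. \<exists>N3\<in>torsion_submodules A N.
        M3 \<subseteq> M1 \<inter> M2 \<and> N1 \<union> N2 \<subseteq> N3 \<and> transition N M3 N3 \<phi>1 = transition N M3 N3 \<phi>2)}"

text \<open>
  The composite of \<open>\<phi> : M1 \<rightarrow> N/N1\<close> and \<open>\<psi> : N2 \<rightarrow> P/P1\<close>. Let \<open>M3\<close> be the preimage under \<open>\<phi>\<close> of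
  \<open>(N1 + N2)/N1 \<cong> N2/(N1 \<inter> N2)\<close>, and let \<open>P3/P1\<close> be \<open>\<psi>(N1 \<inter> N2)\<close>. Then \<open>\<psi>\<close> induces
  \<open>N2/(N1 \<inter> N2) \<rightarrow> P/P3\<close>, and the composite is \<open>M3 \<rightarrow> N2/(N1 \<inter> N2) \<rightarrow> P/P3\<close>.
\<close>

fun qrep_comp :: "'m qrep \<Rightarrow> 'm qrep \<Rightarrow> 'm qrep" where
  "qrep_comp (N2, P1, \<psi>) (M1, N1, \<phi>) =
     (let M3 = {m \<in> M1. \<phi> m \<inter> N2 \<noteq> {}}; P3 = (\<Union>n\<in>N1 \<inter> N2. \<psi> n)
      in (M3, P3, \<lambda>m\<in>M3. \<Union>n\<in>\<phi> m \<inter> N2. \<psi> n))"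

fun qrep_add :: "('a, 'm) gr_module \<Rightarrow> 'm qrep \<Rightarrow> 'm qrep \<Rightarrow> 'm qrep" where
  "qrep_add N (M1, N1, \<phi>1) (M2, N2, \<phi>2) =
     (M1 \<inter> M2, N1 <+>\<^bsub>N\<^esub> N2, \<lambda>m\<in>M1 \<inter> M2. \<phi>1 m <+>\<^bsub>N\<^esub> \<phi>2 m)"

fun qrep_scale ::
    "('k, 'a) gr_algebra \<Rightarrow> ('a, 'm) gr_module \<Rightarrow> 'k \<Rightarrow> 'm qrep \<Rightarrow> 'm qrep" where
  "qrep_scale A M c (M1, N1, \<phi>) = (M1, N1, \<lambda>m\<in>M1. \<phi> (m \<triangleleft>\<^bsub>M\<^esub> scal A c))"

text \<open>
  The category \<open>QGrMod-A\<close>, for graded modules whose underlying set is contained in the type \<open>'m\<close>;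
  \<open>'m\<close> plays the role of the universe. Operations on classes are lifted from representatives.
\<close>

definition QGrMod ::
    "'m itself \<Rightarrow> ('k, 'a) gr_algebra \<Rightarrow> ('k, ('a, 'm) gr_module, 'm qrep set) linear_cat" where
  "QGrMod _ A = \<lparr>
     Obj = {M. graded_right_module A M},
     Hom = (\<lambda>M N. qreps A M N // qrel A M N),
     Ident = (\<lambda>M. qrel A M M `` {(carrier M, {\<zero>\<^bsub>M\<^esub>}, \<lambda>m\<in>carrier M. {m})}),
     Comp = (\<lambda>M N P \<Psi> \<Phi>. \<Union>\<psi>\<in>\<Psi>. \<Union>\<phi>\<in>\<Phi>. qrel A M P `` {qrep_comp \<psi> \<phi>}),
     Hom_add = (\<lambda>M N \<Phi> \<Phi>'. \<Union>\<phi>\<in>\<Phi>. \<Union>\<phi>'\<in>\<Phi>'. qrel A M N `` {qrep_add N \<phi> \<phi>'}),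
     Hom_scale = (\<lambda>M N c \<Phi>. \<Union>\<phi>\<in>\<Phi>. qrel A M N `` {qrep_scale A M c \<phi>})\<rparr>"


section \<open>Generalized Weyl algebras\<close>

datatype 'r gwa_gen = Coef 'r | GenX | GenY

text \<open>
  The free monoid, written additively so that \<open>'g word \<Rightarrow>\<^sub>0 'k\<close> is the free associative
  \<open>'k\<close>-algebra on \<open>'g\<close>, with convolution as multiplication.
\<close>

datatype 'g word = Word (letters: "'g list")

instantiation word :: (type) monoid_add
begin

definition zero_word :: "'a word" where "0 = Word []"

definition plus_word :: "'a word \<Rightarrow> 'a word \<Rightarrow> 'a word" where
  "u + v = Word (letters u @ letters v)"

instance
  by standard (simp_all add: zero_word_def plus_word_def)

end

type_synonym ('k, 'r) gwa_free = "'r gwa_gen word \<Rightarrow>\<^sub>0 'k"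

definition gen :: "'r gwa_gen \<Rightarrow> ('k::field, 'r) gwa_free" where
  "gen g = Poly_Mapping.single (Word [g]) 1"

text \<open>
  Relations presenting \<open>R\<langle>x, y\<rangle>\<close>, in which \<open>x\<close> and \<open>y\<close> do not commute with \<open>R\<close>, as a quotient of
  the free algebra on the set \<open>R \<union> {x, y}\<close>: they say that \<open>Coef : R \<rightarrow> R\<langle>x, y\<rangle>\<close> is a homomorphism
  of \<open>'k\<close>-algebras, where \<open>\<iota> : 'k \<rightarrow> R\<close> is the structure map of \<open>R\<close>.
\<close>

definition coef_relations ::
    "('k::field \<Rightarrow> 'r::comm_ring_1) \<Rightarrow> ('k, 'r) gwa_free set" where
  "coef_relations \<iota> =
     {gen (Coef (r + s)) - (gen (Coef r) + gen (Coef s)) | r s. True} \<union>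
     {gen (Coef (r * s)) - gen (Coef r) * gen (Coef s) | r s. True} \<union>
     {gen (Coef (\<iota> c)) - Poly_Mapping.single 0 c | c. True}"

definition gwa_relations ::
    "('r::comm_ring_1 \<Rightarrow> 'r) \<Rightarrow> 'r \<Rightarrow> ('k::field, 'r) gwa_free set" where
  "gwa_relations \<sigma> f =
     {gen GenX * gen GenY - gen (Coef f),
      gen GenY * gen GenX - gen (Coef (inv_into UNIV \<sigma> f))} \<union>
     {gen GenX * gen (Coef r) - gen (Coef (\<sigma> r)) * gen GenX | r. True} \<union>
     {gen GenY * gen (Coef r) - gen (Coef (inv_into UNIV \<sigma> r)) * gen GenY | r. True}"

definition gwa_ideal ::
    "('k::field \<Rightarrow> 'r::comm_ring_1) \<Rightarrow> ('r \<Rightarrow> 'r) \<Rightarrow> 'r \<Rightarrow> ('k, 'r) gwa_free set" where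
  "gwa_ideal \<iota> \<sigma> f = Idl\<^bsub>ring_of_type_algebra\<^esub> (coef_relations \<iota> \<union> gwa_relations \<sigma> f)"

fun gen_degree :: "'r gwa_gen \<Rightarrow> int" where
  "gen_degree (Coef r) = 0"
| "gen_degree GenX = 1"
| "gen_degree GenY = - 1"

definition word_degree :: "'r gwa_gen word \<Rightarrow> int" where
  "word_degree w = sum_list (map gen_degree (letters w))"

definition gwa ::
    "('k::field \<Rightarrow> 'r::comm_ring_1) \<Rightarrow> ('r \<Rightarrow> 'r) \<Rightarrow> 'r \<Rightarrow>
     ('k, ('k, 'r) gwa_free set) gr_algebra" where
  "gwa \<iota> \<sigma> f =
     (let F = ring_of_type_algebra; I = gwa_ideal \<iota> \<sigma> f
      in ring.extend (F Quot I)
           (gr_algebra.fields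
              (\<lambda>c. I +>\<^bsub>F\<^esub> Poly_Mapping.single 0 c)
              (\<lambda>n. {I +>\<^bsub>F\<^esub> p | p. \<forall>w\<in>Poly_Mapping.keys p. word_degree w = n})))"

lemma ring_ring_of_type_algebra: "ring (ring_of_type_algebra :: 'a::ring_1 ring)"
proof -
  have "\<exists>y. x + y = 0" "\<exists>y. y + x = 0" for x :: 'a
    using add.right_inverse add.left_inverse by blast+
  then show ?thesis
    unfolding ring_of_type_algebra_def
    by unfold_locales (auto simp: algebra_simps Units_def)
qed

lemma gwa_simps:
  "carrier (gwa \<iota> \<sigma> f) = carrier (ring_of_type_algebra Quot gwa_ideal \<iota> \<sigma> f)"
  "monoid.mult (gwa \<iota> \<sigma> f) = monoid.mult (ring_of_type_algebra Quot gwa_ideal \<iota> \<sigma> f)"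
  "monoid.one (gwa \<iota> \<sigma> f) = monoid.one (ring_of_type_algebra Quot gwa_ideal \<iota> \<sigma> f)"
  "ring.add (gwa \<iota> \<sigma> f) = ring.add (ring_of_type_algebra Quot gwa_ideal \<iota> \<sigma> f)"
  "ring.zero (gwa \<iota> \<sigma> f) = ring.zero (ring_of_type_algebra Quot gwa_ideal \<iota> \<sigma> f)"
  "scal (gwa \<iota> \<sigma> f) c =
     gwa_ideal \<iota> \<sigma> f +>\<^bsub>ring_of_type_algebra\<^esub> Poly_Mapping.single 0 c"
  "grade (gwa \<iota> \<sigma> f) n =
     {gwa_ideal \<iota> \<sigma> f +>\<^bsub>ring_of_type_algebra\<^esub> p | p.
        \<forall>w\<in>Poly_Mapping.keys p. word_degree w = n}"
  by (auto simp: gwa_def Let_def ring.defs gr_algebra.defs)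

lemma ring_gwa:
  fixes \<iota> :: "'k::field \<Rightarrow> 'r::comm_ring_1"
  shows "ring (gwa \<iota> \<sigma> f)"
proof -
  let ?F = "ring_of_type_algebra :: ('k, 'r) gwa_free ring"
  interpret F: ring ?F by (rule ring_ring_of_type_algebra)
  interpret I: ideal "gwa_ideal \<iota> \<sigma> f" ?F
    unfolding gwa_ideal_def by (rule F.genideal_ideal) (simp add: ring_of_type_algebra_def)
  interpret Q: ring "?F Quot gwa_ideal \<iota> \<sigma> f" by (rule I.quotient_is_ring)
  show ?thesis
    by (intro ringI abelian_groupI monoidI)
      (use Q.add.l_inv_ex in \<open>auto simp: gwa_simps Q.a_assoc Q.m_assoc Q.l_distr Q.r_distr Q.a_ac\<close>)
qed

text \<open>The case \<open>R = 'k[z]\<close> and \<open>\<sigma>(z) = z + 1\<close>.\<close>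

definition shift_aut :: "'k::field poly \<Rightarrow> 'k poly" where
  "shift_aut p = pcompose p [:1, 1:]"

lemma bij_shift_aut: "bij (shift_aut :: 'k::field poly \<Rightarrow> _)"
proof (rule o_bij)
  show "(\<lambda>p. pcompose p [:- 1, 1:]) \<circ> shift_aut = (id :: 'k poly \<Rightarrow> _)"
    by (simp add: fun_eq_iff shift_aut_def pcompose_pCons flip: pcompose_assoc)
  show "shift_aut \<circ> (\<lambda>p. pcompose p [:- 1, 1:]) = (id :: 'k poly \<Rightarrow> _)"
    by (simp add: fun_eq_iff shift_aut_def pcompose_pCons flip: pcompose_assoc)
qed

definition gwa_shift :: "'k::field poly \<Rightarrow> ('k, ('k, 'k poly) gwa_free set) gr_algebra" where
  "gwa_shift f = gwa (\<lambda>c. [:c:]) shift_aut f"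

text \<open>
  The case \<open>R = 'k[z, z\<^sup>-\<^sup>1]\<close> and \<open>\<sigma>(z) = \<xi> z\<close>: Laurent polynomials are the monoid algebra
  \<open>int \<Rightarrow>\<^sub>0 'k\<close> of the integers, with \<open>z\<^sup>n\<close> given by \<open>Poly_Mapping.single n 1\<close>.
\<close>

type_synonym 'k laurent = "int \<Rightarrow>\<^sub>0 'k"

definition laurent_of_poly :: "'k::field poly \<Rightarrow> 'k laurent" where
  "laurent_of_poly p =
     (\<Sum>i\<le>Polynomial.degree p. Poly_Mapping.single (int i) (Polynomial.coeff p i))"

definition scale_aut :: "'k::field \<Rightarrow> 'k laurent \<Rightarrow> 'k laurent" where
  "scale_aut \<xi> p =
     (\<Sum>n\<in>Poly_Mapping.keys p. Poly_Mapping.single n (\<xi> powi n * Poly_Mapping.lookup p n))"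

lemma lookup_scale_aut: "Poly_Mapping.lookup (scale_aut \<xi> p) n = \<xi> powi n * Poly_Mapping.lookup p n"
  by (cases "n \<in> Poly_Mapping.keys p")
    (auto simp: scale_aut_def lookup_sum lookup_single when_def in_keys_iff)

lemma bij_scale_aut:
  assumes "\<xi> \<noteq> 0" shows "bij (scale_aut \<xi>)"
proof (rule o_bij)
  show "scale_aut (inverse \<xi>) \<circ> scale_aut \<xi> = id" "scale_aut \<xi> \<circ> scale_aut (inverse \<xi>) = id"
    using assms by (auto simp: fun_eq_iff poly_mapping_eq_iff lookup_scale_aut power_int_inverse)
qed

definition gwa_scale ::
    "'k::field \<Rightarrow> 'k laurent \<Rightarrow> ('k, ('k, 'k laurent) gwa_free set) gr_algebra" where
  "gwa_scale \<xi> f = gwa (\<lambda>c. Poly_Mapping.single 0 c) (scale_aut \<xi>) f"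

end

theory Submission
  imports Defs
begin

text \<open>
  Put \<open>h = z - \<beta>\<close>, \<open>f = h g\<close> and \<open>f' = \<sigma>(h) g\<close>. A graded module over \<open>A = R(\<sigma>, f)\<close> is a graded
  \<open>R\<close>-module with semilinear maps \<open>x\<close> and \<open>y\<close> of degrees \<open>1\<close> and \<open>-1\<close>. To \<open>M\<close> we assign the module
  \<open>F M = {(a, b) \<in> M \<times> M(1). a x = b \<sigma>\<^sup>-\<^sup>1(h) \<and> b y = a g}\<close> over \<open>A' = R(\<sigma>, f')\<close>, with
  \<open>(a, b) x = (b h, b x)\<close>, \<open>(a, b) y = (a y, a \<sigma>\<^sup>-\<^sup>1(g))\<close> and \<open>(a, b) r = (a r, b \<sigma>\<^sup>-\<^sup>1(r))\<close>. The same
  construction with \<open>x\<close> and \<open>y\<close> exchanged gives a functor \<open>G\<close> back, and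
  \<open>m \<mapsto> ((m h, m x), (m y, m \<sigma>\<^sup>-\<^sup>1(g)))\<close> is a natural map \<open>M \<rightarrow> G F M\<close> whose kernel and cokernel are
  annihilated by \<open>x\<close>, \<open>y\<close> and \<open>h\<close>, hence torsion.

  A module is torsion iff each of its elements is annihilated by a nonzero \<open>r \<in> R\<close>, by a power of \<open>x\<close>
  and by a power of \<open>y\<close>. A morphism \<open>M \<rightarrow> N\<close> of the quotient category is represented by a graded
  submodule \<open>\<Gamma> \<le> M \<times> N\<close> whose domain is cotorsion in \<open>M\<close> and whose fibre over \<open>0\<close> is torsion;
  composition is composition of relations, and \<open>\<Gamma> \<subseteq> \<Delta>\<close> implies that \<open>\<Gamma>\<close> and \<open>\<Delta>\<close> represent the same
  morphism. So all identities between morphisms reduce to inclusions of relations.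
\<close>

section \<open>Homogeneous components\<close>

text \<open>Where \<open>h\<close> acts invertibly, the coordinate \<open>b\<close> is
  \<open>a x\<close> divided by \<sigma>^-1(h). There \<open>F M\<close> is \<open>M\<close> itself,
  with \<open>y\<close> kept and \<open>x\<close> followed by \<open>h / \<sigma>^-1(h)\<close>, and
  this rescaling turns \<open>x y = h g\<close> into \<open>\<sigma>(h) g\<close>. Carrying
  \<open>b\<close> along instead of dividing gives the formula a meaning for every \<open>M\<close>,
  with an error that the quotient category does not see. Two obstacles shape the rest. Torsion is
  not tested on one multiplicative set but on three separate commutative ones; commutativity inside
  each set supplies common multipliers. And pairs have another type than the elements of
  \<open>M\<close>, while the objects of \<open>QGrMod\<close> are confined to the type
  \<open>'m\<close>, so pairs must be encoded as elements of \<open>M\<close>. Relations absorb both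
  choices in a representative at once: partiality is the smaller source, multivaluedness the
  submodule factored out of the target. Two relations represent the same morphism exactly if their
  intersection represents a morphism too. Hence an operation that is monotone and preserves such
  relations is well defined on morphisms.\<close>

lemma additive_map_zero:
  assumes "abelian_group M" "abelian_group N" "f \<in> carrier M \<rightarrow> carrier N"
    and add: "\<And>x y. \<lbrakk>x \<in> carrier M; y \<in> carrier M\<rbrakk> \<Longrightarrow> f (x \<oplus>\<^bsub>M\<^esub> y) = f x \<oplus>\<^bsub>N\<^esub> f y"
  shows "f \<zero>\<^bsub>M\<^esub> = \<zero>\<^bsub>N\<^esub>"
proof -
  interpret M: abelian_group M by fact
  interpret N: abelian_group N by fact
  have "f \<zero>\<^bsub>M\<^esub> \<oplus>\<^bsub>N\<^esub> f \<zero>\<^bsub>M\<^esub> = f \<zero>\<^bsub>M\<^esub>" using add[of "\<zero>\<^bsub>M\<^esub>" "\<zero>\<^bsub>M\<^esub>"] by simp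
  moreover have "f \<zero>\<^bsub>M\<^esub> \<in> carrier N" using assms by auto
  ultimately show ?thesis by (simp add: N.add.r_cancel_one')
qed

lemma additive_map_finsum:
  assumes "abelian_group M" "abelian_group N" "f \<in> carrier M \<rightarrow> carrier N"
    and add: "\<And>x y. \<lbrakk>x \<in> carrier M; y \<in> carrier M\<rbrakk> \<Longrightarrow> f (x \<oplus>\<^bsub>M\<^esub> y) = f x \<oplus>\<^bsub>N\<^esub> f y"
    and "finite I" "\<And>i. i \<in> I \<Longrightarrow> g i \<in> carrier M"
  shows "f (\<Oplus>\<^bsub>M\<^esub>i\<in>I. g i) = (\<Oplus>\<^bsub>N\<^esub>i\<in>I. f (g i))"
  using assms(5,6)
proof (induction I rule: finite_induct)
  interpret M: abelian_group M by fact
  interpret N: abelian_group N by fact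
  {
    case empty
    show ?case using additive_map_zero[OF assms(1-4)] by simp
  next
    case (insert i I)
    have *: "g \<in> I \<rightarrow> carrier M" "g i \<in> carrier M" "(\<lambda>i. f (g i)) \<in> I \<rightarrow> carrier N"
      "f (g i) \<in> carrier N" using insert.prems assms(3) by auto
    show ?case using insert * by (simp add: add)
  }
qed

definition hproj :: "('a, 'm) gr_module \<Rightarrow> int \<Rightarrow> 'm \<Rightarrow> 'm" where
  "hproj M n m = (THE c. homogeneous_decomposition M c m) n"

text \<open>The definition sums over the exact support, which is awkward to know; any finite set
  containing the support gives the same sum, as the extra terms are zero.\<close>

lemma homogeneous_decompositionI:
  assumes "abelian_group M" "\<And>n. component M n \<subseteq> carrier M"
    and "finite I" "\<And>n. c n \<in> component M n" "\<And>n. n \<notin> I \<Longrightarrow> c n = \<zero>\<^bsub>M\<^esub>"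
    and "m = (\<Oplus>\<^bsub>M\<^esub>n\<in>I. c n)"
  shows "homogeneous_decomposition M c m"
proof -
  interpret abelian_group M by fact
  have sub: "{n. c n \<noteq> \<zero>\<^bsub>M\<^esub>} \<subseteq> I" using assms(5) by blast
  have "(\<Oplus>\<^bsub>M\<^esub>n\<in>{n. c n \<noteq> \<zero>\<^bsub>M\<^esub>}. c n) = (\<Oplus>\<^bsub>M\<^esub>n\<in>I. c n)"
    by (rule add.finprod_mono_neutral_cong_left) (use assms(2-4) sub in auto)
  then show ?thesis
    unfolding homogeneous_decomposition_def using assms(4,6) finite_subset[OF sub assms(3)] by simp
qed

text \<open>Additive maps \<open>p k\<close> that fix degree \<open>k\<close> and kill the other
  degrees determine every decomposition: applied to a sum of homogeneous elements,
  \<open>p k\<close> leaves the \<open>k\<close>-th term. The direct-sum axiom for submodules,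
  quotients, transported modules and pairs is checked in this form.\<close>

lemma direct_sumI:
  assumes M: "abelian_group M" and sub: "\<And>n. additive_subgroup (component M n) M"
    and mem: "\<And>n m. m \<in> carrier M \<Longrightarrow> p n m \<in> component M n"
    and fin: "\<And>m. m \<in> carrier M \<Longrightarrow> \<exists>I. finite I \<and> (\<forall>n. n \<notin> I \<longrightarrow> p n m = \<zero>\<^bsub>M\<^esub>) \<and> m = (\<Oplus>\<^bsub>M\<^esub>n\<in>I. p n m)"
    and add: "\<And>n x y. \<lbrakk>x \<in> carrier M; y \<in> carrier M\<rbrakk> \<Longrightarrow> p n (x \<oplus>\<^bsub>M\<^esub> y) = p n x \<oplus>\<^bsub>M\<^esub> p n y"
    and same: "\<And>n m. m \<in> component M n \<Longrightarrow> p n m = m"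
    and diff: "\<And>n k m. \<lbrakk>m \<in> component M n; k \<noteq> n\<rbrakk> \<Longrightarrow> p k m = \<zero>\<^bsub>M\<^esub>"
    and m: "m \<in> carrier M"
  shows "\<exists>!c. homogeneous_decomposition M c m"
proof -
  interpret abelian_group M by fact
  have csub: "component M n \<subseteq> carrier M" for n
    using additive_subgroup.a_subset[OF sub] .
  show ?thesis
  proof
    obtain I where "finite I" "\<forall>n. n \<notin> I \<longrightarrow> p n m = \<zero>\<^bsub>M\<^esub>" "m = (\<Oplus>\<^bsub>M\<^esub>n\<in>I. p n m)"
      using fin[OF m] by blast
    then show "homogeneous_decomposition M (\<lambda>n. p n m) m"
      by (intro homogeneous_decompositionI[OF M csub, of I]) (auto simp: mem m)
  next
    fix c assume c: "homogeneous_decomposition M c m"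
    show "c = (\<lambda>n. p n m)"
    proof
      fix k
      let ?I = "{n. c n \<noteq> \<zero>\<^bsub>M\<^esub>}"
      have cn: "c n \<in> component M n" and cc: "c n \<in> carrier M" for n
        using c csub unfolding homogeneous_decomposition_def by blast+
      have fin: "finite ?I" and meq: "m = (\<Oplus>\<^bsub>M\<^esub>n\<in>?I. c n)"
        using c unfolding homogeneous_decomposition_def by blast+
      have "p k m = (\<Oplus>\<^bsub>M\<^esub>n\<in>?I. p k (c n))"
        by (subst meq, rule additive_map_finsum[OF M M])
          (use mem csub cc fin add in auto)
      also have "\<dots> = (\<Oplus>\<^bsub>M\<^esub>n\<in>?I. if k = n then c n else \<zero>\<^bsub>M\<^esub>)"
        by (rule add.finprod_cong') (use cn cc same diff[OF cn] in auto)
      also have "\<dots> = c k"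
      proof (cases "k \<in> ?I")
        case True
        then show ?thesis using add.finprod_singleton[OF True fin, of c] cc by auto
      next
        case False
        have "(\<Oplus>\<^bsub>M\<^esub>n\<in>?I. if k = n then c n else \<zero>\<^bsub>M\<^esub>) = (\<Oplus>\<^bsub>M\<^esub>n\<in>?I. \<zero>\<^bsub>M\<^esub>)"
          by (rule add.finprod_cong') (use False in auto)
        then show ?thesis using False by simp
      qed
      finally show "c k = p k m" by simp
    qed
  qed
qed

context graded_right_module
begin

lemma component_subset: "component M n \<subseteq> carrier M"
  using additive_subgroup.a_subset[OF component_subgroup] .

lemma component_carrier: "m \<in> component M n \<Longrightarrow> m \<in> carrier M"
  using component_subset by blast

lemma component_zero: "\<zero>\<^bsub>M\<^esub> \<in> component M n"
  using additive_subgroup.zero_closed[OF component_subgroup] .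

lemma component_add: "\<lbrakk>x \<in> component M n; y \<in> component M n\<rbrakk> \<Longrightarrow> x \<oplus>\<^bsub>M\<^esub> y \<in> component M n"
  using additive_subgroup.a_closed[OF component_subgroup] .

lemma hproj_unique: "\<lbrakk>m \<in> carrier M; homogeneous_decomposition M c m\<rbrakk> \<Longrightarrow> hproj M n m = c n"
  unfolding hproj_def using component_direct_sum the1_equality by metis

lemma hproj_decomposition: "m \<in> carrier M \<Longrightarrow> homogeneous_decomposition M (\<lambda>n. hproj M n m) m"
proof -
  assume m: "m \<in> carrier M"
  then obtain c where c: "homogeneous_decomposition M c m" using component_direct_sum by blast
  then have "(\<lambda>n. hproj M n m) = c" using hproj_unique[OF m c] by blast
  then show ?thesis using c by simp
qed

lemma hproj_component: "m \<in> carrier M \<Longrightarrow> hproj M n m \<in> component M n"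
  using hproj_decomposition unfolding homogeneous_decomposition_def by blast

lemma hproj_closed: "m \<in> carrier M \<Longrightarrow> hproj M n m \<in> carrier M"
  using hproj_component component_carrier by blast

lemma finite_hproj: "m \<in> carrier M \<Longrightarrow> finite {n. hproj M n m \<noteq> \<zero>\<^bsub>M\<^esub>}"
  using hproj_decomposition unfolding homogeneous_decomposition_def by blast

lemma hproj_sum: "m \<in> carrier M \<Longrightarrow> (\<Oplus>\<^bsub>M\<^esub>n\<in>{n. hproj M n m \<noteq> \<zero>\<^bsub>M\<^esub>}. hproj M n m) = m"
  using hproj_decomposition unfolding homogeneous_decomposition_def by metis

lemma hproj_sum_superset:
  assumes m: "m \<in> carrier M" and I: "finite I" "\<And>n. n \<notin> I \<Longrightarrow> hproj M n m = \<zero>\<^bsub>M\<^esub>"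
  shows "(\<Oplus>\<^bsub>M\<^esub>n\<in>I. hproj M n m) = m"
proof -
  have "(\<Oplus>\<^bsub>M\<^esub>n\<in>{n. hproj M n m \<noteq> \<zero>\<^bsub>M\<^esub>}. hproj M n m) = (\<Oplus>\<^bsub>M\<^esub>n\<in>I. hproj M n m)"
    by (rule M.add.finprod_mono_neutral_cong_left) (use m I hproj_closed in auto)
  then show ?thesis using hproj_sum[OF m] by simp
qed

lemma hproj_eqI:
  assumes "finite I" "\<And>n. c n \<in> component M n" "\<And>n. n \<notin> I \<Longrightarrow> c n = \<zero>\<^bsub>M\<^esub>"
  shows "hproj M k (\<Oplus>\<^bsub>M\<^esub>n\<in>I. c n) = c k"
proof (rule hproj_unique)
  show "(\<Oplus>\<^bsub>M\<^esub>n\<in>I. c n) \<in> carrier M"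
    by (rule M.add.finprod_closed) (use assms component_carrier in auto)
  show "homogeneous_decomposition M c (\<Oplus>\<^bsub>M\<^esub>n\<in>I. c n)"
    by (rule homogeneous_decompositionI[OF M.abelian_group_axioms component_subset assms]) auto
qed

lemma hproj_add:
  assumes x: "x \<in> carrier M" and y: "y \<in> carrier M"
  shows "hproj M k (x \<oplus>\<^bsub>M\<^esub> y) = hproj M k x \<oplus>\<^bsub>M\<^esub> hproj M k y"
proof -
  let ?I = "{n. hproj M n x \<noteq> \<zero>\<^bsub>M\<^esub>} \<union> {n. hproj M n y \<noteq> \<zero>\<^bsub>M\<^esub>}"
  have fin: "finite ?I" using assms finite_hproj by blast
  have "x \<oplus>\<^bsub>M\<^esub> y = (\<Oplus>\<^bsub>M\<^esub>n\<in>?I. hproj M n x) \<oplus>\<^bsub>M\<^esub> (\<Oplus>\<^bsub>M\<^esub>n\<in>?I. hproj M n y)"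
    using hproj_sum_superset[OF x fin] hproj_sum_superset[OF y fin] by auto
  also have "\<dots> = (\<Oplus>\<^bsub>M\<^esub>n\<in>?I. hproj M n x \<oplus>\<^bsub>M\<^esub> hproj M n y)"
    by (rule M.add.finprod_multf[symmetric]) (use assms hproj_closed in auto)
  also have "hproj M k \<dots> = hproj M k x \<oplus>\<^bsub>M\<^esub> hproj M k y"
    by (rule hproj_eqI[OF fin]) (use assms hproj_component component_add in auto)
  finally show ?thesis .
qed

lemma hproj_same: "m \<in> component M n \<Longrightarrow> hproj M n m = m"
  and hproj_diff: "\<lbrakk>m \<in> component M n; k \<noteq> n\<rbrakk> \<Longrightarrow> hproj M k m = \<zero>\<^bsub>M\<^esub>"
proof -
  assume m: "m \<in> component M n"
  \<comment> \<open>Seen as a one-term sum whose summand is zero in all other degrees,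
    \<open>m\<close> has a visible decomposition.\<close>
  have "hproj M k (\<Oplus>\<^bsub>M\<^esub>i\<in>{n}. if i = n then m else \<zero>\<^bsub>M\<^esub>) = (if k = n then m else \<zero>\<^bsub>M\<^esub>)" for k
    by (rule hproj_eqI) (use m component_zero in auto)
  moreover have "(\<Oplus>\<^bsub>M\<^esub>i\<in>{n}. if i = n then m else \<zero>\<^bsub>M\<^esub>) = m"
    using m component_carrier by (simp add: Pi_def)
  ultimately have *: "hproj M k m = (if k = n then m else \<zero>\<^bsub>M\<^esub>)" for k by simp
  show "hproj M n m = m" by (simp add: *)
  show "k \<noteq> n \<Longrightarrow> hproj M k m = \<zero>\<^bsub>M\<^esub>" by (simp add: *)
qed

lemma hproj_zero: "hproj M n \<zero>\<^bsub>M\<^esub> = \<zero>\<^bsub>M\<^esub>"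
  using hproj_same[OF component_zero] .

lemma hproj_finsum:
  "\<lbrakk>finite I; \<And>i. i \<in> I \<Longrightarrow> g i \<in> carrier M\<rbrakk> \<Longrightarrow> hproj M n (\<Oplus>\<^bsub>M\<^esub>i\<in>I. g i) = (\<Oplus>\<^bsub>M\<^esub>i\<in>I. hproj M n (g i))"
  by (rule additive_map_finsum[OF M.abelian_group_axioms M.abelian_group_axioms])
    (auto simp: hproj_closed hproj_add)

lemma ract_finsum:
  "\<lbrakk>finite I; \<And>i. i \<in> I \<Longrightarrow> g i \<in> carrier M; a \<in> carrier A\<rbrakk> \<Longrightarrow>
    (\<Oplus>\<^bsub>M\<^esub>i\<in>I. g i) \<triangleleft>\<^bsub>M\<^esub> a = (\<Oplus>\<^bsub>M\<^esub>i\<in>I. g i \<triangleleft>\<^bsub>M\<^esub> a)"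
  by (rule additive_map_finsum[OF M.abelian_group_axioms M.abelian_group_axioms])
    (auto simp: ract_closed ract_add_left)

lemma zero_ract: "a \<in> carrier A \<Longrightarrow> \<zero>\<^bsub>M\<^esub> \<triangleleft>\<^bsub>M\<^esub> a = \<zero>\<^bsub>M\<^esub>"
  by (rule additive_map_zero[OF M.abelian_group_axioms M.abelian_group_axioms])
    (auto simp: ract_closed ract_add_left)

lemma ract_zero: "m \<in> carrier M \<Longrightarrow> m \<triangleleft>\<^bsub>M\<^esub> \<zero>\<^bsub>A\<^esub> = \<zero>\<^bsub>M\<^esub>"
  by (rule additive_map_zero[OF A.abelian_group_axioms M.abelian_group_axioms])
    (auto simp: ract_closed ract_add_right)

text \<open>Negation is the action of an element of \<open>A\<close>, so a subset that contains zero
  and is closed under sums and the action is a subgroup. This gives \<open>graded_submoduleI\<close>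
  its short list of conditions.\<close>

lemma ract_minus_one: "m \<in> carrier M \<Longrightarrow> m \<triangleleft>\<^bsub>M\<^esub> (\<ominus>\<^bsub>A\<^esub> \<one>\<^bsub>A\<^esub>) = \<ominus>\<^bsub>M\<^esub> m"
proof -
  assume m: "m \<in> carrier M"
  have "m \<triangleleft>\<^bsub>M\<^esub> (\<ominus>\<^bsub>A\<^esub> \<one>\<^bsub>A\<^esub>) \<oplus>\<^bsub>M\<^esub> m \<triangleleft>\<^bsub>M\<^esub> \<one>\<^bsub>A\<^esub> = m \<triangleleft>\<^bsub>M\<^esub> \<zero>\<^bsub>A\<^esub>"
    using m by (subst ract_add_right[symmetric]) (auto simp: A.l_neg)
  then show ?thesis using m
    by (simp add: ract_one ract_zero M.minus_equality ract_closed)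
qed

lemma hproj_ract:
  assumes m: "m \<in> carrier M" and a: "a \<in> grade A j" "a \<in> carrier A"
  shows "hproj M (n + j) (m \<triangleleft>\<^bsub>M\<^esub> a) = hproj M n m \<triangleleft>\<^bsub>M\<^esub> a"
proof -
  let ?I = "{n. hproj M n m \<noteq> \<zero>\<^bsub>M\<^esub>}"
  let ?J = "(\<lambda>n. n + j) ` ?I"
  have fin: "finite ?I" using finite_hproj[OF m] .
  have "m \<triangleleft>\<^bsub>M\<^esub> a = (\<Oplus>\<^bsub>M\<^esub>n\<in>?I. hproj M n m) \<triangleleft>\<^bsub>M\<^esub> a" using hproj_sum[OF m] by simp
  also have "\<dots> = (\<Oplus>\<^bsub>M\<^esub>n\<in>?I. hproj M n m \<triangleleft>\<^bsub>M\<^esub> a)"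
    by (rule ract_finsum) (use fin m a hproj_closed in auto)
  \<comment> \<open>Writing \<open>n\<close> as \<open>n + j - j\<close> makes each term a function
    of its degree \<open>n + j\<close>, so that the sum can be reindexed over the shifted support
    \<open>?J\<close>.\<close>
  also have "\<dots> = (\<Oplus>\<^bsub>M\<^esub>n\<in>?I. hproj M (n + j - j) m \<triangleleft>\<^bsub>M\<^esub> a)" by simp
  also have "\<dots> = (\<Oplus>\<^bsub>M\<^esub>n\<in>?J. hproj M (n - j) m \<triangleleft>\<^bsub>M\<^esub> a)"
    by (rule M.add.finprod_reindex[symmetric]) (use m a hproj_closed ract_closed in auto)
  also have "hproj M (n + j) \<dots> = hproj M (n + j - j) m \<triangleleft>\<^bsub>M\<^esub> a"
  proof (rule hproj_eqI)
    show "hproj M (k - j) m \<triangleleft>\<^bsub>M\<^esub> a \<in> component M k" for k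
      using component_ract[OF hproj_component[OF m] a(1), of "k - j"] by simp
    show "hproj M (k - j) m \<triangleleft>\<^bsub>M\<^esub> a = \<zero>\<^bsub>M\<^esub>" if "k \<notin> ?J" for k
    proof -
      have "k - j \<notin> ?I" using that by (metis (no_types, lifting) diff_add_cancel imageI)
      then show ?thesis using zero_ract a by auto
    qed
  qed (use fin in auto)
  finally show ?thesis by simp
qed

text \<open>Decompositions are unique, so the existential in the definition can only be witnessed by
  the projections.\<close>

lemma graded_submodule_iff:
  "graded_submodule A M W \<longleftrightarrow> additive_subgroup W M \<and>
     (\<forall>w\<in>W. \<forall>a\<in>carrier A. w \<triangleleft>\<^bsub>M\<^esub> a \<in> W) \<and> (\<forall>w\<in>W. \<forall>n. hproj M n w \<in> W)"
proof -
  have "(\<exists>c. homogeneous_decomposition M c w \<and> (\<forall>n. c n \<in> W)) \<longleftrightarrow> (\<forall>n. hproj M n w \<in> W)"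
    if "w \<in> carrier M" for w
    using that hproj_unique hproj_decomposition by metis
  then show ?thesis unfolding graded_submodule_def
    using additive_subgroup.a_subset by blast
qed

lemma graded_submoduleI:
  assumes "W \<subseteq> carrier M" "\<zero>\<^bsub>M\<^esub> \<in> W" "\<And>x y. \<lbrakk>x \<in> W; y \<in> W\<rbrakk> \<Longrightarrow> x \<oplus>\<^bsub>M\<^esub> y \<in> W"
    and act: "\<And>w a. \<lbrakk>w \<in> W; a \<in> carrier A\<rbrakk> \<Longrightarrow> w \<triangleleft>\<^bsub>M\<^esub> a \<in> W"
    and "\<And>w n. w \<in> W \<Longrightarrow> hproj M n w \<in> W"
  shows "graded_submodule A M W"
proof -
  have "\<ominus>\<^bsub>M\<^esub> w \<in> W" if "w \<in> W" for w
    using act[OF that, of "\<ominus>\<^bsub>A\<^esub> \<one>\<^bsub>A\<^esub>"] ract_minus_one[of w] that assms(1) by auto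
  then have "additive_subgroup W M"
    using assms(1-3)
    by (intro additive_subgroupI M.add.subgroupI) (auto simp: a_inv_def)
  then show ?thesis unfolding graded_submodule_iff using assms by blast
qed

lemma graded_submoduleD:
  assumes "graded_submodule A M W"
  shows "W \<subseteq> carrier M" "\<zero>\<^bsub>M\<^esub> \<in> W" "\<And>x y. \<lbrakk>x \<in> W; y \<in> W\<rbrakk> \<Longrightarrow> x \<oplus>\<^bsub>M\<^esub> y \<in> W"
    "\<And>x. x \<in> W \<Longrightarrow> \<ominus>\<^bsub>M\<^esub> x \<in> W" "\<And>w a. \<lbrakk>w \<in> W; a \<in> carrier A\<rbrakk> \<Longrightarrow> w \<triangleleft>\<^bsub>M\<^esub> a \<in> W"
    "\<And>w n. w \<in> W \<Longrightarrow> hproj M n w \<in> W"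
proof -
  have W: "additive_subgroup W M" using assms unfolding graded_submodule_iff by blast
  show "W \<subseteq> carrier M" by (rule additive_subgroup.a_subset[OF W])
  show "\<zero>\<^bsub>M\<^esub> \<in> W" by (rule additive_subgroup.zero_closed[OF W])
  show "\<And>x y. \<lbrakk>x \<in> W; y \<in> W\<rbrakk> \<Longrightarrow> x \<oplus>\<^bsub>M\<^esub> y \<in> W" by (rule additive_subgroup.a_closed[OF W])
  show "\<And>x. x \<in> W \<Longrightarrow> \<ominus>\<^bsub>M\<^esub> x \<in> W" using additive_subgroup.a_inv_closed[OF W] by simp
  show "\<And>w a. \<lbrakk>w \<in> W; a \<in> carrier A\<rbrakk> \<Longrightarrow> w \<triangleleft>\<^bsub>M\<^esub> a \<in> W" "\<And>w n. w \<in> W \<Longrightarrow> hproj M n w \<in> W"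
    using assms unfolding graded_submodule_iff by blast+
qed

end

section \<open>Graded submodules as modules\<close>

lemma sub_gr_module_simps:
  "carrier (sub_gr_module M W) = W"
  "ring.zero (sub_gr_module M W) = ring.zero M"
  "ring.add (sub_gr_module M W) = ring.add M"
  "ract (sub_gr_module M W) = ract M"
  "component (sub_gr_module M W) n = W \<inter> component M n"
  by (simp_all add: sub_gr_module_def)

context graded_right_module
begin

lemma graded_right_module_sub:
  assumes W: "graded_submodule A M W" and grade_carrier: "\<And>j. grade A j \<subseteq> carrier A"
  shows "graded_right_module A (sub_gr_module M W)"
proof -
  note WD = graded_submoduleD[OF W]
  let ?N = "sub_gr_module M W"
  have carr: "w \<in> W \<Longrightarrow> w \<in> carrier M" for w using WD(1) by blast
  have N: "abelian_group ?N"
  proof (rule abelian_groupI)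
    show "\<exists>y\<in>carrier ?N. y \<oplus>\<^bsub>?N\<^esub> x = \<zero>\<^bsub>?N\<^esub>" if "x \<in> carrier ?N" for x
      using that carr WD(4)[of x] M.l_neg[of x] by (auto simp: sub_gr_module_simps)
  qed (use WD carr in \<open>auto simp: sub_gr_module_simps M.a_ac\<close>)
  have sub: "additive_subgroup (component ?N n) ?N" for n
  proof (intro additive_subgroupI group.subgroupI)
    show "group (add_monoid ?N)"
      using N by (simp add: abelian_group.a_group)
    interpret N: abelian_group ?N by (rule N)
    show "inv\<^bsub>add_monoid ?N\<^esub> a \<in> component ?N n" if "a \<in> component ?N n" for a
    proof -
      have a: "a \<in> W" "a \<in> component M n" using that by (auto simp: sub_gr_module_simps)
      have "\<ominus>\<^bsub>?N\<^esub> a = \<ominus>\<^bsub>M\<^esub> a"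
        by (rule N.minus_equality)
          (use a carr WD in \<open>auto simp: sub_gr_module_simps M.l_neg\<close>)
      then show ?thesis
        using a WD(4) additive_subgroup.a_inv_closed[OF component_subgroup]
        by (auto simp: a_inv_def sub_gr_module_simps)
    qed
  qed (use WD component_zero component_add in \<open>auto simp: sub_gr_module_simps\<close>)
  \<comment> \<open>\<open>finsum\<close> depends on the record, so sums in the submodule and in
    \<open>M\<close> are different terms; they agree because the inclusion is additive.\<close>
  have fs: "(\<Oplus>\<^bsub>?N\<^esub>i\<in>I. g i) = (\<Oplus>\<^bsub>M\<^esub>i\<in>I. g i)"
    if "finite I" "\<And>i. i \<in> I \<Longrightarrow> g i \<in> W" for I :: "int set" and g
    using additive_map_finsum[OF N M.abelian_group_axioms, of "\<lambda>x. x" I g] that carr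
    by (auto simp: sub_gr_module_simps)
  show ?thesis
  proof (intro graded_right_module.intro graded_right_module_axioms.intro)
    show "\<exists>!c. homogeneous_decomposition ?N c m" if "m \<in> carrier ?N" for m
    proof (rule direct_sumI[OF N sub, where p = "hproj M"])
      fix m assume m: "m \<in> carrier ?N"
      then have mW: "m \<in> W" "m \<in> carrier M" using carr by (auto simp: sub_gr_module_simps)
      have "m = (\<Oplus>\<^bsub>?N\<^esub>n\<in>{n. hproj M n m \<noteq> \<zero>\<^bsub>M\<^esub>}. hproj M n m)"
        using mW by (subst fs) (auto simp: finite_hproj hproj_sum WD)
      then show "\<exists>I. finite I \<and> (\<forall>n. n \<notin> I \<longrightarrow> hproj M n m = \<zero>\<^bsub>?N\<^esub>) \<and>
          m = (\<Oplus>\<^bsub>?N\<^esub>n\<in>I. hproj M n m)"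
        using mW by (intro exI[of _ "{n. hproj M n m \<noteq> \<zero>\<^bsub>M\<^esub>}"])
          (auto simp: finite_hproj sub_gr_module_simps)
    qed (use that carr WD in
        \<open>auto simp: sub_gr_module_simps hproj_component hproj_add hproj_same hproj_diff\<close>)
  qed (use WD carr N sub grade_carrier in \<open>auto simp: subset_eq sub_gr_module_simps ract_add_left ract_add_right ract_assoc
      ract_one component_ract A.ring_axioms\<close>)
qed

end

section \<open>The quotient by a graded submodule\<close>

locale graded_quotient = graded_right_module +
  fixes W
  assumes W: "graded_submodule A M W"
    and grade_carrier: "grade A j \<subseteq> carrier A"
begin

abbreviation "Q \<equiv> quot_gr_module M W"

definition coset :: "'c \<Rightarrow> 'c set" where "coset m = W +>\<^bsub>M\<^esub> m"

lemmas WD = graded_submoduleD[OF W]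

lemma Wc: "w \<in> W \<Longrightarrow> w \<in> carrier M" using WD(1) by blast

lemma coset_eq: "coset m = {w \<oplus>\<^bsub>M\<^esub> m | w. w \<in> W}"
  unfolding coset_def a_r_coset_def' by auto

lemma coset_mem: "m \<in> carrier M \<Longrightarrow> x \<in> coset m \<longleftrightarrow> x \<in> carrier M \<and> x \<ominus>\<^bsub>M\<^esub> m \<in> W"
proof -
  assume m: "m \<in> carrier M"
  have 1: "(w \<oplus>\<^bsub>M\<^esub> m) \<ominus>\<^bsub>M\<^esub> m = w" if "w \<in> W" for w
    using that m Wc by (simp add: M.minus_eq M.a_assoc M.r_neg)
  have 2: "x = (x \<ominus>\<^bsub>M\<^esub> m) \<oplus>\<^bsub>M\<^esub> m" if "x \<in> carrier M"
    using that m by (simp add: M.minus_eq M.a_assoc M.l_neg)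
  show ?thesis unfolding coset_eq using 1 2 m Wc by auto
qed

lemma coset_eq_iff:
  assumes "m \<in> carrier M" "m' \<in> carrier M"
  shows "coset m = coset m' \<longleftrightarrow> m \<ominus>\<^bsub>M\<^esub> m' \<in> W"
proof
  assume "coset m = coset m'"
  moreover have "m \<in> coset m" using assms WD(2) by (simp add: coset_mem M.minus_eq M.r_neg)
  ultimately show "m \<ominus>\<^bsub>M\<^esub> m' \<in> W" using assms by (simp add: coset_mem)
next
  assume *: "m \<ominus>\<^bsub>M\<^esub> m' \<in> W"
  have 1: "x \<ominus>\<^bsub>M\<^esub> m' = (x \<ominus>\<^bsub>M\<^esub> m) \<oplus>\<^bsub>M\<^esub> (m \<ominus>\<^bsub>M\<^esub> m')" if "x \<in> carrier M" for x
    using that assms by (simp add: M.minus_eq M.a_assoc M.r_neg1)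
  have 2: "x \<ominus>\<^bsub>M\<^esub> m = (x \<ominus>\<^bsub>M\<^esub> m') \<oplus>\<^bsub>M\<^esub> (\<ominus>\<^bsub>M\<^esub> (m \<ominus>\<^bsub>M\<^esub> m'))" if "x \<in> carrier M" for x
    using that assms by (simp add: M.minus_eq M.a_assoc M.minus_add M.r_neg1 M.a_comm[of "\<ominus>\<^bsub>M\<^esub> m"])
  show "coset m = coset m'"
  proof (intro subset_antisym subsetI)
    show "x \<in> coset m'" if "x \<in> coset m" for x
      using that assms * 1 WD(3) unfolding coset_mem[OF assms(1)] coset_mem[OF assms(2)] by metis
    show "x \<in> coset m" if "x \<in> coset m'" for x
      using that assms * 2 WD(3,4) unfolding coset_mem[OF assms(1)] coset_mem[OF assms(2)] by metis
  qed
qed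

lemma coset_carrier: "carrier Q = coset ` carrier M"
  by (auto simp: quot_gr_module_simps A_RCOSETS_def' coset_def)

lemma abelian_subgroup_W: "abelian_subgroup W M"
  using W M.abelian_group_axioms unfolding graded_submodule_def
  by (intro abelian_subgroupI3) auto

lemma coset_add:
  "\<lbrakk>m \<in> carrier M; m' \<in> carrier M\<rbrakk> \<Longrightarrow> coset m \<oplus>\<^bsub>Q\<^esub> coset m' = coset (m \<oplus>\<^bsub>M\<^esub> m')"
  unfolding coset_def quot_gr_module_simps
  using abelian_subgroup.a_rcos_sum[OF abelian_subgroup_W] by simp

lemma coset_zero: "\<zero>\<^bsub>Q\<^esub> = coset \<zero>\<^bsub>M\<^esub>"
  unfolding coset_eq quot_gr_module_simps using Wc by force

lemma coset_eq_zero: "m \<in> carrier M \<Longrightarrow> coset m = \<zero>\<^bsub>Q\<^esub> \<longleftrightarrow> m \<in> W"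
proof -
  assume m: "m \<in> carrier M"
  have "\<ominus>\<^bsub>M\<^esub> \<zero>\<^bsub>M\<^esub> = \<zero>\<^bsub>M\<^esub>" by (rule M.minus_equality) auto
  then have "m \<ominus>\<^bsub>M\<^esub> \<zero>\<^bsub>M\<^esub> = m" using m unfolding M.minus_eq by (metis M.r_zero)
  then show ?thesis unfolding coset_zero using m by (simp add: coset_eq_iff)
qed

lemma coset_ract:
  assumes "m \<in> carrier M" "a \<in> carrier A"
  shows "coset m \<triangleleft>\<^bsub>Q\<^esub> a = coset (m \<triangleleft>\<^bsub>M\<^esub> a)"
proof -
  have 1: "w \<oplus>\<^bsub>M\<^esub> ((w' \<oplus>\<^bsub>M\<^esub> m) \<triangleleft>\<^bsub>M\<^esub> a) = (w \<oplus>\<^bsub>M\<^esub> w' \<triangleleft>\<^bsub>M\<^esub> a) \<oplus>\<^bsub>M\<^esub> m \<triangleleft>\<^bsub>M\<^esub> a"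
    if "w \<in> W" "w' \<in> W" for w w'
    using that assms Wc by (simp add: ract_add_left ract_closed M.a_assoc)
  have 2: "w \<oplus>\<^bsub>M\<^esub> m \<triangleleft>\<^bsub>M\<^esub> a = w \<oplus>\<^bsub>M\<^esub> ((\<zero>\<^bsub>M\<^esub> \<oplus>\<^bsub>M\<^esub> m) \<triangleleft>\<^bsub>M\<^esub> a)" for w
    using assms by simp
  show ?thesis
    unfolding quot_gr_module_simps
  proof (intro subset_antisym subsetI)
    fix x assume "x \<in> W <+>\<^bsub>M\<^esub> (\<lambda>m. m \<triangleleft>\<^bsub>M\<^esub> a) ` coset m"
    then obtain w w' where w: "w \<in> W" "w' \<in> W" "x = w \<oplus>\<^bsub>M\<^esub> ((w' \<oplus>\<^bsub>M\<^esub> m) \<triangleleft>\<^bsub>M\<^esub> a)"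
      unfolding set_add_def' coset_eq[of m] by blast
    then show "x \<in> coset (m \<triangleleft>\<^bsub>M\<^esub> a)"
      unfolding coset_eq 1[OF w(1,2)] using WD(3)[OF w(1) WD(5)[OF w(2) assms(2)]] w(3) 1[OF w(1,2)] by blast
  next
    fix x assume "x \<in> coset (m \<triangleleft>\<^bsub>M\<^esub> a)"
    then obtain w where w: "w \<in> W" "x = w \<oplus>\<^bsub>M\<^esub> m \<triangleleft>\<^bsub>M\<^esub> a" unfolding coset_eq by blast
    then show "x \<in> W <+>\<^bsub>M\<^esub> (\<lambda>m. m \<triangleleft>\<^bsub>M\<^esub> a) ` coset m"
      unfolding set_add_def' coset_eq[of m] 2 using WD(2) by blast
  qed
qed

lemma abelian_group_quot: "abelian_group Q"
proof (rule abelian_groupI)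
  show "\<exists>y\<in>carrier Q. y \<oplus>\<^bsub>Q\<^esub> x = \<zero>\<^bsub>Q\<^esub>" if x: "x \<in> carrier Q" for x
  proof -
    obtain m where m: "m \<in> carrier M" "x = coset m" using x unfolding coset_carrier by blast
    then have "coset (\<ominus>\<^bsub>M\<^esub> m) \<oplus>\<^bsub>Q\<^esub> x = \<zero>\<^bsub>Q\<^esub>"
      by (simp add: coset_add coset_zero M.l_neg)
    then show ?thesis using m unfolding coset_carrier by blast
  qed
qed (auto simp: coset_carrier coset_add coset_zero M.a_ac)

lemma coset_component: "component Q n = coset ` component M n"
  by (auto simp: quot_gr_module_simps coset_def)

lemma coset_finsum:
  "\<lbrakk>finite I; \<And>i. i \<in> I \<Longrightarrow> g i \<in> carrier M\<rbrakk> \<Longrightarrow> coset (\<Oplus>\<^bsub>M\<^esub>i\<in>I. g i) = (\<Oplus>\<^bsub>Q\<^esub>i\<in>I. coset (g i))"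
  by (rule additive_map_finsum[OF M.abelian_group_axioms abelian_group_quot])
    (auto simp: coset_carrier coset_add)

lemma graded_right_module_quot: "graded_right_module A Q"
proof -
  interpret Q: abelian_group Q by (rule abelian_group_quot)
  have sub: "additive_subgroup (component Q n) Q" for n
  proof (intro additive_subgroupI group.subgroupI)
    show "group (add_monoid Q)" using Q.a_group .
    show "inv\<^bsub>add_monoid Q\<^esub> a \<in> component Q n" if a: "a \<in> component Q n" for a
    proof -
      obtain m where m: "m \<in> component M n" "a = coset m" "m \<in> carrier M"
        using a component_carrier unfolding coset_component by blast
      have "\<ominus>\<^bsub>Q\<^esub> a = coset (\<ominus>\<^bsub>M\<^esub> m)"
        by (rule Q.minus_equality)
          (use m in \<open>auto simp: coset_carrier coset_add coset_zero M.l_neg\<close>)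
      then show ?thesis
        using m additive_subgroup.a_inv_closed[OF component_subgroup]
        by (auto simp: a_inv_def coset_component)
    qed
    show "a \<otimes>\<^bsub>add_monoid Q\<^esub> b \<in> component Q n"
      if "a \<in> component Q n" "b \<in> component Q n" for a b
      using that component_carrier component_add by (auto simp: coset_component coset_add)
    show "component Q n \<subseteq> carrier (add_monoid Q)"
      using component_carrier by (auto simp: coset_component coset_carrier)
    show "component Q n \<noteq> {}" using component_zero by (auto simp: coset_component)
  qed
  \<comment> \<open>The projection of a coset is read off an arbitrary representative. Two
    representatives differ by an element of \<open>W\<close>, and \<open>hproj\<close> maps
    \<open>W\<close> into itself, so the choice does not matter.\<close>
  define p where "p n C = coset (hproj M n (SOME m. m \<in> carrier M \<and> C = coset m))" for n C
  have p: "p n (coset m) = coset (hproj M n m)" if m: "m \<in> carrier M" for n m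
  proof -
    define m' where "m' = (SOME m'. m' \<in> carrier M \<and> coset m = coset m')"
    have m': "m' \<in> carrier M" "coset m = coset m'"
      using someI[of "\<lambda>m'. m' \<in> carrier M \<and> coset m = coset m'" m] m unfolding m'_def by auto
    then obtain w where w: "w \<in> W" "m = w \<oplus>\<^bsub>M\<^esub> m'"
      using m coset_mem[OF m, of m] WD(2) by (auto simp: M.minus_eq M.r_neg coset_eq[of m'])
    have "hproj M n m = hproj M n w \<oplus>\<^bsub>M\<^esub> hproj M n m'"
      using w m' Wc by (simp add: hproj_add)
    then have "hproj M n m \<ominus>\<^bsub>M\<^esub> hproj M n m' = hproj M n w"
      using w m' m Wc hproj_closed by (simp add: M.minus_eq M.a_assoc M.r_neg)
    then have "coset (hproj M n m) = coset (hproj M n m')"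
      using m m' w hproj_closed WD(6) by (subst coset_eq_iff) auto
    then show ?thesis unfolding p_def m'_def by simp
  qed
  show ?thesis
  proof (intro graded_right_module.intro graded_right_module_axioms.intro)
    show "\<exists>!c. homogeneous_decomposition Q c m" if "m \<in> carrier Q" for m
    proof (rule direct_sumI[OF Q.abelian_group_axioms sub, where p = p])
      fix C assume "C \<in> carrier Q"
      then obtain m where m: "m \<in> carrier M" "C = coset m" unfolding coset_carrier by blast
      let ?I = "{n. hproj M n m \<noteq> \<zero>\<^bsub>M\<^esub>}"
      have "C = coset (\<Oplus>\<^bsub>M\<^esub>n\<in>?I. hproj M n m)" using m by (simp add: hproj_sum)
      also have "\<dots> = (\<Oplus>\<^bsub>Q\<^esub>n\<in>?I. coset (hproj M n m))"
        by (rule coset_finsum) (use m in \<open>auto simp: finite_hproj hproj_closed\<close>)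
      also have "(\<lambda>n. coset (hproj M n m)) = (\<lambda>n. p n C)" using m p by auto
      finally have "C = (\<Oplus>\<^bsub>Q\<^esub>n\<in>?I. p n C)" .
      moreover have "p n C = \<zero>\<^bsub>Q\<^esub>" if "n \<notin> ?I" for n
        using that m p by (auto simp: coset_zero)
      ultimately show "\<exists>I. finite I \<and> (\<forall>n. n \<notin> I \<longrightarrow> p n C = \<zero>\<^bsub>Q\<^esub>) \<and> C = (\<Oplus>\<^bsub>Q\<^esub>n\<in>I. p n C)"
        using finite_hproj[OF m(1)] by blast
    next
      show "p k m = \<zero>\<^bsub>Q\<^esub>" if "m \<in> component Q n" "k \<noteq> n" for n k m
        using that component_carrier hproj_diff by (auto simp: coset_component p coset_zero)
    qed (use that component_carrier in \<open>auto simp: coset_carrier coset_component coset_add p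
        hproj_component hproj_add hproj_same hproj_closed\<close>)
    show "m \<triangleleft>\<^bsub>Q\<^esub> a \<in> component Q (i + j)" if "m \<in> component Q i" "a \<in> grade A j" for m a i j
    proof -
      have "a \<in> carrier A" using that grade_carrier by blast
      then show ?thesis using that component_carrier component_ract
        by (auto simp: coset_component coset_ract)
    qed
  qed (use component_carrier in \<open>auto simp: coset_carrier coset_add coset_ract ract_closed
      ract_add_left ract_add_right ract_assoc ract_one sub A.ring_axioms Q.abelian_group_axioms\<close>)
qed

end

section \<open>Morphisms of the quotient category as relations\<close>

text \<open>The argument concerns the additive structure and the degrees, so source and target may
  be modules over different algebras. This and the shift \<open>d\<close> are needed for the
  coordinates of the pair module, the second of which has degree \<open>eps\<close>.\<close>

lemma hproj_map_shift:
  assumes "graded_right_module A M" "graded_right_module B N"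
    and f: "f \<in> carrier M \<rightarrow> carrier N"
    and add: "\<And>x y. \<lbrakk>x \<in> carrier M; y \<in> carrier M\<rbrakk> \<Longrightarrow> f (x \<oplus>\<^bsub>M\<^esub> y) = f x \<oplus>\<^bsub>N\<^esub> f y"
    and comp: "\<And>i x. x \<in> component M i \<Longrightarrow> f x \<in> component N (i + d)"
    and m: "m \<in> carrier M"
  shows "hproj N (i + d) (f m) = f (hproj M i m)"
proof -
  interpret M: graded_right_module A M by fact
  interpret N: graded_right_module B N by fact
  let ?I = "{n. hproj M n m \<noteq> \<zero>\<^bsub>M\<^esub>}"
  let ?J = "(\<lambda>n. n + d) ` ?I"
  have fc: "f x \<in> carrier N" if "x \<in> carrier M" for x using f that by auto
  have z: "f \<zero>\<^bsub>M\<^esub> = \<zero>\<^bsub>N\<^esub>"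
    by (rule additive_map_zero[OF M.M.abelian_group_axioms N.M.abelian_group_axioms f add])
  have "f m = f (\<Oplus>\<^bsub>M\<^esub>n\<in>?I. hproj M n m)" by (simp add: M.hproj_sum[OF m])
  also have "\<dots> = (\<Oplus>\<^bsub>N\<^esub>n\<in>?I. f (hproj M n m))"
    by (rule additive_map_finsum[OF M.M.abelian_group_axioms N.M.abelian_group_axioms f add])
      (auto simp: M.finite_hproj[OF m] M.hproj_closed[OF m])
  also have "\<dots> = (\<Oplus>\<^bsub>N\<^esub>n\<in>?I. f (hproj M (n + d - d) m))" by simp
  also have "\<dots> = (\<Oplus>\<^bsub>N\<^esub>k\<in>?J. f (hproj M (k - d) m))"
    by (rule N.M.add.finprod_reindex[symmetric]) (auto simp: fc M.hproj_closed[OF m])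
  also have "hproj N (i + d) \<dots> = f (hproj M (i + d - d) m)"
  proof (rule N.hproj_eqI)
    show "f (hproj M (k - d) m) \<in> component N k" for k
      using comp[OF M.hproj_component[OF m], of "k - d"] by simp
    show "f (hproj M (k - d) m) = \<zero>\<^bsub>N\<^esub>" if "k \<notin> ?J" for k
    proof -
      have "k - d \<notin> ?I" using that by (metis (no_types, lifting) diff_add_cancel imageI)
      then show ?thesis using z by auto
    qed
  qed (use M.finite_hproj[OF m] in auto)
  finally show ?thesis by simp
qed

lemma hproj_map:
  assumes "graded_right_module A M" "graded_right_module B N"
    and f: "f \<in> carrier M \<rightarrow> carrier N"
    and add: "\<And>x y. \<lbrakk>x \<in> carrier M; y \<in> carrier M\<rbrakk> \<Longrightarrow> f (x \<oplus>\<^bsub>M\<^esub> y) = f x \<oplus>\<^bsub>N\<^esub> f y"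
    and comp: "\<And>i x. x \<in> component M i \<Longrightarrow> f x \<in> component N i"
    and m: "m \<in> carrier M"
  shows "hproj N i (f m) = f (hproj M i m)"
  using hproj_map_shift[OF assms(1,2) f add _ m, where d = 0 and i = i] comp by simp

section \<open>Graded relations and abstract torsion theories\<close>

definition mult_dense :: "'a set set \<Rightarrow> ('a, 'm) gr_module \<Rightarrow> 'm set \<Rightarrow> bool" where
  "mult_dense \<S> M D \<longleftrightarrow> (\<forall>S\<in>\<S>. \<forall>m\<in>carrier M. \<exists>s\<in>S. m \<triangleleft>\<^bsub>M\<^esub> s \<in> D)"

text \<open>This and \<open>mult_dense\<close> are the elementwise conditions for \<open>W\<close>
  and for \<open>M/D\<close> to be torsion. The multiplier may depend on the set \<open>S\<close>;
  no single element has to work for the whole family.\<close>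

definition mult_torsion :: "'a set set \<Rightarrow> ('a, 'm) gr_module \<Rightarrow> 'm set \<Rightarrow> bool" where
  "mult_torsion \<S> M W \<longleftrightarrow> (\<forall>S\<in>\<S>. \<forall>w\<in>W. \<exists>s\<in>S. w \<triangleleft>\<^bsub>M\<^esub> s = \<zero>\<^bsub>M\<^esub>)"

text \<open>A graded submodule of the direct sum of \<open>M\<close> and \<open>N\<close>, spelled
  out in coordinates so that the direct sum need not be built as a module on pairs.\<close>

definition graded_relation ::
    "('k, 'a) gr_algebra \<Rightarrow> ('a, 'm) gr_module \<Rightarrow> ('a, 'n) gr_module \<Rightarrow> ('m \<times> 'n) set \<Rightarrow> bool" where
  "graded_relation A M N \<Gamma> \<longleftrightarrow>
     \<Gamma> \<subseteq> carrier M \<times> carrier N \<and> (\<zero>\<^bsub>M\<^esub>, \<zero>\<^bsub>N\<^esub>) \<in> \<Gamma> \<and>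
     (\<forall>m n m' n'. (m, n) \<in> \<Gamma> \<longrightarrow> (m', n') \<in> \<Gamma> \<longrightarrow> (m \<oplus>\<^bsub>M\<^esub> m', n \<oplus>\<^bsub>N\<^esub> n') \<in> \<Gamma>) \<and>
     (\<forall>m n. \<forall>a\<in>carrier A. (m, n) \<in> \<Gamma> \<longrightarrow> (m \<triangleleft>\<^bsub>M\<^esub> a, n \<triangleleft>\<^bsub>N\<^esub> a) \<in> \<Gamma>) \<and>
     (\<forall>m n i. (m, n) \<in> \<Gamma> \<longrightarrow> (hproj M i m, hproj N i n) \<in> \<Gamma>)"

lemma graded_relationI:
  assumes "\<And>m n. (m, n) \<in> \<Gamma> \<Longrightarrow> m \<in> carrier M \<and> n \<in> carrier N" "(\<zero>\<^bsub>M\<^esub>, \<zero>\<^bsub>N\<^esub>) \<in> \<Gamma>"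
    "\<And>m n m' n'. \<lbrakk>(m, n) \<in> \<Gamma>; (m', n') \<in> \<Gamma>\<rbrakk> \<Longrightarrow> (m \<oplus>\<^bsub>M\<^esub> m', n \<oplus>\<^bsub>N\<^esub> n') \<in> \<Gamma>"
    "\<And>m n a. \<lbrakk>(m, n) \<in> \<Gamma>; a \<in> carrier A\<rbrakk> \<Longrightarrow> (m \<triangleleft>\<^bsub>M\<^esub> a, n \<triangleleft>\<^bsub>N\<^esub> a) \<in> \<Gamma>"
    "\<And>m n i. (m, n) \<in> \<Gamma> \<Longrightarrow> (hproj M i m, hproj N i n) \<in> \<Gamma>"
  shows "graded_relation A M N \<Gamma>"
  unfolding graded_relation_def using assms by auto

lemma graded_relationD:
  assumes "graded_relation A M N \<Gamma>"
  shows "\<And>m n. (m, n) \<in> \<Gamma> \<Longrightarrow> m \<in> carrier M" "\<And>m n. (m, n) \<in> \<Gamma> \<Longrightarrow> n \<in> carrier N"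
    "(\<zero>\<^bsub>M\<^esub>, \<zero>\<^bsub>N\<^esub>) \<in> \<Gamma>"
    "\<And>m n m' n'. \<lbrakk>(m, n) \<in> \<Gamma>; (m', n') \<in> \<Gamma>\<rbrakk> \<Longrightarrow> (m \<oplus>\<^bsub>M\<^esub> m', n \<oplus>\<^bsub>N\<^esub> n') \<in> \<Gamma>"
    "\<And>m n a. \<lbrakk>(m, n) \<in> \<Gamma>; a \<in> carrier A\<rbrakk> \<Longrightarrow> (m \<triangleleft>\<^bsub>M\<^esub> a, n \<triangleleft>\<^bsub>N\<^esub> a) \<in> \<Gamma>"
    "\<And>m n i. (m, n) \<in> \<Gamma> \<Longrightarrow> (hproj M i m, hproj N i n) \<in> \<Gamma>"
  using assms unfolding graded_relation_def by auto

lemma graded_relation_converse:   assumes "graded_relation A M N \<Gamma>"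
  shows "graded_relation A N M (\<Gamma>\<inverse>)"
  using graded_relationD[OF assms] by (intro graded_relationI) simp_all

lemma graded_relation_Int:
  assumes "graded_relation A M N \<Gamma>" "graded_relation A M N \<Delta>"
  shows "graded_relation A M N (\<Gamma> \<inter> \<Delta>)"
  using graded_relationD[OF assms(1)] graded_relationD[OF assms(2)]
  by (intro graded_relationI) auto

lemma graded_relation_minus:
  assumes "graded_right_module A M" "graded_right_module A N" and \<Gamma>: "graded_relation A M N \<Gamma>"
    and mn: "(m, n) \<in> \<Gamma>" "(m', n') \<in> \<Gamma>"
  shows "(m \<ominus>\<^bsub>M\<^esub> m', n \<ominus>\<^bsub>N\<^esub> n') \<in> \<Gamma>"
proof -
  interpret M: graded_right_module A M by fact
  interpret N: graded_right_module A N by fact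
  note D = graded_relationD[OF \<Gamma>]
  have "(m' \<triangleleft>\<^bsub>M\<^esub> (\<ominus>\<^bsub>A\<^esub> \<one>\<^bsub>A\<^esub>), n' \<triangleleft>\<^bsub>N\<^esub> (\<ominus>\<^bsub>A\<^esub> \<one>\<^bsub>A\<^esub>)) \<in> \<Gamma>"
    using D(5)[OF mn(2)] by simp
  then have "(\<ominus>\<^bsub>M\<^esub> m', \<ominus>\<^bsub>N\<^esub> n') \<in> \<Gamma>"
    using D(1,2)[OF mn(2)] by (simp add: M.ract_minus_one N.ract_minus_one)
  then show ?thesis using D(4)[OF mn(1)] by (simp add: M.M.minus_eq N.M.minus_eq)
qed

definition qmor ::
    "('k, 'a) gr_algebra \<Rightarrow> 'a set set \<Rightarrow> ('a, 'm) gr_module \<Rightarrow> ('a, 'm) gr_module \<Rightarrow> ('m \<times> 'm) set \<Rightarrow> bool" where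
  "qmor A \<S> M N \<Gamma> \<longleftrightarrow> graded_relation A M N \<Gamma> \<and> mult_dense \<S> M (Domain \<Gamma>) \<and> mult_torsion \<S> N (\<Gamma> `` {\<zero>\<^bsub>M\<^esub>})"

definition qrep_of :: "('a, 'm) gr_module \<Rightarrow> ('m \<times> 'm) set \<Rightarrow> 'm qrep" where
  "qrep_of M \<Gamma> = (Domain \<Gamma>, \<Gamma> `` {\<zero>\<^bsub>M\<^esub>}, \<lambda>m\<in>Domain \<Gamma>. \<Gamma> `` {m})"

text \<open>The values of \<phi> are cosets, that is, sets of elements of \<open>N\<close>, so this
  is the graph of \<phi> lifted to \<open>N\<close>. The submodule \<open>N'\<close> is not lost: it
  is the fibre over zero.\<close>

fun rel_of :: "'m qrep \<Rightarrow> ('m \<times> 'm) set" where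
  "rel_of (M', N', \<phi>) = {(m, n). m \<in> M' \<and> n \<in> \<phi> m}"

lemma rel_of_qrep_of: "rel_of (qrep_of M \<Gamma>) = \<Gamma>"
  by (auto simp: qrep_of_def split: if_splits)

definition cls ::
    "('k, 'a) gr_algebra \<Rightarrow> ('a, 'm) gr_module \<Rightarrow> ('a, 'm) gr_module \<Rightarrow> ('m \<times> 'm) set \<Rightarrow> 'm qrep set" where
  "cls A M N \<Gamma> = qrel A M N `` {qrep_of M \<Gamma>}"

text \<open>Submodules and quotients get separate axioms because a quotient of a module on
  \<open>'m\<close> has elements of type \<open>'m set\<close>, and the type of a module is fixed
  inside the locale.\<close>

locale torsion_theory = A?: ring A
  for A :: "('k, 'a) gr_algebra" (structure) and \<S> :: "'a set set" and ty :: "'m itself" +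
  assumes mult_subset: "S \<in> \<S> \<Longrightarrow> S \<subseteq> carrier A"
    and mult_one: "S \<in> \<S> \<Longrightarrow> \<one>\<^bsub>A\<^esub> \<in> S"
    and mult_closed: "\<lbrakk>S \<in> \<S>; s \<in> S; t \<in> S\<rbrakk> \<Longrightarrow> s \<otimes>\<^bsub>A\<^esub> t \<in> S"
    and mult_comm: "\<lbrakk>S \<in> \<S>; s \<in> S; t \<in> S\<rbrakk> \<Longrightarrow> s \<otimes>\<^bsub>A\<^esub> t = t \<otimes>\<^bsub>A\<^esub> s"
    and grade_carrier: "grade A j \<subseteq> carrier A"
    and scal_closed: "scal A c \<in> carrier A"
    and scal_central: "a \<in> carrier A \<Longrightarrow> scal A c \<otimes>\<^bsub>A\<^esub> a = a \<otimes>\<^bsub>A\<^esub> scal A c"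
    and scal_grade: "scal A c \<in> grade A 0"
    and torsion_sub: "\<And>(M :: ('a, 'm) gr_module) W. \<lbrakk>graded_right_module A M; graded_submodule A M W\<rbrakk> \<Longrightarrow>
      torsion A (sub_gr_module M W) \<longleftrightarrow> mult_torsion \<S> M W"
    and torsion_quot: "\<And>(M :: ('a, 'm) gr_module) W. \<lbrakk>graded_right_module A M; graded_submodule A M W\<rbrakk> \<Longrightarrow>
      torsion A (quot_gr_module M W) \<longleftrightarrow> mult_dense \<S> M W"
begin

abbreviation gmod :: "('a, 'm) gr_module \<Rightarrow> bool" where "gmod M \<equiv> graded_right_module A M"

text \<open>If \<open>s\<close> brings one element where it is wanted and \<open>t\<close> another,
  then \<open>s\<close> times \<open>t\<close> serves both, since the members of one set commute.
  Common multipliers in this abstract part arise in this way.\<close>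

lemma ract2:
  assumes "gmod M" "S \<in> \<S>" "s \<in> S" "t \<in> S" "m \<in> carrier M"
  shows "m \<triangleleft>\<^bsub>M\<^esub> (s \<otimes>\<^bsub>A\<^esub> t) = (m \<triangleleft>\<^bsub>M\<^esub> s) \<triangleleft>\<^bsub>M\<^esub> t" "m \<triangleleft>\<^bsub>M\<^esub> (s \<otimes>\<^bsub>A\<^esub> t) = (m \<triangleleft>\<^bsub>M\<^esub> t) \<triangleleft>\<^bsub>M\<^esub> s"
proof -
  interpret M: graded_right_module A M by fact
  have "s \<in> carrier A" "t \<in> carrier A" using assms mult_subset by blast+
  then show "m \<triangleleft>\<^bsub>M\<^esub> (s \<otimes>\<^bsub>A\<^esub> t) = (m \<triangleleft>\<^bsub>M\<^esub> s) \<triangleleft>\<^bsub>M\<^esub> t" "m \<triangleleft>\<^bsub>M\<^esub> (s \<otimes>\<^bsub>A\<^esub> t) = (m \<triangleleft>\<^bsub>M\<^esub> t) \<triangleleft>\<^bsub>M\<^esub> s"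
    using M.ract_assoc[OF assms(5), of s t] M.ract_assoc[OF assms(5), of t s] mult_comm[OF assms(2-4)]
    by auto
qed

lemma in_cotorsion:
  "gmod M \<Longrightarrow> W \<in> cotorsion_submodules A M \<longleftrightarrow> graded_submodule A M W \<and> mult_dense \<S> M W"
  unfolding cotorsion_submodules_def using torsion_quot by blast

lemma in_torsion:
  "gmod M \<Longrightarrow> W \<in> torsion_submodules A M \<longleftrightarrow> graded_submodule A M W \<and> mult_torsion \<S> M W"
  unfolding torsion_submodules_def using torsion_sub by blast

lemma Domain_submodule:
  assumes "gmod M" "gmod N" "graded_relation A M N \<Gamma>"
  shows "graded_submodule A M (Domain \<Gamma>)"
proof -
  interpret M: graded_right_module A M by fact
  note D = graded_relationD[OF assms(3)]
  show ?thesis proof (rule M.graded_submoduleI)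
    show "x \<oplus>\<^bsub>M\<^esub> y \<in> Domain \<Gamma>" if "x \<in> Domain \<Gamma>" "y \<in> Domain \<Gamma>" for x y
      using that D(4) by (meson DomainE DomainI)
    show "w \<triangleleft>\<^bsub>M\<^esub> a \<in> Domain \<Gamma>" if "w \<in> Domain \<Gamma>" "a \<in> carrier A" for w a
      using that D(5) by (meson DomainE DomainI)
    show "hproj M n w \<in> Domain \<Gamma>" if "w \<in> Domain \<Gamma>" for w n
      using that D(6) by (meson DomainE DomainI)
  qed (use D(1,3) in auto)
qed

lemma image_zero_submodule:
  assumes "gmod M" "gmod N" "graded_relation A M N \<Gamma>"
  shows "graded_submodule A N (\<Gamma> `` {\<zero>\<^bsub>M\<^esub>})"
proof -
  interpret M: graded_right_module A M by fact
  interpret N: graded_right_module A N by fact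
  note D = graded_relationD[OF assms(3)]
  show ?thesis
  proof (rule N.graded_submoduleI)
    show "x \<oplus>\<^bsub>N\<^esub> y \<in> \<Gamma> `` {\<zero>\<^bsub>M\<^esub>}" if "x \<in> \<Gamma> `` {\<zero>\<^bsub>M\<^esub>}" "y \<in> \<Gamma> `` {\<zero>\<^bsub>M\<^esub>}" for x y
      using that D(4)[of "\<zero>\<^bsub>M\<^esub>" x "\<zero>\<^bsub>M\<^esub>" y] by simp
    show "w \<triangleleft>\<^bsub>N\<^esub> a \<in> \<Gamma> `` {\<zero>\<^bsub>M\<^esub>}" if "w \<in> \<Gamma> `` {\<zero>\<^bsub>M\<^esub>}" "a \<in> carrier A" for w a
      using that D(5)[of "\<zero>\<^bsub>M\<^esub>" w a] by (simp add: M.zero_ract)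
    show "hproj N n w \<in> \<Gamma> `` {\<zero>\<^bsub>M\<^esub>}" if "w \<in> \<Gamma> `` {\<zero>\<^bsub>M\<^esub>}" for w n
      using that D(6)[of "\<zero>\<^bsub>M\<^esub>" w n] by (simp add: M.hproj_zero)
  qed (use D in blast)+
qed

lemma graded_quotientI: "gmod M \<Longrightarrow> graded_submodule A M W \<Longrightarrow> graded_quotient A M W"
  using grade_carrier by (simp add: graded_quotient_def graded_quotient_axioms_def)

text \<open>Two partners of \<open>m\<close> differ by a partner of zero. A graded relation is
  therefore a map from its domain to \<open>N\<close> modulo its fibre over zero, which is the shape
  of a representative.\<close>

lemma image_coset:
  assumes "gmod M" "gmod N" "graded_relation A M N \<Gamma>" "(m, n) \<in> \<Gamma>"
  shows "\<Gamma> `` {m} = graded_quotient.coset N (\<Gamma> `` {\<zero>\<^bsub>M\<^esub>}) n"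
proof -
  interpret M: graded_right_module A M by fact
  interpret N: graded_quotient A N "\<Gamma> `` {\<zero>\<^bsub>M\<^esub>}"
    by (rule graded_quotientI[OF assms(2) image_zero_submodule[OF assms(1-3)]])
  note D = graded_relationD[OF assms(3)]
  have n: "n \<in> carrier N" "m \<in> carrier M" using D assms(4) by blast+
  show ?thesis
  proof (intro subset_antisym subsetI)
    fix x assume x: "x \<in> \<Gamma> `` {m}"
    then have "(m \<ominus>\<^bsub>M\<^esub> m, x \<ominus>\<^bsub>N\<^esub> n) \<in> \<Gamma>"
      using graded_relation_minus[OF assms(1-3) _ assms(4)] by blast
    then show "x \<in> N.coset n" using n x D(2) by (auto simp: N.coset_mem M.M.minus_eq M.M.r_neg)
  next
    fix x assume "x \<in> N.coset n"
    then obtain w where "(\<zero>\<^bsub>M\<^esub>, w) \<in> \<Gamma>" "x = w \<oplus>\<^bsub>N\<^esub> n" unfolding N.coset_eq by blast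
    then show "x \<in> \<Gamma> `` {m}" using D(4)[of "\<zero>\<^bsub>M\<^esub>" w m n] n assms(4) by simp
  qed
qed

lemma qrep_of_qreps:
  assumes M: "gmod M" and N: "gmod N" and q: "qmor A \<S> M N \<Gamma>"
  shows "qrep_of M \<Gamma> \<in> qreps A M N"
proof -
  have \<Gamma>: "graded_relation A M N \<Gamma>" using q unfolding qmor_def by blast
  note D = graded_relationD[OF \<Gamma>]
  interpret M: graded_right_module A M by fact
  interpret N: graded_quotient A N "\<Gamma> `` {\<zero>\<^bsub>M\<^esub>}"
    by (rule graded_quotientI[OF N image_zero_submodule[OF M N \<Gamma>]])
  note ic = image_coset[OF M N \<Gamma>]
  have "(\<lambda>m\<in>Domain \<Gamma>. \<Gamma> `` {m}) \<in> gr_hom A (sub_gr_module M (Domain \<Gamma>)) N.Q"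
    unfolding gr_hom_def
  proof (intro CollectI conjI ballI allI)
    show "(\<lambda>m\<in>Domain \<Gamma>. \<Gamma> `` {m}) \<in> carrier (sub_gr_module M (Domain \<Gamma>)) \<rightarrow>\<^sub>E carrier N.Q"
      using ic D(2) by (auto simp: sub_gr_module_simps N.coset_carrier)
  next
    fix m m' assume "m \<in> carrier (sub_gr_module M (Domain \<Gamma>))" "m' \<in> carrier (sub_gr_module M (Domain \<Gamma>))"
    then obtain n n' where n: "(m, n) \<in> \<Gamma>" "(m', n') \<in> \<Gamma>" by (auto simp: sub_gr_module_simps)
    then have "(m \<oplus>\<^bsub>M\<^esub> m', n \<oplus>\<^bsub>N\<^esub> n') \<in> \<Gamma>" using D by blast
    then show "(\<lambda>m\<in>Domain \<Gamma>. \<Gamma> `` {m}) (m \<oplus>\<^bsub>sub_gr_module M (Domain \<Gamma>)\<^esub> m') =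
        (\<lambda>m\<in>Domain \<Gamma>. \<Gamma> `` {m}) m \<oplus>\<^bsub>N.Q\<^esub> (\<lambda>m\<in>Domain \<Gamma>. \<Gamma> `` {m}) m'"
      using n D(2) by (auto simp: sub_gr_module_simps ic N.coset_add Domain.DomainI)
  next
    fix m a assume "m \<in> carrier (sub_gr_module M (Domain \<Gamma>))" and a: "a \<in> carrier A"
    then obtain n where n: "(m, n) \<in> \<Gamma>" by (auto simp: sub_gr_module_simps)
    then have "(m \<triangleleft>\<^bsub>M\<^esub> a, n \<triangleleft>\<^bsub>N\<^esub> a) \<in> \<Gamma>" using D a by blast
    then show "(\<lambda>m\<in>Domain \<Gamma>. \<Gamma> `` {m}) (m \<triangleleft>\<^bsub>sub_gr_module M (Domain \<Gamma>)\<^esub> a) =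
        (\<lambda>m\<in>Domain \<Gamma>. \<Gamma> `` {m}) m \<triangleleft>\<^bsub>N.Q\<^esub> a"
      using n D(2) a by (auto simp: sub_gr_module_simps ic N.coset_ract Domain.DomainI)
  next
    fix i m assume "m \<in> component (sub_gr_module M (Domain \<Gamma>)) i"
    then obtain n where n: "(m, n) \<in> \<Gamma>" and m: "m \<in> component M i" by (auto simp: sub_gr_module_simps)
    have "(m, hproj N i n) \<in> \<Gamma>" using D(6)[OF n, of i] m by (simp add: M.hproj_same)
    then show "(\<lambda>m\<in>Domain \<Gamma>. \<Gamma> `` {m}) m \<in> component N.Q i"
      using D(2)[OF n] by (auto simp: ic N.coset_component N.hproj_component Domain.DomainI)
  qed
  then show ?thesis
    using q Domain_submodule[OF M N \<Gamma>] image_zero_submodule[OF M N \<Gamma>]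
    unfolding qmor_def qrep_of_def qreps_def by (auto simp: in_cotorsion[OF M] in_torsion[OF N])
qed

text \<open>The converse of \<open>qrep_of_qreps\<close>: a representative and its graph determine
  each other, so nothing is lost by arguing about relations only.\<close>

lemma qreps_rel_of:
  assumes M: "gmod M" and N: "gmod N" and r: "r \<in> qreps A M N"
  shows "qmor A \<S> M N (rel_of r)" "qrep_of M (rel_of r) = r"
proof -
  obtain M1 N1 \<phi> where r_eq: "r = (M1, N1, \<phi>)" by (cases r)
  have M1: "graded_submodule A M M1" "mult_dense \<S> M M1"
    and N1: "graded_submodule A N N1" "mult_torsion \<S> N N1"
    and \<phi>: "\<phi> \<in> gr_hom A (sub_gr_module M M1) (quot_gr_module N N1)"
    using r unfolding r_eq qreps_def by (auto simp: in_cotorsion[OF M] in_torsion[OF N])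
  interpret M: graded_right_module A M by fact
  interpret N: graded_quotient A N N1 by (rule graded_quotientI[OF N N1(1)])
  interpret S: graded_right_module A "sub_gr_module M M1"
    by (rule M.graded_right_module_sub[OF M1(1)]) (use grade_carrier in blast)
  interpret Q: graded_right_module A N.Q by (rule N.graded_right_module_quot)
  note MD = M.graded_submoduleD[OF M1(1)]
  have \<phi>1: "\<phi> \<in> M1 \<rightarrow>\<^sub>E N.coset ` carrier N"
    and \<phi>2: "\<And>m m'. \<lbrakk>m \<in> M1; m' \<in> M1\<rbrakk> \<Longrightarrow> \<phi> (m \<oplus>\<^bsub>M\<^esub> m') = \<phi> m \<oplus>\<^bsub>N.Q\<^esub> \<phi> m'"
    and \<phi>3: "\<And>m a. \<lbrakk>m \<in> M1; a \<in> carrier A\<rbrakk> \<Longrightarrow> \<phi> (m \<triangleleft>\<^bsub>M\<^esub> a) = \<phi> m \<triangleleft>\<^bsub>N.Q\<^esub> a"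
    and \<phi>4: "\<And>m n. \<lbrakk>m \<in> M1; m \<in> component M n\<rbrakk> \<Longrightarrow> \<phi> m \<in> component N.Q n"
    using \<phi> unfolding gr_hom_def by (auto simp: sub_gr_module_simps N.coset_carrier)
  have \<phi>0: "\<phi> \<zero>\<^bsub>M\<^esub> = \<zero>\<^bsub>N.Q\<^esub>"
    using additive_map_zero[OF S.M.abelian_group_axioms Q.M.abelian_group_axioms, of \<phi>] \<phi>1 \<phi>2
    by (auto simp: sub_gr_module_simps N.coset_carrier)
  \<comment> \<open>Projections of the submodule are computed in its own record; the inclusion
    preserves degrees and therefore commutes with them.\<close>
  have incl: "hproj (sub_gr_module M M1) i m = hproj M i m" if "m \<in> M1" for i m
    by (rule hproj_map[OF S.graded_right_module_axioms M, of "\<lambda>x. x", symmetric])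
      (use that MD(1) in \<open>auto simp: sub_gr_module_simps\<close>)
  have \<phi>5: "hproj N.Q i (\<phi> m) = \<phi> (hproj M i m)" if "m \<in> M1" for i m
    using hproj_map[OF S.graded_right_module_axioms Q.graded_right_module_axioms, of \<phi> m i] that \<phi>1 \<phi>2 \<phi>4 incl
    by (auto simp: sub_gr_module_simps N.coset_carrier)
  have hc: "hproj N.Q i (N.coset n) = N.coset (hproj N i n)" if "n \<in> carrier N" for i n
    using hproj_map[OF N Q.graded_right_module_axioms, of N.coset n i] that
    by (auto simp: N.coset_carrier N.coset_add N.coset_component)
  have self: "n \<in> N.coset n" if "n \<in> carrier N" for n
    using that N1(1) N.WD(2) by (simp add: N.coset_mem N.M.minus_eq N.M.r_neg)
  \<comment> \<open>Membership in the graph becomes an equation between cosets, and each closure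
    property of the graph becomes the matching property of \<phi>.\<close>
  have rel: "(m, n) \<in> rel_of r \<longleftrightarrow> m \<in> M1 \<and> n \<in> carrier N \<and> \<phi> m = N.coset n" for m n
  proof -
    have "n \<in> \<phi> m \<longleftrightarrow> n \<in> carrier N \<and> \<phi> m = N.coset n" if m: "m \<in> M1"
    proof -
      obtain n' where n': "n' \<in> carrier N" "\<phi> m = N.coset n'" using \<phi>1 m by (auto simp: PiE_def Pi_def)
      show ?thesis
        using n' self N.coset_eq_iff[of n n'] N.coset_mem[of n' n] by auto
    qed
    then show ?thesis by (auto simp: r_eq)
  qed
  have gr: "graded_relation A M N (rel_of r)"
  proof (rule graded_relationI)
    show "(hproj M i m, hproj N i n) \<in> rel_of r" if "(m, n) \<in> rel_of r" for m n i
      using that \<phi>5 hc MD(6) N.hproj_closed unfolding rel by metis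
  qed (use MD \<phi>2 \<phi>3 \<phi>0 in \<open>auto simp: rel N.coset_zero N.coset_add N.coset_ract N.ract_closed\<close>)
  have dom: "Domain (rel_of r) = M1"
  proof (intro subset_antisym subsetI)
    fix m assume m: "m \<in> M1"
    then obtain n where "n \<in> carrier N" "\<phi> m = N.coset n" using \<phi>1 by (auto simp: PiE_def Pi_def)
    then show "m \<in> Domain (rel_of r)" using m rel by blast
  qed (auto simp: rel)
  have im: "rel_of r `` {\<zero>\<^bsub>M\<^esub>} = N1"
  proof -
    have "rel_of r `` {\<zero>\<^bsub>M\<^esub>} = \<phi> \<zero>\<^bsub>M\<^esub>" using MD(2) by (auto simp: r_eq)
    then show ?thesis using \<phi>0 by (simp add: quot_gr_module_simps)
  qed
  show "qmor A \<S> M N (rel_of r)" unfolding qmor_def using gr dom im M1 N1 by simp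
  have "(\<lambda>m\<in>M1. rel_of r `` {m}) = \<phi>"
    using \<phi>1 by (auto simp: r_eq PiE_def extensional_def fun_eq_iff)
  then show "qrep_of M (rel_of r) = r" unfolding qrep_of_def dom im by (simp add: r_eq)
qed

lemma mult_dense_Int:
  assumes "gmod M" "graded_submodule A M D" "graded_submodule A M E" "mult_dense \<S> M D" "mult_dense \<S> M E"
  shows "mult_dense \<S> M (D \<inter> E)"
  unfolding mult_dense_def
proof (intro ballI)
  interpret M: graded_right_module A M by fact
  fix S m assume S: "S \<in> \<S>" and m: "m \<in> carrier M"
  obtain s t where st: "s \<in> S" "t \<in> S" "m \<triangleleft>\<^bsub>M\<^esub> s \<in> D" "m \<triangleleft>\<^bsub>M\<^esub> t \<in> E"
    using assms(4,5) S m unfolding mult_dense_def by metis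
  have "s \<in> carrier A" "t \<in> carrier A" using st S mult_subset by blast+
  then have "m \<triangleleft>\<^bsub>M\<^esub> (s \<otimes>\<^bsub>A\<^esub> t) \<in> D \<inter> E"
    using ract2[OF assms(1) S st(1,2) m] st M.graded_submoduleD(5)[OF assms(2)] M.graded_submoduleD(5)[OF assms(3)]
    by (metis IntI)
  then show "\<exists>s\<in>S. m \<triangleleft>\<^bsub>M\<^esub> s \<in> D \<inter> E" using mult_closed[OF S st(1,2)] by blast
qed

lemma set_addI: "\<lbrakk>d \<in> D; e \<in> E\<rbrakk> \<Longrightarrow> d \<oplus>\<^bsub>M\<^esub> e \<in> D <+>\<^bsub>M\<^esub> E"
  unfolding set_add_def' by blast

lemma mult_torsion_sum:
  assumes "gmod M" "D \<subseteq> carrier M" "E \<subseteq> carrier M" "mult_torsion \<S> M D" "mult_torsion \<S> M E"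
  shows "mult_torsion \<S> M (D <+>\<^bsub>M\<^esub> E)"
  unfolding mult_torsion_def
proof (intro ballI)
  interpret M: graded_right_module A M by fact
  fix S m assume S: "S \<in> \<S>" and m: "m \<in> D <+>\<^bsub>M\<^esub> E"
  then obtain d e where de: "d \<in> D" "e \<in> E" "m = d \<oplus>\<^bsub>M\<^esub> e" unfolding set_add_def' by blast
  obtain s t where st: "s \<in> S" "t \<in> S" "d \<triangleleft>\<^bsub>M\<^esub> s = \<zero>\<^bsub>M\<^esub>" "e \<triangleleft>\<^bsub>M\<^esub> t = \<zero>\<^bsub>M\<^esub>"
    using assms(4,5) S de unfolding mult_torsion_def by metis
  have c: "s \<in> carrier A" "t \<in> carrier A" "d \<in> carrier M" "e \<in> carrier M"
    using st S mult_subset de assms(2,3) by blast+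
  have "m \<triangleleft>\<^bsub>M\<^esub> (s \<otimes>\<^bsub>A\<^esub> t) = d \<triangleleft>\<^bsub>M\<^esub> (s \<otimes>\<^bsub>A\<^esub> t) \<oplus>\<^bsub>M\<^esub> e \<triangleleft>\<^bsub>M\<^esub> (s \<otimes>\<^bsub>A\<^esub> t)"
    using de c by (simp add: M.ract_add_left)
  also have "\<dots> = \<zero>\<^bsub>M\<^esub>"
    using st c by (simp add: ract2(1)[OF assms(1) S st(1,2) c(3)] ract2(2)[OF assms(1) S st(1,2) c(4)] M.zero_ract)
  finally show "\<exists>s\<in>S. m \<triangleleft>\<^bsub>M\<^esub> s = \<zero>\<^bsub>M\<^esub>" using mult_closed[OF S st(1,2)] by blast
qed

lemma graded_submodule_sum:
  assumes "gmod M" "graded_submodule A M D" "graded_submodule A M E"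
  shows "graded_submodule A M (D <+>\<^bsub>M\<^esub> E)"
proof -
  interpret M: graded_right_module A M by fact
  note D = M.graded_submoduleD[OF assms(2)] and E = M.graded_submoduleD[OF assms(3)]
  have c: "d \<in> carrier M" "e \<in> carrier M" if "d \<in> D" "e \<in> E" for d e using that D(1) E(1) by blast+
  show ?thesis
  proof (rule M.graded_submoduleI)
    show "D <+>\<^bsub>M\<^esub> E \<subseteq> carrier M" using c by (auto simp: set_add_def')
    show "\<zero>\<^bsub>M\<^esub> \<in> D <+>\<^bsub>M\<^esub> E" using set_addI[OF D(2) E(2), of M] by simp
  next
    fix x y assume "x \<in> D <+>\<^bsub>M\<^esub> E" "y \<in> D <+>\<^bsub>M\<^esub> E"
    then obtain d e d' e' where *: "d \<in> D" "e \<in> E" "d' \<in> D" "e' \<in> E" "x = d \<oplus>\<^bsub>M\<^esub> e" "y = d' \<oplus>\<^bsub>M\<^esub> e'"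
      unfolding set_add_def' by blast
    then have "x \<oplus>\<^bsub>M\<^esub> y = (d \<oplus>\<^bsub>M\<^esub> d') \<oplus>\<^bsub>M\<^esub> (e \<oplus>\<^bsub>M\<^esub> e')" using c by (simp add: M.M.a_ac)
    then show "x \<oplus>\<^bsub>M\<^esub> y \<in> D <+>\<^bsub>M\<^esub> E" using set_addI[OF D(3)[OF *(1,3)] E(3)[OF *(2,4)]] by simp
  next
    fix x a assume "x \<in> D <+>\<^bsub>M\<^esub> E" and a: "a \<in> carrier A"
    then obtain d e where *: "d \<in> D" "e \<in> E" "x = d \<oplus>\<^bsub>M\<^esub> e" unfolding set_add_def' by blast
    then have "x \<triangleleft>\<^bsub>M\<^esub> a = d \<triangleleft>\<^bsub>M\<^esub> a \<oplus>\<^bsub>M\<^esub> e \<triangleleft>\<^bsub>M\<^esub> a" using c a by (simp add: M.ract_add_left)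
    then show "x \<triangleleft>\<^bsub>M\<^esub> a \<in> D <+>\<^bsub>M\<^esub> E" using set_addI[OF D(5)[OF *(1) a] E(5)[OF *(2) a]] by simp
  next
    fix x n assume "x \<in> D <+>\<^bsub>M\<^esub> E"
    then obtain d e where *: "d \<in> D" "e \<in> E" "x = d \<oplus>\<^bsub>M\<^esub> e" unfolding set_add_def' by blast
    then have "hproj M n x = hproj M n d \<oplus>\<^bsub>M\<^esub> hproj M n e" using c by (simp add: M.hproj_add)
    then show "hproj M n x \<in> D <+>\<^bsub>M\<^esub> E" using set_addI[OF D(6)[OF *(1)] E(6)[OF *(2)]] by simp
  qed
qed

text \<open>Agreement modulo torsion becomes agreement on a smaller domain: if the values at
  \<open>m s\<close> differ by \<open>w\<close> in \<open>W\<close>, a multiplier \<open>t\<close>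
  killing \<open>w\<close> makes them equal at \<open>m s t\<close>, and \<open>s t\<close> is again
  in \<open>S\<close>.\<close>

lemma mult_dense_Domain_Int:
  assumes M: "gmod M" and N: "gmod N" and gr: "graded_relation A M N \<Gamma>" "graded_relation A M N \<Delta>"
    and D: "mult_dense \<S> M D" "D \<subseteq> carrier M" and W: "mult_torsion \<S> N W" "W \<subseteq> carrier N"
    and close: "\<And>m. m \<in> D \<Longrightarrow> \<exists>n n' w. (m, n) \<in> \<Gamma> \<and> (m, n') \<in> \<Delta> \<and> w \<in> W \<and> n = w \<oplus>\<^bsub>N\<^esub> n'"
  shows "mult_dense \<S> M (Domain (\<Gamma> \<inter> \<Delta>))"
  unfolding mult_dense_def
proof (intro ballI)
  interpret M: graded_right_module A M by fact
  interpret N: graded_right_module A N by fact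
  fix S m assume S: "S \<in> \<S>" and m: "m \<in> carrier M"
  obtain s where s: "s \<in> S" "m \<triangleleft>\<^bsub>M\<^esub> s \<in> D" using D S m unfolding mult_dense_def by blast
  obtain n n' w where n: "(m \<triangleleft>\<^bsub>M\<^esub> s, n) \<in> \<Gamma>" "(m \<triangleleft>\<^bsub>M\<^esub> s, n') \<in> \<Delta>" "w \<in> W" "n = w \<oplus>\<^bsub>N\<^esub> n'"
    using close[OF s(2)] by blast
  obtain t where t: "t \<in> S" "w \<triangleleft>\<^bsub>N\<^esub> t = \<zero>\<^bsub>N\<^esub>" using W S n unfolding mult_torsion_def by blast
  have c: "s \<in> carrier A" "t \<in> carrier A" using s t S mult_subset by blast+
  have n': "n' \<in> carrier N" "w \<in> carrier N" using n graded_relationD(2)[OF gr(2)] W(2) by blast+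
  have "n \<triangleleft>\<^bsub>N\<^esub> t = n' \<triangleleft>\<^bsub>N\<^esub> t" using n t n' c by (simp add: N.ract_add_left N.ract_closed)
  then have "((m \<triangleleft>\<^bsub>M\<^esub> s) \<triangleleft>\<^bsub>M\<^esub> t, n \<triangleleft>\<^bsub>N\<^esub> t) \<in> \<Gamma> \<inter> \<Delta>"
    using graded_relationD(5)[OF gr(1) n(1) c(2)] graded_relationD(5)[OF gr(2) n(2) c(2)] by simp
  then have "m \<triangleleft>\<^bsub>M\<^esub> (s \<otimes>\<^bsub>A\<^esub> t) \<in> Domain (\<Gamma> \<inter> \<Delta>)" using ract2(1)[OF M S s(1) t(1) m] by (metis DomainI)
  then show "\<exists>s\<in>S. m \<triangleleft>\<^bsub>M\<^esub> s \<in> Domain (\<Gamma> \<inter> \<Delta>)" using mult_closed[OF S s(1) t(1)] by blast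
qed

lemma qmorD:
  assumes "qmor A \<S> M N \<Gamma>"
  shows "graded_relation A M N \<Gamma>" "mult_dense \<S> M (Domain \<Gamma>)" "mult_torsion \<S> N (\<Gamma> `` {\<zero>\<^bsub>M\<^esub>})"
  using assms unfolding qmor_def by auto

lemma qmor_Int:
  assumes "qmor A \<S> M N \<Gamma>" "graded_relation A M N \<Delta>" "mult_dense \<S> M (Domain (\<Gamma> \<inter> \<Delta>))"
  shows "qmor A \<S> M N (\<Gamma> \<inter> \<Delta>)"
proof -
  have "mult_torsion \<S> N ((\<Gamma> \<inter> \<Delta>) `` {\<zero>\<^bsub>M\<^esub>})"
    using qmorD(3)[OF assms(1)] unfolding mult_torsion_def by auto
  then show ?thesis unfolding qmor_def
    using graded_relation_Int[OF qmorD(1)[OF assms(1)] assms(2)] assms(3) by blast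
qed

lemma Domain_carrier: "graded_relation A M N \<Gamma> \<Longrightarrow> Domain \<Gamma> \<subseteq> carrier M"
  and image_carrier: "graded_relation A M N \<Gamma> \<Longrightarrow> \<Gamma> `` K \<subseteq> carrier N"
  unfolding graded_relation_def by auto

text \<open>On the common domain of the two intersections both chosen values are partners of
  \<open>m\<close> under \<Delta>. They differ by an element of the fibre of \<Delta> over zero,
  which is torsion, and \<open>mult_dense_Domain_Int\<close> removes the difference.\<close>

lemma qmor_Int_trans:
  assumes M: "gmod M" and N: "gmod N" and q: "qmor A \<S> M N \<Gamma>" "qmor A \<S> M N \<Delta>" "qmor A \<S> M N \<Theta>"
    and i: "qmor A \<S> M N (\<Gamma> \<inter> \<Delta>)" "qmor A \<S> M N (\<Delta> \<inter> \<Theta>)"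
  shows "qmor A \<S> M N (\<Gamma> \<inter> \<Theta>)"
proof (rule qmor_Int[OF q(1) qmorD(1)[OF q(3)]])
  interpret N: graded_right_module A N by fact
  interpret M: graded_right_module A M by fact
  note G = qmorD[OF q(1)] and D = qmorD[OF q(2)] and T = qmorD[OF q(3)]
  show "mult_dense \<S> M (Domain (\<Gamma> \<inter> \<Theta>))"
  proof (rule mult_dense_Domain_Int[OF M N G(1) T(1) _ _ D(3) image_carrier[OF D(1)]])
    let ?D = "Domain (\<Gamma> \<inter> \<Delta>) \<inter> Domain (\<Delta> \<inter> \<Theta>)"
    show "mult_dense \<S> M ?D"
      using mult_dense_Int[OF M Domain_submodule[OF M N qmorD(1)[OF i(1)]] Domain_submodule[OF M N qmorD(1)[OF i(2)]]]
        qmorD(2)[OF i(1)] qmorD(2)[OF i(2)] by blast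
    show "?D \<subseteq> carrier M" using Domain_carrier[OF qmorD(1)[OF i(1)]] by blast
    fix m assume "m \<in> ?D"
    then obtain n n' where n: "(m, n) \<in> \<Gamma>" "(m, n) \<in> \<Delta>" "(m, n') \<in> \<Delta>" "(m, n') \<in> \<Theta>" by blast
    have c: "m \<in> carrier M" "n \<in> carrier N" "n' \<in> carrier N" using graded_relationD(1,2)[OF D(1)] n by blast+
    have "(m \<ominus>\<^bsub>M\<^esub> m, n \<ominus>\<^bsub>N\<^esub> n') \<in> \<Delta>" by (rule graded_relation_minus[OF M N D(1) n(2,3)])
    then have "n \<ominus>\<^bsub>N\<^esub> n' \<in> \<Delta> `` {\<zero>\<^bsub>M\<^esub>}" using c by (simp add: M.M.minus_eq M.M.r_neg)
    moreover have "n = (n \<ominus>\<^bsub>N\<^esub> n') \<oplus>\<^bsub>N\<^esub> n'" using c by (simp add: N.M.minus_eq N.M.a_assoc N.M.l_neg)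
    ultimately show "\<exists>n n' w. (m, n) \<in> \<Gamma> \<and> (m, n') \<in> \<Theta> \<and> w \<in> \<Delta> `` {\<zero>\<^bsub>M\<^esub>} \<and> n = w \<oplus>\<^bsub>N\<^esub> n'"
      using n by blast
  qed
qed

text \<open>Replaces the search for \<open>M3\<close> and \<open>N3\<close> by one condition. Equal
  transition maps mean that the values agree modulo the torsion submodule \<open>N3\<close>, so the
  relations meet over a dense domain. Conversely that domain and \<open>N1 + N2\<close> are suitable
  witnesses.\<close>

lemma qrel_iff:
  assumes M: "gmod M" and N: "gmod N" and r: "r1 \<in> qreps A M N" "r2 \<in> qreps A M N"
  shows "(r1, r2) \<in> qrel A M N \<longleftrightarrow> qmor A \<S> M N (rel_of r1 \<inter> rel_of r2)"
proof -
  interpret N: graded_right_module A N by fact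
  interpret M: graded_right_module A M by fact
  obtain M1 N1 \<phi>1 M2 N2 \<phi>2 where re: "r1 = (M1, N1, \<phi>1)" "r2 = (M2, N2, \<phi>2)" by (cases r1, cases r2)
  note q = qreps_rel_of(1)[OF M N r(1)] qreps_rel_of(1)[OF M N r(2)]
  note g1 = qmorD(1)[OF q(1)] and g2 = qmorD(1)[OF q(2)]
  have q1: "(Domain (rel_of r1), rel_of r1 `` {\<zero>\<^bsub>M\<^esub>}, \<lambda>m\<in>Domain (rel_of r1). rel_of r1 `` {m}) = r1"
    and q2: "(Domain (rel_of r2), rel_of r2 `` {\<zero>\<^bsub>M\<^esub>}, \<lambda>m\<in>Domain (rel_of r2). rel_of r2 `` {m}) = r2"
    using qreps_rel_of(2)[OF M N r(1)] qreps_rel_of(2)[OF M N r(2)] unfolding qrep_of_def by auto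
  have dom: "Domain (rel_of r1) = M1" "Domain (rel_of r2) = M2"
    "rel_of r1 `` {\<zero>\<^bsub>M\<^esub>} = N1" "rel_of r2 `` {\<zero>\<^bsub>M\<^esub>} = N2"
    using q1 q2 unfolding re by auto
  have mem: "(m, n) \<in> rel_of r1 \<longleftrightarrow> m \<in> M1 \<and> n \<in> \<phi>1 m" "(m, n) \<in> rel_of r2 \<longleftrightarrow> m \<in> M2 \<and> n \<in> \<phi>2 m" for m n
    by (auto simp: re)
  show ?thesis
  proof
    assume "(r1, r2) \<in> qrel A M N"
    then obtain M3 N3 where 3: "M3 \<in> cotorsion_submodules A M" "N3 \<in> torsion_submodules A N"
      "M3 \<subseteq> M1 \<inter> M2" "N1 \<union> N2 \<subseteq> N3" and tr: "transition N M3 N3 \<phi>1 = transition N M3 N3 \<phi>2"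
      unfolding re qrel_def by auto
    have M3: "graded_submodule A M M3" "mult_dense \<S> M M3"
      and N3: "graded_submodule A N N3" "mult_torsion \<S> N N3"
      using 3 in_cotorsion[OF M] in_torsion[OF N] by blast+
    note N3D = N.graded_submoduleD[OF N3(1)]
    show "qmor A \<S> M N (rel_of r1 \<inter> rel_of r2)"
    proof (rule qmor_Int[OF q(1) g2], rule mult_dense_Domain_Int[OF M N g1 g2 M3(2) _ N3(2) N3D(1)])
      show "M3 \<subseteq> carrier M" using M.graded_submoduleD(1)[OF M3(1)] .
      fix m assume m: "m \<in> M3"
      then obtain n where n: "(m, n) \<in> rel_of r1" using dom(1) 3(3) by blast
      then have "n \<in> N3 <+>\<^bsub>N\<^esub> \<phi>1 m"
        using set_addI[OF N3D(2), of n "\<phi>1 m" N] mem(1)[of m n] n graded_relationD(2)[OF g1 n] by simp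
      moreover have "N3 <+>\<^bsub>N\<^esub> \<phi>1 m = N3 <+>\<^bsub>N\<^esub> \<phi>2 m"
        using fun_cong[OF tr, of m] m unfolding transition_def by simp
      ultimately obtain w n' where "w \<in> N3" "n' \<in> \<phi>2 m" "n = w \<oplus>\<^bsub>N\<^esub> n'" unfolding set_add_def' by blast
      then show "\<exists>n n' w. (m, n) \<in> rel_of r1 \<and> (m, n') \<in> rel_of r2 \<and> w \<in> N3 \<and> n = w \<oplus>\<^bsub>N\<^esub> n'"
        using n m 3(3) mem by blast
    qed
  next
    assume i: "qmor A \<S> M N (rel_of r1 \<inter> rel_of r2)"
    \<comment> \<open>The domain on which both relations share a value, and the least submodule that
      contains both indeterminacies.\<close>
    let ?M3 = "Domain (rel_of r1 \<inter> rel_of r2)" and ?N3 = "N1 <+>\<^bsub>N\<^esub> N2"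
    have N12: "graded_submodule A N N1" "mult_torsion \<S> N N1" "graded_submodule A N N2" "mult_torsion \<S> N N2"
      using image_zero_submodule[OF M N g1] image_zero_submodule[OF M N g2] qmorD(3)[OF q(1)] qmorD(3)[OF q(2)]
      unfolding dom by auto
    note D1 = N.graded_submoduleD[OF N12(1)] and D2 = N.graded_submoduleD[OF N12(3)]
    have M3: "?M3 \<in> cotorsion_submodules A M"
      using Domain_submodule[OF M N qmorD(1)[OF i]] qmorD(2)[OF i] in_cotorsion[OF M] by blast
    have N3g: "graded_submodule A N ?N3" by (rule graded_submodule_sum[OF N N12(1,3)])
    have N3: "?N3 \<in> torsion_submodules A N"
      using N3g mult_torsion_sum[OF N D1(1) D2(1) N12(2,4)] in_torsion[OF N] by blast
    have N1N3: "N1 \<subseteq> ?N3"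
    proof
      fix x assume x: "x \<in> N1"
      then have "x = x \<oplus>\<^bsub>N\<^esub> \<zero>\<^bsub>N\<^esub>" using D1(1) by (metis N.M.r_zero subsetD)
      then show "x \<in> ?N3" unfolding set_add_def' using x D2(2) by blast
    qed
    have N2N3: "N2 \<subseteq> ?N3"
    proof
      fix x assume x: "x \<in> N2"
      then have "x = \<zero>\<^bsub>N\<^esub> \<oplus>\<^bsub>N\<^esub> x" using D2(1) by (metis N.M.l_zero subsetD)
      then show "x \<in> ?N3" unfolding set_add_def' using x D1(2) by blast
    qed
    note D3 = N.graded_submoduleD[OF N3g]
    \<comment> \<open>A fibre is a coset of the fibre over zero, which lies in \<open>?N3\<close>.
      Adding \<open>?N3\<close> therefore leaves one coset of \<open>?N3\<close>, determined by any
      single value \<open>n\<close>; a value common to both relations gives the same coset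
      twice.\<close>
    have absorb: "?N3 <+>\<^bsub>N\<^esub> rel `` {m} = {w \<oplus>\<^bsub>N\<^esub> n | w. w \<in> ?N3}"
      if rel: "graded_relation A M N rel" "(m, n) \<in> rel" "rel `` {\<zero>\<^bsub>M\<^esub>} \<subseteq> ?N3" for rel m n
    proof -
      interpret K: graded_quotient A N "rel `` {\<zero>\<^bsub>M\<^esub>}"
        by (rule graded_quotientI[OF N image_zero_submodule[OF M N rel(1)]])
      have n: "n \<in> carrier N" using graded_relationD(2)[OF rel(1,2)] .
      show ?thesis
      proof (intro subset_antisym subsetI)
        fix x assume "x \<in> ?N3 <+>\<^bsub>N\<^esub> rel `` {m}"
        then obtain w n' where w: "w \<in> ?N3" "n' \<in> K.coset n" "x = w \<oplus>\<^bsub>N\<^esub> n'"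
          unfolding image_coset[OF M N rel(1,2)] set_add_def'[of _ ?N3] by blast
        then obtain w' where w': "w' \<in> ?N3" "n' = w' \<oplus>\<^bsub>N\<^esub> n"
          using rel(3) unfolding K.coset_eq by blast
        have "x = (w \<oplus>\<^bsub>N\<^esub> w') \<oplus>\<^bsub>N\<^esub> n"
          using w w' n subsetD[OF D3(1)] by (simp add: N.M.a_assoc)
        then show "x \<in> {w \<oplus>\<^bsub>N\<^esub> n | w. w \<in> ?N3}" using D3(3)[OF w(1) w'(1)] by blast
      next
        fix x assume "x \<in> {w \<oplus>\<^bsub>N\<^esub> n | w. w \<in> ?N3}"
        then show "x \<in> ?N3 <+>\<^bsub>N\<^esub> rel `` {m}" using rel(2) unfolding set_add_def'[of _ ?N3] by blast
      qed
    qed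
    have "?N3 <+>\<^bsub>N\<^esub> \<phi>1 m = ?N3 <+>\<^bsub>N\<^esub> \<phi>2 m" if m: "m \<in> ?M3" for m
    proof -
      obtain n where n: "(m, n) \<in> rel_of r1" "(m, n) \<in> rel_of r2" using m by blast
      have "rel_of r1 `` {m} = \<phi>1 m" "rel_of r2 `` {m} = \<phi>2 m" using n mem by blast+
      then show ?thesis using absorb[OF g1 n(1)] absorb[OF g2 n(2)] N1N3 N2N3 dom by simp
    qed
    then have tr: "transition N ?M3 ?N3 \<phi>1 = transition N ?M3 ?N3 \<phi>2"
      unfolding transition_def by (intro restrict_ext)
    have "?M3 \<subseteq> M1 \<inter> M2" using dom by blast
    then show "(r1, r2) \<in> qrel A M N"
      using r M3 N3 tr N1N3 N2N3 unfolding re qrel_def by blast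
  qed
qed

end

section \<open>The operations of the quotient category on relations\<close>

definition rel_add :: "('a, 'm) gr_module \<Rightarrow> ('m \<times> 'm) set \<Rightarrow> ('m \<times> 'm) set \<Rightarrow> ('m \<times> 'm) set" where
  "rel_add N \<Gamma> \<Delta> = {(m, n \<oplus>\<^bsub>N\<^esub> n') | m n n'. (m, n) \<in> \<Gamma> \<and> (m, n') \<in> \<Delta>}"

text \<open>As in \<open>qrep_scale\<close>, the scalar acts on the source. The condition on the
  domain matters for \<open>c = 0\<close>: every multiple is then zero, and without it the domain
  would become all of \<open>M\<close>.\<close>

definition rel_scale ::
    "('k, 'a) gr_algebra \<Rightarrow> ('a, 'm) gr_module \<Rightarrow> 'k \<Rightarrow> ('m \<times> 'm) set \<Rightarrow> ('m \<times> 'm) set" where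
  "rel_scale A M c \<Gamma> = {(m, n). m \<in> Domain \<Gamma> \<and> (m \<triangleleft>\<^bsub>M\<^esub> scal A c, n) \<in> \<Gamma>}"

lemma UN_singleton_class: "\<lbrakk>r \<in> \<Phi>; \<And>r. r \<in> \<Phi> \<Longrightarrow> F r = C\<rbrakk> \<Longrightarrow> (\<Union>r\<in>\<Phi>. F r) = C"
  by auto

lemma QGrMod_Comp:
  "Comp (QGrMod ty A) M N P \<Psi> \<Phi> = (\<Union>\<psi>\<in>\<Psi>. \<Union>\<phi>\<in>\<Phi>. qrel A M P `` {qrep_comp \<psi> \<phi>})"
  by (simp add: QGrMod_def)

lemma QGrMod_Hom_add:
  "Hom_add (QGrMod ty A) M N \<Phi> \<Phi>' = (\<Union>\<phi>\<in>\<Phi>. \<Union>\<phi>'\<in>\<Phi>'. qrel A M N `` {qrep_add N \<phi> \<phi>'})"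
  by (simp add: QGrMod_def)

lemma QGrMod_Hom_scale:
  "Hom_scale (QGrMod ty A) M N c \<Phi> = (\<Union>\<phi>\<in>\<Phi>. qrel A M N `` {qrep_scale A M c \<phi>})"
  by (simp add: QGrMod_def)

context torsion_theory
begin

lemma cls_Collect:
  assumes "gmod M" "gmod N" "qmor A \<S> M N \<Gamma>"
  shows "cls A M N \<Gamma> = {r \<in> qreps A M N. qmor A \<S> M N (\<Gamma> \<inter> rel_of r)}"
proof -
  have "qrep_of M \<Gamma> \<in> qreps A M N" by (rule qrep_of_qreps[OF assms])
  moreover have "qrel A M N \<subseteq> qreps A M N \<times> qreps A M N" unfolding qrel_def by blast
  ultimately show ?thesis
    unfolding cls_def using qrel_iff[OF assms(1,2), of "qrep_of M \<Gamma>"] by (auto simp: rel_of_qrep_of)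
qed

lemma cls_memD:
  assumes "gmod M" "gmod N" "qmor A \<S> M N \<Gamma>" "r \<in> cls A M N \<Gamma>"
  shows "r \<in> qreps A M N" "qmor A \<S> M N (rel_of r)" "qmor A \<S> M N (\<Gamma> \<inter> rel_of r)" "qrep_of M (rel_of r) = r"
  using assms qreps_rel_of[OF assms(1,2)] unfolding cls_Collect[OF assms(1-3)] by auto

lemma cls_self:
  assumes "gmod M" "gmod N" "qmor A \<S> M N \<Gamma>"
  shows "qrep_of M \<Gamma> \<in> cls A M N \<Gamma>"
  unfolding cls_Collect[OF assms] using qrep_of_qreps[OF assms] assms(3) by (simp add: rel_of_qrep_of)

lemma cls_eqI:
  assumes "gmod M" "gmod N" "qmor A \<S> M N \<Gamma>" "qmor A \<S> M N \<Delta>" "qmor A \<S> M N (\<Gamma> \<inter> \<Delta>)"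
  shows "cls A M N \<Gamma> = cls A M N \<Delta>"
proof -
  have i: "qmor A \<S> M N (\<Delta> \<inter> \<Gamma>)" using assms(5) by (simp add: Int_commute)
  have "qmor A \<S> M N (\<Gamma> \<inter> rel_of r) \<longleftrightarrow> qmor A \<S> M N (\<Delta> \<inter> rel_of r)" if r: "r \<in> qreps A M N" for r
  proof -
    note q = qreps_rel_of(1)[OF assms(1,2) r]
    show ?thesis
    proof
      show "qmor A \<S> M N (\<Delta> \<inter> rel_of r)" if "qmor A \<S> M N (\<Gamma> \<inter> rel_of r)"
        by (rule qmor_Int_trans[OF assms(1,2,4,3) q i that])
      show "qmor A \<S> M N (\<Gamma> \<inter> rel_of r)" if "qmor A \<S> M N (\<Delta> \<inter> rel_of r)"
        by (rule qmor_Int_trans[OF assms(1,2,3,4) q assms(5) that])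
    qed
  qed
  then show ?thesis
    unfolding cls_Collect[OF assms(1-3)] cls_Collect[OF assms(1,2,4)] by (intro Collect_cong conj_cong refl)
qed

lemma cls_subset_eq:
  assumes "gmod M" "gmod N" "qmor A \<S> M N \<Gamma>" "qmor A \<S> M N \<Delta>" "\<Gamma> \<subseteq> \<Delta>"
  shows "cls A M N \<Gamma> = cls A M N \<Delta>"
  using cls_eqI[OF assms(1-4)] assms(3,5) by (simp add: Int_absorb2)

lemma Hom_cls:
  assumes "gmod M" "gmod N"
  shows "Hom (QGrMod ty A) M N = {cls A M N \<Gamma> | \<Gamma>. qmor A \<S> M N \<Gamma>}"
proof -
  have "Hom (QGrMod ty A) M N = (\<lambda>r. qrel A M N `` {r}) ` qreps A M N"
    by (auto simp: QGrMod_def quotient_def)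
  also have "\<dots> = {cls A M N \<Gamma> | \<Gamma>. qmor A \<S> M N \<Gamma>}"
  proof (intro subset_antisym subsetI)
    fix \<Phi> assume "\<Phi> \<in> (\<lambda>r. qrel A M N `` {r}) ` qreps A M N"
    then obtain r where r: "r \<in> qreps A M N" "\<Phi> = qrel A M N `` {r}" by (rule imageE)
    then have "\<Phi> = cls A M N (rel_of r)" unfolding cls_def using qreps_rel_of(2)[OF assms r(1)] by simp
    then show "\<Phi> \<in> {cls A M N \<Gamma> | \<Gamma>. qmor A \<S> M N \<Gamma>}" using qreps_rel_of(1)[OF assms r(1)] by auto
  next
    fix \<Phi> assume "\<Phi> \<in> {cls A M N \<Gamma> | \<Gamma>. qmor A \<S> M N \<Gamma>}"
    then obtain \<Gamma> where "\<Phi> = cls A M N \<Gamma>" "qmor A \<S> M N \<Gamma>" by auto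
    then show "\<Phi> \<in> (\<lambda>r. qrel A M N `` {r}) ` qreps A M N"
      using qrep_of_qreps[OF assms] unfolding cls_def by auto
  qed
  finally show ?thesis .
qed

lemma qmor_Id:
  assumes M: "gmod M"
  shows "qmor A \<S> M M (Id_on (carrier M))"
proof -
  interpret M: graded_right_module A M by fact
  have "mult_dense \<S> M (Domain (Id_on (carrier M)))"
    unfolding mult_dense_def using mult_subset mult_one by (auto simp: M.ract_closed subset_eq)
  moreover have "mult_torsion \<S> M (Id_on (carrier M) `` {\<zero>\<^bsub>M\<^esub>})"
    unfolding mult_torsion_def using mult_subset mult_one by (auto simp: M.ract_one intro!: bexI[of _ "\<one>\<^bsub>A\<^esub>"])
  moreover have "graded_relation A M M (Id_on (carrier M))"
    by (rule graded_relationI) (auto simp: M.ract_closed M.hproj_closed)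
  ultimately show ?thesis unfolding qmor_def by blast
qed

text \<open>Multipliers are applied one after the other. A first one brings \<open>m\<close> into
  the domain of \<Gamma>, a second one brings the value into the domain of \<Delta>. Over zero, a
  first one kills the intermediate element, which moves the end into the fibre of \<Delta> over
  zero, and a second one kills that.\<close>

lemma qmor_comp:
  assumes M: "gmod M" and N: "gmod N" and P: "gmod P"
    and q: "qmor A \<S> M N \<Gamma>" "qmor A \<S> N P \<Delta>"
  shows "qmor A \<S> M P (\<Gamma> O \<Delta>)"
proof -
  interpret M: graded_right_module A M by fact
  interpret N: graded_right_module A N by fact
  interpret P: graded_right_module A P by fact
  note g = qmorD(1)[OF q(1)] and d = qmorD(1)[OF q(2)]
  note gD = graded_relationD[OF g] and dD = graded_relationD[OF d]
  have gr: "graded_relation A M P (\<Gamma> O \<Delta>)"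
  proof (rule graded_relationI)
    fix m n m' n' assume "(m, n) \<in> \<Gamma> O \<Delta>" "(m', n') \<in> \<Gamma> O \<Delta>"
    then obtain k k' where "(m, k) \<in> \<Gamma>" "(k, n) \<in> \<Delta>" "(m', k') \<in> \<Gamma>" "(k', n') \<in> \<Delta>" by blast
    then show "(m \<oplus>\<^bsub>M\<^esub> m', n \<oplus>\<^bsub>P\<^esub> n') \<in> \<Gamma> O \<Delta>" using gD(4) dD(4) by (meson relcompI)
  next
    fix m n a assume "(m, n) \<in> \<Gamma> O \<Delta>" "a \<in> carrier A"
    then show "(m \<triangleleft>\<^bsub>M\<^esub> a, n \<triangleleft>\<^bsub>P\<^esub> a) \<in> \<Gamma> O \<Delta>" using gD(5) dD(5) by (meson relcompI relcompEpair)
  next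
    fix m n i assume "(m, n) \<in> \<Gamma> O \<Delta>"
    then show "(hproj M i m, hproj P i n) \<in> \<Gamma> O \<Delta>" using gD(6) dD(6) by (meson relcompI relcompEpair)
  qed (use gD(1-3) dD(1-3) in auto)
  have "mult_dense \<S> M (Domain (\<Gamma> O \<Delta>))"
    unfolding mult_dense_def
  proof (intro ballI)
    fix S m assume S: "S \<in> \<S>" and m: "m \<in> carrier M"
    obtain s n where s: "s \<in> S" "(m \<triangleleft>\<^bsub>M\<^esub> s, n) \<in> \<Gamma>" using qmorD(2)[OF q(1)] S m unfolding mult_dense_def by blast
    obtain t p where t: "t \<in> S" "(n \<triangleleft>\<^bsub>N\<^esub> t, p) \<in> \<Delta>"
      using qmorD(2)[OF q(2)] S gD(2)[OF s(2)] unfolding mult_dense_def by blast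
    have "((m \<triangleleft>\<^bsub>M\<^esub> s) \<triangleleft>\<^bsub>M\<^esub> t, n \<triangleleft>\<^bsub>N\<^esub> t) \<in> \<Gamma>" using gD(5)[OF s(2)] t(1) S mult_subset by blast
    then have "m \<triangleleft>\<^bsub>M\<^esub> (s \<otimes>\<^bsub>A\<^esub> t) \<in> Domain (\<Gamma> O \<Delta>)" using t(2) ract2(1)[OF M S s(1) t(1) m] by auto
    then show "\<exists>s\<in>S. m \<triangleleft>\<^bsub>M\<^esub> s \<in> Domain (\<Gamma> O \<Delta>)" using mult_closed[OF S s(1) t(1)] by blast
  qed
  moreover have "mult_torsion \<S> P ((\<Gamma> O \<Delta>) `` {\<zero>\<^bsub>M\<^esub>})"
    unfolding mult_torsion_def
  proof (intro ballI)
    fix S p assume S: "S \<in> \<S>" and "p \<in> (\<Gamma> O \<Delta>) `` {\<zero>\<^bsub>M\<^esub>}"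
    then obtain n where n: "(\<zero>\<^bsub>M\<^esub>, n) \<in> \<Gamma>" "(n, p) \<in> \<Delta>" by blast
    obtain s where s: "s \<in> S" "n \<triangleleft>\<^bsub>N\<^esub> s = \<zero>\<^bsub>N\<^esub>"
      using qmorD(3)[OF q(1)] S n unfolding mult_torsion_def by blast
    have "(n \<triangleleft>\<^bsub>N\<^esub> s, p \<triangleleft>\<^bsub>P\<^esub> s) \<in> \<Delta>" using dD(5)[OF n(2)] s S mult_subset by blast
    then obtain t where t: "t \<in> S" "(p \<triangleleft>\<^bsub>P\<^esub> s) \<triangleleft>\<^bsub>P\<^esub> t = \<zero>\<^bsub>P\<^esub>"
      using qmorD(3)[OF q(2)] S s unfolding mult_torsion_def by auto
    then show "\<exists>s\<in>S. p \<triangleleft>\<^bsub>P\<^esub> s = \<zero>\<^bsub>P\<^esub>"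
      using mult_closed[OF S s(1) t(1)] ract2(1)[OF P S s(1) t(1)] dD(2)[OF n(2)] by metis
  qed
  ultimately show ?thesis unfolding qmor_def using gr by blast
qed

lemma qmor_add:
  assumes M: "gmod M" and N: "gmod N" and q: "qmor A \<S> M N \<Gamma>" "qmor A \<S> M N \<Delta>"
  shows "qmor A \<S> M N (rel_add N \<Gamma> \<Delta>)"
proof -
  interpret M: graded_right_module A M by fact
  interpret N: graded_right_module A N by fact
  note g = qmorD(1)[OF q(1)] and d = qmorD(1)[OF q(2)]
  note gD = graded_relationD[OF g] and dD = graded_relationD[OF d]
  have I: "(m, n \<oplus>\<^bsub>N\<^esub> n') \<in> rel_add N \<Gamma> \<Delta>" if "(m, n) \<in> \<Gamma>" "(m, n') \<in> \<Delta>" for m n n'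
    using that unfolding rel_add_def by blast
  have gr: "graded_relation A M N (rel_add N \<Gamma> \<Delta>)"
  proof (rule graded_relationI)
    show "(\<zero>\<^bsub>M\<^esub>, \<zero>\<^bsub>N\<^esub>) \<in> rel_add N \<Gamma> \<Delta>" using I[OF gD(3) dD(3)] by simp
  next
    fix m n m' n' assume "(m, n) \<in> rel_add N \<Gamma> \<Delta>" "(m', n') \<in> rel_add N \<Gamma> \<Delta>"
    then obtain a b a' b' where *: "(m, a) \<in> \<Gamma>" "(m, b) \<in> \<Delta>" "(m', a') \<in> \<Gamma>" "(m', b') \<in> \<Delta>"
      "n = a \<oplus>\<^bsub>N\<^esub> b" "n' = a' \<oplus>\<^bsub>N\<^esub> b'" unfolding rel_add_def by blast
    have "a \<in> carrier N" "b \<in> carrier N" "a' \<in> carrier N" "b' \<in> carrier N" using * gD(2) dD(2) by metis+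
    then have "n \<oplus>\<^bsub>N\<^esub> n' = (a \<oplus>\<^bsub>N\<^esub> a') \<oplus>\<^bsub>N\<^esub> (b \<oplus>\<^bsub>N\<^esub> b')" using * by (simp add: N.M.a_ac)
    then show "(m \<oplus>\<^bsub>M\<^esub> m', n \<oplus>\<^bsub>N\<^esub> n') \<in> rel_add N \<Gamma> \<Delta>" using I[OF gD(4)[OF *(1,3)] dD(4)[OF *(2,4)]] by simp
  next
    fix m n a assume "(m, n) \<in> rel_add N \<Gamma> \<Delta>" and a: "a \<in> carrier A"
    then obtain u v where *: "(m, u) \<in> \<Gamma>" "(m, v) \<in> \<Delta>" "n = u \<oplus>\<^bsub>N\<^esub> v" unfolding rel_add_def by blast
    then show "(m \<triangleleft>\<^bsub>M\<^esub> a, n \<triangleleft>\<^bsub>N\<^esub> a) \<in> rel_add N \<Gamma> \<Delta>"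
      using I[OF gD(5)[OF *(1) a] dD(5)[OF *(2) a]] gD(2)[OF *(1)] dD(2)[OF *(2)] a by (simp add: N.ract_add_left)
  next
    fix m n i assume "(m, n) \<in> rel_add N \<Gamma> \<Delta>"
    then obtain u v where *: "(m, u) \<in> \<Gamma>" "(m, v) \<in> \<Delta>" "n = u \<oplus>\<^bsub>N\<^esub> v" unfolding rel_add_def by blast
    then show "(hproj M i m, hproj N i n) \<in> rel_add N \<Gamma> \<Delta>"
      using I[OF gD(6)[OF *(1), of i] dD(6)[OF *(2), of i]] gD(2)[OF *(1)] dD(2)[OF *(2)] by (simp add: N.hproj_add)
  qed (auto simp: rel_add_def gD dD)
  have dom: "Domain (rel_add N \<Gamma> \<Delta>) = Domain \<Gamma> \<inter> Domain \<Delta>"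
    unfolding rel_add_def by blast
  have im: "rel_add N \<Gamma> \<Delta> `` {\<zero>\<^bsub>M\<^esub>} = \<Gamma> `` {\<zero>\<^bsub>M\<^esub>} <+>\<^bsub>N\<^esub> \<Delta> `` {\<zero>\<^bsub>M\<^esub>}"
    unfolding rel_add_def set_add_def' by blast
  show ?thesis
    unfolding qmor_def dom im
    using gr mult_dense_Int[OF M Domain_submodule[OF M N g] Domain_submodule[OF M N d] qmorD(2)[OF q(1)] qmorD(2)[OF q(2)]]
      mult_torsion_sum[OF N image_carrier[OF g] image_carrier[OF d] qmorD(3)[OF q(1)] qmorD(3)[OF q(2)]] by blast
qed

lemma qmor_scale:
  assumes M: "gmod M" and N: "gmod N" and q: "qmor A \<S> M N \<Gamma>"
  shows "qmor A \<S> M N (rel_scale A M c \<Gamma>)"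
proof -
  interpret M: graded_right_module A M by fact
  interpret N: graded_right_module A N by fact
  note g = qmorD(1)[OF q]
  note gD = graded_relationD[OF g]
  note DD = M.graded_submoduleD[OF Domain_submodule[OF M N g]]
  have z: "\<zero>\<^bsub>M\<^esub> \<triangleleft>\<^bsub>M\<^esub> scal A c = \<zero>\<^bsub>M\<^esub>" by (rule M.zero_ract[OF scal_closed])
  have gr: "graded_relation A M N (rel_scale A M c \<Gamma>)"
  proof (rule graded_relationI)
    fix m n m' n' assume "(m, n) \<in> rel_scale A M c \<Gamma>" "(m', n') \<in> rel_scale A M c \<Gamma>"
    then have *: "m \<in> Domain \<Gamma>" "m' \<in> Domain \<Gamma>" "(m \<triangleleft>\<^bsub>M\<^esub> scal A c, n) \<in> \<Gamma>" "(m' \<triangleleft>\<^bsub>M\<^esub> scal A c, n') \<in> \<Gamma>"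
      unfolding rel_scale_def by blast+
    have "m \<in> carrier M" "m' \<in> carrier M" using * DD(1) by blast+
    then show "(m \<oplus>\<^bsub>M\<^esub> m', n \<oplus>\<^bsub>N\<^esub> n') \<in> rel_scale A M c \<Gamma>"
      using DD(3)[OF *(1,2)] gD(4)[OF *(3,4)] unfolding rel_scale_def by (simp add: M.ract_add_left scal_closed)
  next
    fix m n a assume "(m, n) \<in> rel_scale A M c \<Gamma>" and a: "a \<in> carrier A"
    then have *: "m \<in> Domain \<Gamma>" "(m \<triangleleft>\<^bsub>M\<^esub> scal A c, n) \<in> \<Gamma>" unfolding rel_scale_def by blast+
    have m: "m \<in> carrier M" using * DD(1) by blast
    have "(m \<triangleleft>\<^bsub>M\<^esub> scal A c) \<triangleleft>\<^bsub>M\<^esub> a = (m \<triangleleft>\<^bsub>M\<^esub> a) \<triangleleft>\<^bsub>M\<^esub> scal A c"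
      using M.ract_assoc[OF m scal_closed a] M.ract_assoc[OF m a scal_closed] scal_central[OF a] by simp
    then show "(m \<triangleleft>\<^bsub>M\<^esub> a, n \<triangleleft>\<^bsub>N\<^esub> a) \<in> rel_scale A M c \<Gamma>"
      using DD(5)[OF *(1) a] gD(5)[OF *(2) a] unfolding rel_scale_def by simp
  next
    fix m n i assume "(m, n) \<in> rel_scale A M c \<Gamma>"
    then have *: "m \<in> Domain \<Gamma>" "(m \<triangleleft>\<^bsub>M\<^esub> scal A c, n) \<in> \<Gamma>" unfolding rel_scale_def by blast+
    have m: "m \<in> carrier M" using * DD(1) by blast
    have "hproj M i (m \<triangleleft>\<^bsub>M\<^esub> scal A c) = hproj M i m \<triangleleft>\<^bsub>M\<^esub> scal A c"
      using M.hproj_ract[OF m scal_grade scal_closed, of i] by simp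
    then show "(hproj M i m, hproj N i n) \<in> rel_scale A M c \<Gamma>"
      using DD(6)[OF *(1), of i] gD(6)[OF *(2), of i] unfolding rel_scale_def by simp
  next
    show "m \<in> carrier M \<and> n \<in> carrier N" if "(m, n) \<in> rel_scale A M c \<Gamma>" for m n
      using that gD(1,2) unfolding rel_scale_def by auto
    show "(\<zero>\<^bsub>M\<^esub>, \<zero>\<^bsub>N\<^esub>) \<in> rel_scale A M c \<Gamma>"
      unfolding rel_scale_def using z gD(3) by auto
  qed
  have dom: "Domain (rel_scale A M c \<Gamma>) = Domain \<Gamma>"
    unfolding rel_scale_def using DD(5)[OF _ scal_closed] by auto
  have im: "rel_scale A M c \<Gamma> `` {\<zero>\<^bsub>M\<^esub>} = \<Gamma> `` {\<zero>\<^bsub>M\<^esub>}"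
    unfolding rel_scale_def using z by auto
  show ?thesis unfolding qmor_def dom im using gr qmorD(2,3)[OF q] by blast
qed

lemma Ident_cls:
  assumes "gmod M"
  shows "Ident (QGrMod ty A) M = cls A M M (Id_on (carrier M))"
proof -
  interpret M: graded_right_module A M by fact
  have "(\<lambda>m\<in>carrier M. Id_on (carrier M) `` {m}) = (\<lambda>m\<in>carrier M. {m})"
    by (intro restrict_ext) auto
  then have "qrep_of M (Id_on (carrier M)) = (carrier M, {\<zero>\<^bsub>M\<^esub>}, \<lambda>m\<in>carrier M. {m})"
    unfolding qrep_of_def by auto
  then show ?thesis unfolding cls_def by (simp add: QGrMod_def)
qed

text \<open>\<open>qrep_comp\<close> is the composition of graphs. Its value on arbitrary members of
  the two classes is compared with \<open>\<Gamma> O \<Delta>\<close> through the composite of the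
  intersections, which is a morphism contained in both. Addition and scaling are treated by the same
  sandwich.\<close>

lemma Comp_cls:
  assumes M: "gmod M" and N: "gmod N" and P: "gmod P"
    and q: "qmor A \<S> M N \<Gamma>" "qmor A \<S> N P \<Delta>"
  shows "Comp (QGrMod ty A) M N P (cls A N P \<Delta>) (cls A M N \<Gamma>) = cls A M P (\<Gamma> O \<Delta>)"
proof -
  have "qrel A M P `` {qrep_comp \<psi> \<phi>} = cls A M P (\<Gamma> O \<Delta>)"
    if \<psi>: "\<psi> \<in> cls A N P \<Delta>" and \<phi>: "\<phi> \<in> cls A M N \<Gamma>" for \<psi> \<phi>
  proof -
    note 1 = cls_memD[OF N P q(2) \<psi>] and 2 = cls_memD[OF M N q(1) \<phi>]
    obtain N2 P1 g M1 N1 f where e: "\<psi> = (N2, P1, g)" "\<phi> = (M1, N1, f)" by (cases \<psi>, cases \<phi>)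
    have M1: "Domain (rel_of \<phi>) = M1" and N1: "rel_of \<phi> `` {\<zero>\<^bsub>M\<^esub>} = N1" and N2: "Domain (rel_of \<psi>) = N2"
      using 1(4) 2(4) unfolding e qrep_of_def by auto
    define M3 where "M3 = {m \<in> M1. f m \<inter> N2 \<noteq> {}}"
    have dom: "Domain (rel_of \<phi> O rel_of \<psi>) = M3"
      unfolding M3_def using M1 N2 unfolding e by auto
    have im: "(rel_of \<phi> O rel_of \<psi>) `` {\<zero>\<^bsub>M\<^esub>} = (\<Union>n\<in>N1 \<inter> N2. g n)"
      using N1 N2 unfolding e by auto
    have "(rel_of \<phi> O rel_of \<psi>) `` {m} = (\<Union>n\<in>f m \<inter> N2. g n)" if "m \<in> M3" for m
      using that unfolding M3_def e by auto
    then have "qrep_comp \<psi> \<phi> = qrep_of M (rel_of \<phi> O rel_of \<psi>)"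
      unfolding qrep_of_def dom im unfolding e by (auto simp: Let_def M3_def intro!: restrict_ext)
    then have "qrel A M P `` {qrep_comp \<psi> \<phi>} = cls A M P (rel_of \<phi> O rel_of \<psi>)" by (simp add: cls_def)
    also have "\<dots> = cls A M P ((\<Gamma> \<inter> rel_of \<phi>) O (\<Delta> \<inter> rel_of \<psi>))"
      by (rule cls_subset_eq[OF M P, symmetric])
        (use qmor_comp[OF M N P 2(3) 1(3)] qmor_comp[OF M N P 2(2) 1(2)] in auto)
    also have "\<dots> = cls A M P (\<Gamma> O \<Delta>)"
      by (rule cls_subset_eq[OF M P])
        (use qmor_comp[OF M N P 2(3) 1(3)] qmor_comp[OF M N P q] in auto)
    finally show ?thesis .
  qed
  then have "(\<Union>\<phi>\<in>cls A M N \<Gamma>. qrel A M P `` {qrep_comp \<psi> \<phi>}) = cls A M P (\<Gamma> O \<Delta>)"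
    if "\<psi> \<in> cls A N P \<Delta>" for \<psi>
    using cls_self[OF M N q(1)] that by auto
  then show ?thesis
    unfolding QGrMod_Comp by (rule UN_singleton_class[OF cls_self[OF N P q(2)]])
qed

lemma Hom_add_cls:
  assumes M: "gmod M" and N: "gmod N" and q: "qmor A \<S> M N \<Gamma>" "qmor A \<S> M N \<Delta>"
  shows "Hom_add (QGrMod ty A) M N (cls A M N \<Gamma>) (cls A M N \<Delta>) = cls A M N (rel_add N \<Gamma> \<Delta>)"
proof -
  have "qrel A M N `` {qrep_add N \<phi> \<psi>} = cls A M N (rel_add N \<Gamma> \<Delta>)"
    if \<psi>: "\<psi> \<in> cls A M N \<Delta>" and \<phi>: "\<phi> \<in> cls A M N \<Gamma>" for \<psi> \<phi>
  proof -
    note 1 = cls_memD[OF M N q(2) \<psi>] and 2 = cls_memD[OF M N q(1) \<phi>]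
    obtain M2 N2 g M1 N1 f where e: "\<psi> = (M2, N2, g)" "\<phi> = (M1, N1, f)" by (cases \<psi>, cases \<phi>)
    have M1: "Domain (rel_of \<phi>) = M1" and N1: "rel_of \<phi> `` {\<zero>\<^bsub>M\<^esub>} = N1"
      and M2: "Domain (rel_of \<psi>) = M2" and N2: "rel_of \<psi> `` {\<zero>\<^bsub>M\<^esub>} = N2"
      using 1(4) 2(4) unfolding e qrep_of_def by auto
    have dom: "Domain (rel_add N (rel_of \<phi>) (rel_of \<psi>)) = M1 \<inter> M2"
      unfolding rel_add_def M1[symmetric] M2[symmetric] by blast
    have im: "rel_add N (rel_of \<phi>) (rel_of \<psi>) `` {\<zero>\<^bsub>M\<^esub>} = N1 <+>\<^bsub>N\<^esub> N2"
      unfolding rel_add_def N1[symmetric] N2[symmetric] set_add_def' by blast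
    have "rel_add N (rel_of \<phi>) (rel_of \<psi>) `` {m} = f m <+>\<^bsub>N\<^esub> g m" if "m \<in> M1 \<inter> M2" for m
      using that unfolding e rel_add_def set_add_def' by auto
    then have "qrep_add N \<phi> \<psi> = qrep_of M (rel_add N (rel_of \<phi>) (rel_of \<psi>))"
      unfolding qrep_of_def dom im unfolding e by (auto intro!: restrict_ext)
    then have "qrel A M N `` {qrep_add N \<phi> \<psi>} = cls A M N (rel_add N (rel_of \<phi>) (rel_of \<psi>))" by (simp add: cls_def)
    also have "\<dots> = cls A M N (rel_add N (\<Gamma> \<inter> rel_of \<phi>) (\<Delta> \<inter> rel_of \<psi>))"
      by (rule cls_subset_eq[OF M N, symmetric])
        (use qmor_add[OF M N 2(3) 1(3)] qmor_add[OF M N 2(2) 1(2)] in \<open>auto simp: rel_add_def\<close>)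
    also have "\<dots> = cls A M N (rel_add N \<Gamma> \<Delta>)"
      by (rule cls_subset_eq[OF M N])
        (use qmor_add[OF M N 2(3) 1(3)] qmor_add[OF M N q] in \<open>auto simp: rel_add_def\<close>)
    finally show ?thesis .
  qed
  then show ?thesis
    unfolding QGrMod_Hom_add
    by (intro UN_singleton_class[OF cls_self[OF M N q(1)]] UN_singleton_class[OF cls_self[OF M N q(2)]])
qed

lemma Hom_scale_cls:
  assumes M: "gmod M" and N: "gmod N" and q: "qmor A \<S> M N \<Gamma>"
  shows "Hom_scale (QGrMod ty A) M N c (cls A M N \<Gamma>) = cls A M N (rel_scale A M c \<Gamma>)"
proof -
  interpret M: graded_right_module A M by fact
  have "qrel A M N `` {qrep_scale A M c \<phi>} = cls A M N (rel_scale A M c \<Gamma>)"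
    if \<phi>: "\<phi> \<in> cls A M N \<Gamma>" for \<phi>
  proof -
    note 2 = cls_memD[OF M N q \<phi>]
    obtain M1 N1 f where e: "\<phi> = (M1, N1, f)" by (cases \<phi>)
    have M1: "Domain (rel_of \<phi>) = M1" and N1: "rel_of \<phi> `` {\<zero>\<^bsub>M\<^esub>} = N1"
      using 2(4) unfolding e qrep_of_def by auto
    have cl: "m \<triangleleft>\<^bsub>M\<^esub> scal A c \<in> M1" if "m \<in> M1" for m
      using M.graded_submoduleD(5)[OF Domain_submodule[OF M N qmorD(1)[OF 2(2)]] _ scal_closed] that M1 by blast
    have sub: "rel_scale A M c (rel_of \<phi>) `` {m} = f (m \<triangleleft>\<^bsub>M\<^esub> scal A c)" if "m \<in> M1" for m
      using that cl[OF that] M1 unfolding rel_scale_def e by auto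
    have dom: "Domain (rel_scale A M c (rel_of \<phi>)) = M1"
    proof (intro subset_antisym subsetI)
      fix m assume m: "m \<in> M1"
      then obtain n where "(m \<triangleleft>\<^bsub>M\<^esub> scal A c, n) \<in> rel_of \<phi>" using cl M1 by blast
      then show "m \<in> Domain (rel_scale A M c (rel_of \<phi>))" using m M1 unfolding rel_scale_def by blast
    qed (use M1 in \<open>auto simp: rel_scale_def\<close>)
    have z: "\<zero>\<^bsub>M\<^esub> \<in> M1" using graded_relationD(3)[OF qmorD(1)[OF 2(2)]] M1 by blast
    have im: "rel_scale A M c (rel_of \<phi>) `` {\<zero>\<^bsub>M\<^esub>} = N1"
      using sub[OF z] N1 z by (simp add: M.zero_ract scal_closed) (auto simp: e)
    have "qrep_scale A M c \<phi> = qrep_of M (rel_scale A M c (rel_of \<phi>))"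
      unfolding qrep_of_def dom im unfolding e using sub by (auto simp: e intro!: restrict_ext)
    then have "qrel A M N `` {qrep_scale A M c \<phi>} = cls A M N (rel_scale A M c (rel_of \<phi>))" by (simp add: cls_def)
    also have "\<dots> = cls A M N (rel_scale A M c (\<Gamma> \<inter> rel_of \<phi>))"
      by (rule cls_subset_eq[OF M N, symmetric])
        (use qmor_scale[OF M N 2(3)] qmor_scale[OF M N 2(2)] in \<open>auto simp: rel_scale_def\<close>)
    also have "\<dots> = cls A M N (rel_scale A M c \<Gamma>)"
      by (rule cls_subset_eq[OF M N])
        (use qmor_scale[OF M N 2(3)] qmor_scale[OF M N q] in \<open>auto simp: rel_scale_def\<close>)
    finally show ?thesis .
  qed
  then show ?thesis
    unfolding QGrMod_Hom_scale by (intro UN_singleton_class[OF cls_self[OF M N q]])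
qed

lemma Obj_QGrMod: "Obj (QGrMod ty A) = {M. gmod M}"
  by (simp add: QGrMod_def)

end

section \<open>Functors and natural isomorphisms given by relations\<close>

locale relation_functor = T: torsion_theory A \<S> ty + T': torsion_theory A' \<S>' ty
  for A :: "('k, 'a) gr_algebra" and \<S> and A' :: "('k, 'b) gr_algebra" and \<S>' and ty :: "'m itself" +
  fixes Fo :: "('a, 'm) gr_module \<Rightarrow> ('b, 'm) gr_module"
    and Fr :: "('a, 'm) gr_module \<Rightarrow> ('a, 'm) gr_module \<Rightarrow> ('m \<times> 'm) set \<Rightarrow> ('m \<times> 'm) set"
  assumes Fo: "T.gmod M \<Longrightarrow> T'.gmod (Fo M)"
    and Fr: "\<lbrakk>T.gmod M; T.gmod N; qmor A \<S> M N \<Gamma>\<rbrakk> \<Longrightarrow> qmor A' \<S>' (Fo M) (Fo N) (Fr M N \<Gamma>)"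
    and Fr_mono: "\<Gamma> \<subseteq> \<Delta> \<Longrightarrow> Fr M N \<Gamma> \<subseteq> Fr M N \<Delta>"
    and Fr_id: "T.gmod M \<Longrightarrow> Id_on (carrier (Fo M)) \<subseteq> Fr M M (Id_on (carrier M))"
    and Fr_comp: "\<lbrakk>T.gmod M; T.gmod N; T.gmod P\<rbrakk> \<Longrightarrow> Fr M N \<Gamma> O Fr N P \<Delta> \<subseteq> Fr M P (\<Gamma> O \<Delta>)"
    and Fr_add: "\<lbrakk>T.gmod M; T.gmod N\<rbrakk> \<Longrightarrow> rel_add (Fo N) (Fr M N \<Gamma>) (Fr M N \<Delta>) \<subseteq> Fr M N (rel_add N \<Gamma> \<Delta>)"
    and Fr_scale: "\<lbrakk>T.gmod M; T.gmod N; qmor A \<S> M N \<Gamma>\<rbrakk> \<Longrightarrow>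
      rel_scale A' (Fo M) c (Fr M N \<Gamma>) \<subseteq> Fr M N (rel_scale A M c \<Gamma>)"
begin

definition Fm :: "('a, 'm) gr_module \<Rightarrow> ('a, 'm) gr_module \<Rightarrow> 'm qrep set \<Rightarrow> 'm qrep set" where
  "Fm M N \<Phi> = cls A' (Fo M) (Fo N) (Fr M N (rel_of (SOME r. r \<in> \<Phi>)))"

text \<open>The chosen member \<open>r\<close> of the class and \<Gamma> share the morphism
  \<open>\<Gamma> \<inter> rel_of r\<close>. By monotonicity its image lies in both images, so these
  represent the same morphism and the choice does not matter.\<close>

lemma Fm_cls:
  assumes M: "T.gmod M" and N: "T.gmod N" and q: "qmor A \<S> M N \<Gamma>"
  shows "Fm M N (cls A M N \<Gamma>) = cls A' (Fo M) (Fo N) (Fr M N \<Gamma>)"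
proof -
  define r where "r = (SOME r. r \<in> cls A M N \<Gamma>)"
  have "r \<in> cls A M N \<Gamma>" unfolding r_def using T.cls_self[OF assms] by (rule someI)
  note r = T.cls_memD[OF assms this]
  note sub = Fr_mono[of "\<Gamma> \<inter> rel_of r" "rel_of r" M N] Fr_mono[of "\<Gamma> \<inter> rel_of r" \<Gamma> M N]
  have "cls A' (Fo M) (Fo N) (Fr M N (rel_of r)) = cls A' (Fo M) (Fo N) (Fr M N (\<Gamma> \<inter> rel_of r))"
    by (rule T'.cls_subset_eq[symmetric]) (use Fo Fr M N q r sub in auto)
  also have "\<dots> = cls A' (Fo M) (Fo N) (Fr M N \<Gamma>)"
    by (rule T'.cls_subset_eq) (use Fo Fr M N q r sub in auto)
  finally show ?thesis unfolding Fm_def r_def .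
qed

text \<open>The locale asks \<open>Fr\<close> to respect the operations only up to inclusion. That
  is enough, since nested relations that are both morphisms have the same class.\<close>

lemma linear_functor: "linear_functor (QGrMod ty A) (QGrMod ty A') Fo Fm"
  unfolding linear_functor_def T.Obj_QGrMod T'.Obj_QGrMod mem_Collect_eq
proof (intro conjI ballI allI)
  fix M assume "M \<in> {M. T.gmod M}"
  then have M: "T.gmod M" by simp
  show "T'.gmod (Fo M)" by (rule Fo[OF M])
  show "Fm M M (Ident (QGrMod ty A) M) = Ident (QGrMod ty A') (Fo M)"
    unfolding T.Ident_cls[OF M] T'.Ident_cls[OF Fo[OF M]] Fm_cls[OF M M T.qmor_Id[OF M]]
    by (rule T'.cls_subset_eq[OF Fo[OF M] Fo[OF M] T'.qmor_Id[OF Fo[OF M]] Fr[OF M M T.qmor_Id[OF M]] Fr_id[OF M], symmetric])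
  fix N assume "N \<in> {M. T.gmod M}"
  then have N: "T.gmod N" by simp
  { fix f assume "f \<in> Hom (QGrMod ty A) M N"
    then obtain \<Gamma> where f: "f = cls A M N \<Gamma>" and q: "qmor A \<S> M N \<Gamma>" unfolding T.Hom_cls[OF M N] by blast
    show "Fm M N f \<in> Hom (QGrMod ty A') (Fo M) (Fo N)"
      unfolding f Fm_cls[OF M N q] T'.Hom_cls[OF Fo[OF M] Fo[OF N]] using Fr[OF M N q] by blast
    show "Fm M N (Hom_scale (QGrMod ty A) M N c f) = Hom_scale (QGrMod ty A') (Fo M) (Fo N) c (Fm M N f)" for c
      unfolding f Fm_cls[OF M N q] T.Hom_scale_cls[OF M N q] Fm_cls[OF M N T.qmor_scale[OF M N q]]
        T'.Hom_scale_cls[OF Fo[OF M] Fo[OF N] Fr[OF M N q]]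
      by (rule T'.cls_subset_eq[OF Fo[OF M] Fo[OF N] T'.qmor_scale[OF Fo[OF M] Fo[OF N] Fr[OF M N q]]
            Fr[OF M N T.qmor_scale[OF M N q]] Fr_scale[OF M N q], symmetric])
    { fix g assume "g \<in> Hom (QGrMod ty A) M N"
      then obtain \<Delta> where g: "g = cls A M N \<Delta>" and d: "qmor A \<S> M N \<Delta>" unfolding T.Hom_cls[OF M N] by blast
      show "Fm M N (Hom_add (QGrMod ty A) M N f g) = Hom_add (QGrMod ty A') (Fo M) (Fo N) (Fm M N f) (Fm M N g)"
        unfolding f g Fm_cls[OF M N q] Fm_cls[OF M N d] T.Hom_add_cls[OF M N q d] Fm_cls[OF M N T.qmor_add[OF M N q d]]
          T'.Hom_add_cls[OF Fo[OF M] Fo[OF N] Fr[OF M N q] Fr[OF M N d]]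
        by (rule T'.cls_subset_eq[OF Fo[OF M] Fo[OF N] T'.qmor_add[OF Fo[OF M] Fo[OF N] Fr[OF M N q] Fr[OF M N d]]
              Fr[OF M N T.qmor_add[OF M N q d]] Fr_add[OF M N], symmetric])
    }
    { fix P g assume "P \<in> {M. T.gmod M}" and g: "g \<in> Hom (QGrMod ty A) N P"
      then have P: "T.gmod P" by simp
      obtain \<Delta> where g: "g = cls A N P \<Delta>" and d: "qmor A \<S> N P \<Delta>" using g unfolding T.Hom_cls[OF N P] by blast
      show "Fm M P (Comp (QGrMod ty A) M N P g f) = Comp (QGrMod ty A') (Fo M) (Fo N) (Fo P) (Fm N P g) (Fm M N f)"
        unfolding f g Fm_cls[OF M N q] Fm_cls[OF N P d] T.Comp_cls[OF M N P q d] Fm_cls[OF M P T.qmor_comp[OF M N P q d]]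
          T'.Comp_cls[OF Fo[OF M] Fo[OF N] Fo[OF P] Fr[OF M N q] Fr[OF N P d]]
        by (rule T'.cls_subset_eq[OF Fo[OF M] Fo[OF P] T'.qmor_comp[OF Fo[OF M] Fo[OF N] Fo[OF P] Fr[OF M N q] Fr[OF N P d]]
              Fr[OF M P T.qmor_comp[OF M N P q d]] Fr_comp[OF M N P], symmetric])
    }
  }
qed

end

context torsion_theory
begin

text \<open>A total, single-valued \<open>E M\<close> satisfies
  \<open>Id \<subseteq> E O E\<inverse>\<close> and \<open>E\<inverse> O E \<subseteq> Id\<close>;
  if \<open>E M\<close> and its converse are morphisms, these inclusions make them inverse
  isomorphisms. Naturality is likewise an inclusion and follows from the pointwise condition
  \<open>nat\<close>. Both directions are recorded because a unit leaves the identity functor while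
  a counit arrives at it.\<close>

lemma natural_isomorphism_of_relations:
  assumes H: "\<And>M. gmod M \<Longrightarrow> gmod (H M)"
    and Hm: "\<And>M N \<Gamma>. \<lbrakk>gmod M; gmod N; qmor A \<S> M N \<Gamma>\<rbrakk> \<Longrightarrow> qmor A \<S> (H M) (H N) (Hr M N \<Gamma>) \<and>
      Hm M N (cls A M N \<Gamma>) = cls A (H M) (H N) (Hr M N \<Gamma>)"
    and E: "\<And>M. gmod M \<Longrightarrow> qmor A \<S> M (H M) (E M) \<and> qmor A \<S> (H M) M ((E M)\<inverse>) \<and>
      Domain (E M) = carrier M \<and> single_valued (E M)"
    and nat: "\<And>M N \<Gamma> m n m' n'. \<lbrakk>gmod M; gmod N; qmor A \<S> M N \<Gamma>; (m, n) \<in> \<Gamma>; (m, m') \<in> E M; (n, n') \<in> E N\<rbrakk> \<Longrightarrow>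
      (m', n') \<in> Hr M N \<Gamma>"
  shows "natural_isomorphism (QGrMod ty A) (QGrMod ty A) (\<lambda>U. U) (\<lambda>U V f. f) H Hm (\<lambda>M. cls A M (H M) (E M))"
    and "natural_isomorphism (QGrMod ty A) (QGrMod ty A) H Hm (\<lambda>U. U) (\<lambda>U V f. f) (\<lambda>M. cls A (H M) M ((E M)\<inverse>))"
proof -
  have 1: "Comp (QGrMod ty A) M (H M) M (cls A (H M) M ((E M)\<inverse>)) (cls A M (H M) (E M)) = Ident (QGrMod ty A) M"
    if M: "gmod M" for M
  proof -
    have "Id_on (carrier M) \<subseteq> E M O (E M)\<inverse>" using E[OF M] by blast
    then show ?thesis
      using E[OF M] H[OF M] M by (simp add: Comp_cls Ident_cls cls_subset_eq[symmetric] qmor_Id qmor_comp[OF M H[OF M] M])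
  qed
  have 2: "Comp (QGrMod ty A) (H M) M (H M) (cls A M (H M) (E M)) (cls A (H M) M ((E M)\<inverse>)) = Ident (QGrMod ty A) (H M)"
    if M: "gmod M" for M
  proof -
    have "(E M)\<inverse> O E M \<subseteq> Id_on (carrier (H M))"
      using E[OF M] image_carrier[OF qmorD(1), of M "H M" "E M" UNIV] by (auto simp: single_valued_def) blast
    then show ?thesis
      using E[OF M] H[OF M] M by (simp add: Comp_cls Ident_cls cls_subset_eq qmor_Id qmor_comp[OF H[OF M] M H[OF M]])
  qed
  have H1: "cls A M (H M) (E M) \<in> Hom (QGrMod ty A) M (H M)"
    and H2: "cls A (H M) M ((E M)\<inverse>) \<in> Hom (QGrMod ty A) (H M) M" if M: "gmod M" for M
    using E[OF M] Hom_cls[OF M H[OF M]] Hom_cls[OF H[OF M] M] by blast+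
  have 3: "Comp (QGrMod ty A) M N (H N) (cls A N (H N) (E N)) (cls A M N \<Gamma>) =
      Comp (QGrMod ty A) M (H M) (H N) (Hm M N (cls A M N \<Gamma>)) (cls A M (H M) (E M))"
    if M: "gmod M" and N: "gmod N" and q: "qmor A \<S> M N \<Gamma>" for M N \<Gamma>
  proof -
    have e: "qmor A \<S> M (H M) (E M)" "qmor A \<S> N (H N) (E N)" using E M N by blast+
    have h: "qmor A \<S> (H M) (H N) (Hr M N \<Gamma>)" using Hm[OF M N q] by blast
    have "\<Gamma> O E N \<subseteq> E M O Hr M N \<Gamma>"
    proof (clarsimp)
      fix m n n' assume *: "(m, n) \<in> \<Gamma>" "(n, n') \<in> E N"
      have "m \<in> Domain (E M)" using graded_relationD(1)[OF qmorD(1)[OF q] *(1)] E[OF M] by blast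
      then show "(m, n') \<in> E M O Hr M N \<Gamma>" using nat[OF M N q *(1) _ *(2)] by blast
    qed
    then show ?thesis
      using Hm[OF M N q] Comp_cls[OF M N H[OF N] q e(2)] Comp_cls[OF M H[OF M] H[OF N] e(1) h]
        cls_subset_eq[OF M H[OF N] qmor_comp[OF M N H[OF N] q e(2)] qmor_comp[OF M H[OF M] H[OF N] e(1) h]] by simp
  qed
  have 4: "Comp (QGrMod ty A) (H M) (H N) N (cls A (H N) N ((E N)\<inverse>)) (Hm M N (cls A M N \<Gamma>)) =
      Comp (QGrMod ty A) (H M) M N (cls A M N \<Gamma>) (cls A (H M) M ((E M)\<inverse>))"
    if M: "gmod M" and N: "gmod N" and q: "qmor A \<S> M N \<Gamma>" for M N \<Gamma>
  proof -
    have e: "qmor A \<S> (H M) M ((E M)\<inverse>)" "qmor A \<S> (H N) N ((E N)\<inverse>)" using E M N by blast+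
    have h: "qmor A \<S> (H M) (H N) (Hr M N \<Gamma>)" using Hm[OF M N q] by blast
    have "(E M)\<inverse> O \<Gamma> \<subseteq> Hr M N \<Gamma> O (E N)\<inverse>"
    proof (clarsimp)
      fix m' m n assume *: "(m, m') \<in> E M" "(m, n) \<in> \<Gamma>"
      have "n \<in> Domain (E N)" using graded_relationD(2)[OF qmorD(1)[OF q] *(2)] E[OF N] by blast
      then show "(m', n) \<in> Hr M N \<Gamma> O (E N)\<inverse>" using nat[OF M N q *(2,1)] by blast
    qed
    then show ?thesis
      using Hm[OF M N q] Comp_cls[OF H[OF M] H[OF N] N h e(2)] Comp_cls[OF H[OF M] M N e(1) q]
        cls_subset_eq[OF H[OF M] N qmor_comp[OF H[OF M] M N e(1) q] qmor_comp[OF H[OF M] H[OF N] N h e(2)]] by simp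
  qed
  show "natural_isomorphism (QGrMod ty A) (QGrMod ty A) (\<lambda>U. U) (\<lambda>U V f. f) H Hm (\<lambda>M. cls A M (H M) (E M))"
    unfolding natural_isomorphism_def isomorphism_def Obj_QGrMod mem_Collect_eq
  proof (intro conjI ballI)
    fix M assume "M \<in> {M. gmod M}"
    then have M: "gmod M" by simp
    show "cls A M (H M) (E M) \<in> Hom (QGrMod ty A) M (H M)" using H1[OF M] .
    show "\<exists>g\<in>Hom (QGrMod ty A) (H M) M.
        Comp (QGrMod ty A) M (H M) M g (cls A M (H M) (E M)) = Ident (QGrMod ty A) M \<and>
        Comp (QGrMod ty A) (H M) M (H M) (cls A M (H M) (E M)) g = Ident (QGrMod ty A) (H M)"
      using H2[OF M] 1[OF M] 2[OF M] by blast
    fix N f assume "N \<in> {M. gmod M}" and "f \<in> Hom (QGrMod ty A) M N"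
    then obtain \<Gamma> where N: "gmod N" and f: "f = cls A M N \<Gamma>" "qmor A \<S> M N \<Gamma>" using Hom_cls[OF M, of N] by auto
    show "Comp (QGrMod ty A) M N (H N) (cls A N (H N) (E N)) f =
        Comp (QGrMod ty A) M (H M) (H N) (Hm M N f) (cls A M (H M) (E M))"
      unfolding f(1) by (rule 3[OF M N f(2)])
  qed
  show "natural_isomorphism (QGrMod ty A) (QGrMod ty A) H Hm (\<lambda>U. U) (\<lambda>U V f. f) (\<lambda>M. cls A (H M) M ((E M)\<inverse>))"
    unfolding natural_isomorphism_def isomorphism_def Obj_QGrMod mem_Collect_eq
  proof (intro conjI ballI)
    fix M assume "M \<in> {M. gmod M}"
    then have M: "gmod M" by simp
    show "cls A (H M) M ((E M)\<inverse>) \<in> Hom (QGrMod ty A) (H M) M" using H2[OF M] .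
    show "\<exists>g\<in>Hom (QGrMod ty A) M (H M).
        Comp (QGrMod ty A) (H M) M (H M) g (cls A (H M) M ((E M)\<inverse>)) = Ident (QGrMod ty A) (H M) \<and>
        Comp (QGrMod ty A) M (H M) M (cls A (H M) M ((E M)\<inverse>)) g = Ident (QGrMod ty A) M"
      using H1[OF M] 1[OF M] 2[OF M] by blast
    fix N f assume "N \<in> {M. gmod M}" and "f \<in> Hom (QGrMod ty A) M N"
    then obtain \<Gamma> where N: "gmod N" and f: "f = cls A M N \<Gamma>" "qmor A \<S> M N \<Gamma>" using Hom_cls[OF M, of N] by auto
    show "Comp (QGrMod ty A) (H M) (H N) N (cls A (H N) N ((E N)\<inverse>)) (Hm M N f) =
        Comp (QGrMod ty A) (H M) M N f (cls A (H M) M ((E M)\<inverse>))"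
      unfolding f(1) by (rule 4[OF M N f(2)])
  qed
qed

end

section \<open>Modules over generalized Weyl algebras\<close>

type_synonym ('k, 'r, 'm) gwa_gr_module = "(('k, 'r) gwa_free set, 'm) gr_module"

lemma poly_mapping_additive_induct:
  fixes p :: "'a \<Rightarrow>\<^sub>0 'b::comm_monoid_add"
  assumes "P 0" "\<And>w c. P (Poly_Mapping.single w c)" "\<And>p q. \<lbrakk>P p; P q\<rbrakk> \<Longrightarrow> P (p + q)"
  shows "P p"
proof (induction p rule: update_induct)
  case (update f a b)
  have "Poly_Mapping.update a b f = f + Poly_Mapping.single a b"
    using update(1) by (intro poly_mapping_eqI)
      (auto simp: lookup_update lookup_add lookup_single when_def in_keys_iff)
  then show ?case using assms update by simp
qed (rule assms(1))

lemma letters_zero: "letters 0 = []"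
  by (simp add: zero_word_def)

lemma ring_of_type_algebra_simps:
  "carrier ring_of_type_algebra = UNIV" "monoid.mult ring_of_type_algebra = (*)"
  "monoid.one ring_of_type_algebra = 1" "ring.zero ring_of_type_algebra = 0"
  "ring.add ring_of_type_algebra = (+)"
  by (auto simp: ring_of_type_algebra_def fun_eq_iff)

section \<open>The presented algebra\<close>

locale gwa_base =
  fixes \<iota> :: "'k::field \<Rightarrow> 'r::comm_ring_1" and \<sigma> :: "'r \<Rightarrow> 'r"
  assumes iota_add: "\<iota> (c + d) = \<iota> c + \<iota> d" and iota_mult: "\<iota> (c * d) = \<iota> c * \<iota> d" and iota_one: "\<iota> 1 = 1"
    and sigma_add: "\<sigma> (r + s) = \<sigma> r + \<sigma> s" and sigma_mult: "\<sigma> (r * s) = \<sigma> r * \<sigma> s"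
    and sigma_iota: "\<sigma> (\<iota> c) = \<iota> c" and bij_sigma: "bij \<sigma>"
begin

abbreviation \<tau> :: "'r \<Rightarrow> 'r" where "\<tau> \<equiv> inv_into UNIV \<sigma>"

abbreviation "F \<equiv> ring_of_type_algebra :: ('k, 'r) gwa_free ring"

abbreviation alg :: "'r \<Rightarrow> ('k, ('k, 'r) gwa_free set) gr_algebra" where "alg \<equiv> gwa \<iota> \<sigma>"

definition q :: "'r \<Rightarrow> ('k, 'r) gwa_free \<Rightarrow> ('k, 'r) gwa_free set" where
  "q f p = gwa_ideal \<iota> \<sigma> f +>\<^bsub>F\<^esub> p"

definition gn :: "'r \<Rightarrow> 'r gwa_gen \<Rightarrow> ('k, 'r) gwa_free set" where "gn f g = q f (gen g)"

lemma iota_zero: "\<iota> 0 = 0" using iota_add[of 0 0] by simp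

lemma ideal_gwa: "ideal (gwa_ideal \<iota> \<sigma> f) F"
  unfolding gwa_ideal_def
  by (rule ring.genideal_ideal[OF ring_ring_of_type_algebra]) (simp add: ring_of_type_algebra_simps)

lemma alg_ops:
  "carrier (alg f) = range (q f)" "q f p \<oplus>\<^bsub>alg f\<^esub> q f p' = q f (p + p')"
  "q f p \<otimes>\<^bsub>alg f\<^esub> q f p' = q f (p * p')" "\<one>\<^bsub>alg f\<^esub> = q f 1" "\<zero>\<^bsub>alg f\<^esub> = q f 0"
  "scal (alg f) c = q f (Poly_Mapping.single 0 c)"
  "grade (alg f) n = {q f p | p. \<forall>w\<in>Poly_Mapping.keys p. word_degree w = n}"
proof -
  interpret I: ideal "gwa_ideal \<iota> \<sigma> f" F by (rule ideal_gwa)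
  show "carrier (alg f) = range (q f)"
    by (auto simp: gwa_simps FactRing_def A_RCOSETS_def' q_def ring_of_type_algebra_simps)
  show "q f p \<oplus>\<^bsub>alg f\<^esub> q f p' = q f (p + p')"
    using I.a_rcos_sum[of p p'] by (simp add: gwa_simps FactRing_def q_def ring_of_type_algebra_simps)
  show "q f p \<otimes>\<^bsub>alg f\<^esub> q f p' = q f (p * p')"
    using I.rcoset_mult_add[of p p'] by (simp add: gwa_simps FactRing_def q_def ring_of_type_algebra_simps)
  show "\<one>\<^bsub>alg f\<^esub> = q f 1" by (simp add: gwa_simps FactRing_def q_def ring_of_type_algebra_simps)
  show "\<zero>\<^bsub>alg f\<^esub> = q f 0"
    using I.a_coset_add_zero[of "gwa_ideal \<iota> \<sigma> f"]
    by (simp add: gwa_simps FactRing_def q_def ring_of_type_algebra_simps)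
  show "scal (alg f) c = q f (Poly_Mapping.single 0 c)" by (simp add: gwa_simps q_def)
  show "grade (alg f) n = {q f p | p. \<forall>w\<in>Poly_Mapping.keys p. word_degree w = n}"
    by (simp add: gwa_simps q_def)
qed

lemma q_mem: "p' \<in> q f p \<longleftrightarrow> p' - p \<in> gwa_ideal \<iota> \<sigma> f"
proof -
  have "p' \<in> q f p \<longleftrightarrow> (\<exists>h\<in>gwa_ideal \<iota> \<sigma> f. p' = h + p)"
    unfolding q_def a_r_coset_def' by (auto simp: ring_of_type_algebra_simps)
  also have "\<dots> \<longleftrightarrow> p' - p \<in> gwa_ideal \<iota> \<sigma> f" by (metis add_diff_cancel_right' diff_add_cancel)
  finally show ?thesis .
qed

lemma q_self: "p \<in> q f p"
  using additive_subgroup.zero_closed[OF ideal.axioms(1)[OF ideal_gwa[of f]]]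
  by (simp add: q_mem ring_of_type_algebra_simps)

lemma q_eqI: "p' - p \<in> gwa_ideal \<iota> \<sigma> f \<Longrightarrow> q f p' = q f p"
proof -
  interpret I: ideal "gwa_ideal \<iota> \<sigma> f" F by (rule ideal_gwa)
  assume "p' - p \<in> gwa_ideal \<iota> \<sigma> f"
  then have "p' \<in> gwa_ideal \<iota> \<sigma> f +>\<^bsub>F\<^esub> p" using q_mem unfolding q_def by blast
  then show ?thesis
    using I.a_repr_independence'[of p' p] unfolding q_def by (simp add: ring_of_type_algebra_simps)
qed

lemma q_relation:
  "p' - p \<in> coef_relations \<iota> \<union> gwa_relations \<sigma> f \<Longrightarrow> q f p' = q f p"
  using ring.genideal_self[OF ring_ring_of_type_algebra, of "coef_relations \<iota> \<union> gwa_relations \<sigma> f"]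
  by (intro q_eqI) (auto simp: gwa_ideal_def ring_of_type_algebra_simps)

lemma gn_closed: "gn f g \<in> carrier (alg f)"
  by (simp add: gn_def alg_ops)

lemma gn_add: "gn f (Coef (r + s)) = gn f (Coef r) \<oplus>\<^bsub>alg f\<^esub> gn f (Coef s)"
  unfolding gn_def alg_ops by (rule q_relation) (auto simp: coef_relations_def)

lemma gn_mult: "gn f (Coef (r * s)) = gn f (Coef r) \<otimes>\<^bsub>alg f\<^esub> gn f (Coef s)"
  unfolding gn_def alg_ops by (rule q_relation) (auto simp: coef_relations_def)

lemma gn_scal: "gn f (Coef (\<iota> c)) = scal (alg f) c"
  unfolding gn_def alg_ops by (rule q_relation) (auto simp: coef_relations_def)

lemma gn_one: "gn f (Coef 1) = \<one>\<^bsub>alg f\<^esub>"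
  using gn_scal[of f 1] by (simp add: iota_one alg_ops)

lemma gn_zero: "gn f (Coef 0) = \<zero>\<^bsub>alg f\<^esub>"
  using gn_scal[of f 0] by (simp add: iota_zero alg_ops)

lemma gn_XY: "gn f GenX \<otimes>\<^bsub>alg f\<^esub> gn f GenY = gn f (Coef f)"
  unfolding gn_def alg_ops by (rule q_relation) (auto simp: gwa_relations_def)

lemma gn_YX: "gn f GenY \<otimes>\<^bsub>alg f\<^esub> gn f GenX = gn f (Coef (\<tau> f))"
  unfolding gn_def alg_ops by (rule q_relation) (auto simp: gwa_relations_def)

lemma gn_X_Coef: "gn f GenX \<otimes>\<^bsub>alg f\<^esub> gn f (Coef r) = gn f (Coef (\<sigma> r)) \<otimes>\<^bsub>alg f\<^esub> gn f GenX"
  unfolding gn_def alg_ops by (rule q_relation) (auto simp: gwa_relations_def)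

lemma gn_Y_Coef: "gn f GenY \<otimes>\<^bsub>alg f\<^esub> gn f (Coef r) = gn f (Coef (\<tau> r)) \<otimes>\<^bsub>alg f\<^esub> gn f GenY"
  unfolding gn_def alg_ops by (rule q_relation) (auto simp: gwa_relations_def)

lemma gn_grade: "gn f g \<in> grade (alg f) (gen_degree g)"
  unfolding gn_def alg_ops
  by (auto simp: gen_def word_degree_def intro!: exI[of _ "gen g"])

lemma grade_alg: "grade (alg f) n \<subseteq> carrier (alg f)"
  by (auto simp: alg_ops)

lemma word_single:
  "Poly_Mapping.single (Word (g # l)) (c::'k) = gen g * Poly_Mapping.single (Word l) c"
  by (simp add: gen_def mult_single plus_word_def)

text \<open>Scalars get no case of their own, since the relations identify the scalar
  \<open>c\<close> with the generator \<open>Coef (\<iota> c)\<close>. Monomials are built by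
  splitting off one letter at a time.\<close>

lemma alg_induct [consumes 1, case_names gen add mult]:
  assumes a: "a \<in> carrier (alg f)"
    and gen: "\<And>g. P (gn f g)"
    and add: "\<And>a b. \<lbrakk>a \<in> carrier (alg f); b \<in> carrier (alg f); P a; P b\<rbrakk> \<Longrightarrow> P (a \<oplus>\<^bsub>alg f\<^esub> b)"
    and mult: "\<And>a b. \<lbrakk>a \<in> carrier (alg f); b \<in> carrier (alg f); P a; P b\<rbrakk> \<Longrightarrow> P (a \<otimes>\<^bsub>alg f\<^esub> b)"
  shows "P a"
proof -
  have scal: "P (q f (Poly_Mapping.single 0 c))" for c
    using gen[of "Coef (\<iota> c)"] by (simp add: gn_scal alg_ops)
  have single: "P (q f (Poly_Mapping.single (Word l) c))" for l c
  proof (induction l)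
    case Nil
    show ?case using scal[of c] by (simp add: zero_word_def)
  next
    case (Cons g l)
    show ?case unfolding word_single alg_ops(3)[symmetric]
      by (rule mult) (use Cons gen[of g] in \<open>auto simp: alg_ops gn_def\<close>)
  qed
  have "P (q f p)" for p
  proof (induction p rule: poly_mapping_additive_induct)
    case 1
    show ?case using scal[of 0] by simp
  next
    case (2 w c)
    show ?case using single[of "letters w" c] by simp
  next
    case (3 p p')
    show ?case unfolding alg_ops(2)[symmetric] by (rule add) (use 3 in \<open>auto simp: alg_ops\<close>)
  qed
  then show ?thesis using a by (auto simp: alg_ops)
qed

lemma scal_central_alg:
  assumes "a \<in> carrier (alg f)"
  shows "scal (alg f) c \<otimes>\<^bsub>alg f\<^esub> a = a \<otimes>\<^bsub>alg f\<^esub> scal (alg f) c"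
proof -
  have "Poly_Mapping.single 0 c * p = p * Poly_Mapping.single 0 c" for p :: "('k, 'r) gwa_free"
    by (induction p rule: poly_mapping_additive_induct) (simp_all add: mult_single distrib_left distrib_right mult.commute)
  then show ?thesis using assms by (auto simp: alg_ops)
qed

lemma scal_grade_alg: "scal (alg f) c \<in> grade (alg f) 0"
  unfolding alg_ops by (auto simp: word_degree_def zero_word_def intro!: exI[of _ "Poly_Mapping.single 0 c"] split: if_splits)

text \<open>The defining relations, read as identities between operators. For a right action the
  order is reversed: \<open>op GenY\<close> after \<open>op GenX\<close> is the action of the
  product \<open>x y = f\<close>.\<close>

definition gwa_ops ::
    "'r \<Rightarrow> ('k, 'r, 'm) gwa_gr_module \<Rightarrow> ('r gwa_gen \<Rightarrow> 'm \<Rightarrow> 'm) \<Rightarrow> bool" where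
  "gwa_ops f M op \<longleftrightarrow>
     (\<forall>g. \<forall>m\<in>carrier M. op g m \<in> carrier M) \<and>
     (\<forall>g. \<forall>m\<in>carrier M. \<forall>m'\<in>carrier M. op g (m \<oplus>\<^bsub>M\<^esub> m') = op g m \<oplus>\<^bsub>M\<^esub> op g m') \<and>
     (\<forall>g n. \<forall>m\<in>component M n. op g m \<in> component M (n + gen_degree g)) \<and>
     (\<forall>m\<in>carrier M. \<forall>r s. op (Coef (r + s)) m = op (Coef r) m \<oplus>\<^bsub>M\<^esub> op (Coef s) m) \<and>
     (\<forall>m\<in>carrier M. \<forall>r s. op (Coef (r * s)) m = op (Coef s) (op (Coef r) m)) \<and>
     (\<forall>m\<in>carrier M. op (Coef 1) m = m) \<and>
     (\<forall>m\<in>carrier M. op GenY (op GenX m) = op (Coef f) m) \<and>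
     (\<forall>m\<in>carrier M. op GenX (op GenY m) = op (Coef (\<tau> f)) m) \<and>
     (\<forall>m\<in>carrier M. \<forall>r. op (Coef r) (op GenX m) = op GenX (op (Coef (\<sigma> r)) m)) \<and>
     (\<forall>m\<in>carrier M. \<forall>r. op (Coef r) (op GenY m) = op GenY (op (Coef (\<tau> r)) m))"

definition pact ::
    "('k, 'r, 'm) gwa_gr_module \<Rightarrow> ('r gwa_gen \<Rightarrow> 'm \<Rightarrow> 'm) \<Rightarrow> 'm \<Rightarrow> ('k, 'r) gwa_free \<Rightarrow> 'm" where
  "pact M op m p = (\<Oplus>\<^bsub>M\<^esub>w\<in>Poly_Mapping.keys p. op (Coef (\<iota> (Poly_Mapping.lookup p w))) (fold op (letters w) m))"

text \<open>An element of the algebra is a coset of the ideal, and an arbitrary member is made to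
  act; \<open>act_ideal\<close> shows that all members act alike.\<close>

definition gwa_ract ::
    "('k, 'r, 'm) gwa_gr_module \<Rightarrow> ('r gwa_gen \<Rightarrow> 'm \<Rightarrow> 'm) \<Rightarrow> 'm \<Rightarrow> ('k, 'r) gwa_free set \<Rightarrow> 'm" where
  "gwa_ract M op m C = pact M op m (SOME p. p \<in> C)"

lemma gwa_ops_of_module:
  assumes "graded_right_module (alg f) M"
  shows "gwa_ops f M (\<lambda>g m. m \<triangleleft>\<^bsub>M\<^esub> gn f g)"
proof -
  interpret M: graded_right_module "alg f" M by fact
  show ?thesis
    unfolding gwa_ops_def
    by (auto simp: M.ract_closed M.ract_add_left M.ract_add_right M.component_ract gn_closed gn_add gn_mult gn_one
        gn_grade M.ract_one gn_XY gn_YX gn_X_Coef gn_Y_Coef simp flip: M.ract_assoc)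
qed

end

section \<open>Modules built from operators for the generators\<close>

locale gwa_operators = gwa_base \<iota> \<sigma> + M: abelian_group M
  for \<iota> :: "'k::field \<Rightarrow> 'r::comm_ring_1" and \<sigma> :: "'r \<Rightarrow> 'r"
    and M :: "('k, 'r, 'm) gwa_gr_module" +
  fixes f :: 'r and op :: "'r gwa_gen \<Rightarrow> 'm \<Rightarrow> 'm"
  assumes ops: "gwa_ops f M op"
    and component_sub: "additive_subgroup (component M n) M"
    and direct_sum: "m \<in> carrier M \<Longrightarrow> \<exists>!c. homogeneous_decomposition M c m"
begin

lemma op_closed: "m \<in> carrier M \<Longrightarrow> op g m \<in> carrier M"
  and op_add: "\<lbrakk>m \<in> carrier M; m' \<in> carrier M\<rbrakk> \<Longrightarrow> op g (m \<oplus>\<^bsub>M\<^esub> m') = op g m \<oplus>\<^bsub>M\<^esub> op g m'"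
  and op_component: "m \<in> component M n \<Longrightarrow> op g m \<in> component M (n + gen_degree g)"
  and op_Coef_add: "m \<in> carrier M \<Longrightarrow> op (Coef (r + s)) m = op (Coef r) m \<oplus>\<^bsub>M\<^esub> op (Coef s) m"
  and op_Coef_mult: "m \<in> carrier M \<Longrightarrow> op (Coef (r * s)) m = op (Coef s) (op (Coef r) m)"
  and op_one: "m \<in> carrier M \<Longrightarrow> op (Coef 1) m = m"
  and op_XY: "m \<in> carrier M \<Longrightarrow> op GenY (op GenX m) = op (Coef f) m"
  and op_YX: "m \<in> carrier M \<Longrightarrow> op GenX (op GenY m) = op (Coef (\<tau> f)) m"
  and op_X_Coef: "m \<in> carrier M \<Longrightarrow> op (Coef r) (op GenX m) = op GenX (op (Coef (\<sigma> r)) m)"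
  and op_Y_Coef: "m \<in> carrier M \<Longrightarrow> op (Coef r) (op GenY m) = op GenY (op (Coef (\<tau> r)) m)"
  using ops unfolding gwa_ops_def by metis+

lemma op_zero: "op g \<zero>\<^bsub>M\<^esub> = \<zero>\<^bsub>M\<^esub>"
  by (rule additive_map_zero[OF M.abelian_group_axioms M.abelian_group_axioms]) (auto simp: op_closed op_add)

lemma op_Coef_zero: "m \<in> carrier M \<Longrightarrow> op (Coef 0) m = \<zero>\<^bsub>M\<^esub>"
  using op_Coef_add[of m 0 0] op_closed[of m "Coef 0"] by (simp add: M.add.r_cancel_one')

lemma inv_sigma_iota: "\<tau> (\<iota> c) = \<iota> c"
  using sigma_iota bij_sigma by (metis bij_is_inj inv_f_f)

text \<open>Scalars are fixed by \<sigma> and its inverse, so they pass \<open>x\<close> and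
  \<open>y\<close> untwisted.\<close>

lemma op_iota_commute: "m \<in> carrier M \<Longrightarrow> op (Coef (\<iota> c)) (op g m) = op g (op (Coef (\<iota> c)) m)"
proof (cases g)
  case (Coef r)
  assume "m \<in> carrier M"
  then show ?thesis unfolding Coef by (simp flip: op_Coef_mult) (simp add: mult.commute)
qed (simp_all add: op_X_Coef op_Y_Coef sigma_iota inv_sigma_iota)

lemma fold_closed: "m \<in> carrier M \<Longrightarrow> fold op l m \<in> carrier M"
  by (induction l arbitrary: m) (auto simp: op_closed)

lemma fold_add: "\<lbrakk>m \<in> carrier M; m' \<in> carrier M\<rbrakk> \<Longrightarrow> fold op l (m \<oplus>\<^bsub>M\<^esub> m') = fold op l m \<oplus>\<^bsub>M\<^esub> fold op l m'"
  by (induction l arbitrary: m m') (auto simp: op_closed op_add)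

lemma fold_iota: "m \<in> carrier M \<Longrightarrow> fold op l (op (Coef (\<iota> c)) m) = op (Coef (\<iota> c)) (fold op l m)"
  by (induction l arbitrary: m) (auto simp: op_closed simp flip: op_iota_commute)

abbreviation "act \<equiv> pact M op"

lemma act_superset:
  assumes m: "m \<in> carrier M" and K: "finite K" "Poly_Mapping.keys p \<subseteq> K"
  shows "act m p = (\<Oplus>\<^bsub>M\<^esub>w\<in>K. op (Coef (\<iota> (Poly_Mapping.lookup p w))) (fold op (letters w) m))"
  unfolding pact_def
  by (rule M.add.finprod_mono_neutral_cong_left)
    (use m K in \<open>auto simp: in_keys_iff iota_zero op_Coef_zero fold_closed op_closed\<close>)

lemma act_closed: "m \<in> carrier M \<Longrightarrow> act m p \<in> carrier M"
  unfolding pact_def by (auto intro!: M.add.finprod_closed simp: op_closed fold_closed)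

lemma act_add_left:
  assumes "m \<in> carrier M" "m' \<in> carrier M"
  shows "act (m \<oplus>\<^bsub>M\<^esub> m') p = act m p \<oplus>\<^bsub>M\<^esub> act m' p"
  unfolding pact_def
  by (subst M.add.finprod_multf[symmetric])
    (use assms in \<open>auto simp: fold_add op_add fold_closed op_closed intro!: M.add.finprod_cong'\<close>)

lemma act_add_right:
  assumes m: "m \<in> carrier M"
  shows "act m (p + p') = act m p \<oplus>\<^bsub>M\<^esub> act m p'"
proof -
  let ?K = "Poly_Mapping.keys p \<union> Poly_Mapping.keys p'"
  have K: "finite ?K" "Poly_Mapping.keys p \<subseteq> ?K" "Poly_Mapping.keys p' \<subseteq> ?K" "Poly_Mapping.keys (p + p') \<subseteq> ?K"
    using Poly_Mapping.keys_add[of p p'] by auto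
  show ?thesis
    unfolding act_superset[OF m K(1,2)] act_superset[OF m K(1,3)] act_superset[OF m K(1,4)]
    by (subst M.add.finprod_multf[symmetric])
      (use m in \<open>auto simp: lookup_add iota_add op_Coef_add fold_closed op_closed intro!: M.add.finprod_cong'\<close>)
qed

lemma act_zero: "m \<in> carrier M \<Longrightarrow> act m 0 = \<zero>\<^bsub>M\<^esub>"
  by (simp add: pact_def)

lemma act_single:
  assumes m: "m \<in> carrier M"
  shows "act m (Poly_Mapping.single w c) = op (Coef (\<iota> c)) (fold op (letters w) m)"
  using act_superset[OF m, of "{w}" "Poly_Mapping.single w c"] m
  by (simp add: op_closed fold_closed)

lemma fold_zero: "fold op l \<zero>\<^bsub>M\<^esub> = \<zero>\<^bsub>M\<^esub>"
  by (induction l) (auto simp: op_zero)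

text \<open>Both sides are additive in \<open>p\<close> and in \<open>p'\<close>, which leaves two
  monomials. There the fold over a concatenated word is the composite of the folds, and the scalar
  of the first monomial passes the letters of the second.\<close>

lemma act_mult:
  assumes m: "m \<in> carrier M"
  shows "act m (p * p') = act (act m p) p'"
proof (induction p' rule: poly_mapping_additive_induct)
  case (2 w' c')
  show ?case
    using m
  proof (induction p arbitrary: m rule: poly_mapping_additive_induct)
    case (2 w c)
    then show ?case
      by (simp add: mult_single act_single act_closed op_closed fold_closed plus_word_def iota_mult op_Coef_mult fold_iota)
  qed (simp_all add: act_zero act_single op_zero op_add fold_closed fold_zero fold_add distrib_right
      act_add_right act_closed)
qed (simp_all add: m act_zero act_closed distrib_left act_add_right)

lemma act_one: "m \<in> carrier M \<Longrightarrow> act m 1 = m"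
  using act_single[of m 0 1] by (simp add: letters_zero iota_one op_one)

lemma act_gen: "m \<in> carrier M \<Longrightarrow> act m (gen g) = op g m"
  by (simp add: gen_def act_single iota_one op_one op_closed)

lemma act_eq_diff: "m \<in> carrier M \<Longrightarrow> act m (p - p') = \<zero>\<^bsub>M\<^esub> \<longleftrightarrow> act m p = act m p'"
  using act_add_right[of m "p - p'" p'] act_closed[of m p'] act_closed[of m "p - p'"]
  by (auto simp: M.add.l_cancel_one' M.add.r_cancel_one')

lemma act_zero_left: "act \<zero>\<^bsub>M\<^esub> p = \<zero>\<^bsub>M\<^esub>"
  by (rule additive_map_zero[OF M.abelian_group_axioms M.abelian_group_axioms]) (auto simp: act_closed act_add_left)

lemma act_relation:
  assumes m: "m \<in> carrier M" and p: "p \<in> coef_relations \<iota> \<union> gwa_relations \<sigma> f"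
  shows "act m p = \<zero>\<^bsub>M\<^esub>"
  using p m unfolding coef_relations_def gwa_relations_def
  by (auto simp: act_eq_diff act_mult act_add_right act_gen act_single op_closed op_Coef_add op_Coef_mult
      op_XY op_YX op_X_Coef op_Y_Coef zero_word_def)

text \<open>The elements of the free algebra that kill all of \<open>M\<close> form an ideal
  containing the relations. Quantifying over all \<open>m\<close> makes it two-sided: a left factor
  only replaces \<open>m\<close> by another element of \<open>M\<close>.\<close>

lemma act_ideal:
  assumes "m \<in> carrier M" "p \<in> gwa_ideal \<iota> \<sigma> f"
  shows "act m p = \<zero>\<^bsub>M\<^esub>"
proof -
  let ?N = "{p. \<forall>m\<in>carrier M. act m p = \<zero>\<^bsub>M\<^esub>}"
  have "ideal ?N F"
  proof (rule idealI[OF ring_ring_of_type_algebra])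
    show "subgroup ?N (add_monoid F)"
    proof (rule group.subgroupI)
      show "group (add_monoid F)"
        using abelian_group.a_group[OF ring.is_abelian_group[OF ring_ring_of_type_algebra]] .
      show "inv\<^bsub>add_monoid F\<^esub> a \<in> ?N" if "a \<in> ?N" for a
      proof -
        have "inv\<^bsub>add_monoid F\<^esub> a = - a"
          using abelian_group.minus_equality[OF ring.is_abelian_group[OF ring_ring_of_type_algebra], of "- a" a]
          by (simp add: ring_of_type_algebra_simps a_inv_def)
        moreover have "act m (- a) = \<zero>\<^bsub>M\<^esub>" if "m \<in> carrier M" for m
          using act_eq_diff[OF that, of 0 a] \<open>a \<in> ?N\<close> that by (simp add: act_zero)
        ultimately show ?thesis by simp
      qed
    qed (auto simp: ring_of_type_algebra_simps act_add_right intro!: exI[of _ 0] act_zero)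
  qed (auto simp: ring_of_type_algebra_simps act_mult act_closed act_zero_left)
  moreover have "coef_relations \<iota> \<union> gwa_relations \<sigma> f \<subseteq> ?N" using act_relation by blast
  ultimately have "gwa_ideal \<iota> \<sigma> f \<subseteq> ?N"
    unfolding gwa_ideal_def by (rule ring.genideal_minimal[OF ring_ring_of_type_algebra])
  then show ?thesis using assms by blast
qed

lemma ract_q: "m \<in> carrier M \<Longrightarrow> gwa_ract M op m (q f p) = act m p"
proof -
  assume m: "m \<in> carrier M"
  have "(SOME p'. p' \<in> q f p) \<in> q f p" using q_self by (rule someI)
  then have "act m ((SOME p'. p' \<in> q f p) - p) = \<zero>\<^bsub>M\<^esub>" using act_ideal[OF m] q_mem by blast
  then show ?thesis unfolding gwa_ract_def act_eq_diff[OF m] .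
qed

lemma ract_gn: "m \<in> carrier M \<Longrightarrow> gwa_ract M op m (gn f g) = op g m"
  by (simp add: gn_def ract_q act_gen)

lemma fold_component: "m \<in> component M i \<Longrightarrow> fold op l m \<in> component M (i + sum_list (map gen_degree l))"
proof (induction l arbitrary: m i)
  case (Cons g l)
  show ?case using Cons.IH[OF op_component[OF Cons.prems, of g]] by (simp add: add.assoc)
qed simp

lemma act_component:
  assumes m: "m \<in> component M i" and p: "\<forall>w\<in>Poly_Mapping.keys p. word_degree w = j"
  shows "act m p \<in> component M (i + j)"
proof -
  interpret C: additive_subgroup "component M (i + j)" M by (rule component_sub)
  have *: "op (Coef (\<iota> (Poly_Mapping.lookup p w))) (fold op (letters w) m) \<in> component M (i + j)"
    if "w \<in> Poly_Mapping.keys p" for w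
    using op_component[OF fold_component[OF m, of "letters w"], of "Coef (\<iota> (Poly_Mapping.lookup p w))"] p that
    unfolding word_degree_def by simp
  have "(\<Oplus>\<^bsub>M\<^esub>w\<in>K. g w) \<in> component M (i + j)" if "finite K" "\<And>w. w \<in> K \<Longrightarrow> g w \<in> component M (i + j)" for K and g :: "'r gwa_gen word \<Rightarrow> 'm"
    using that
  proof (induction K rule: finite_induct)
    case (insert w K)
    then have "g \<in> K \<rightarrow> carrier M" "g w \<in> carrier M" by auto
    then show ?case using insert by simp
  qed simp
  then show ?thesis unfolding pact_def using * by simp
qed

lemma graded_right_module_ops: "graded_right_module (alg f) (M\<lparr>ract := gwa_ract M op\<rparr>)"
proof -
  let ?N = "M\<lparr>ract := gwa_ract M op\<rparr>"
  \<comment> \<open>Replacing \<open>ract\<close> leaves the additive monoid untouched, and with it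
    subgroups, finite sums and homogeneous decompositions.\<close>
  have am: "add_monoid ?N = add_monoid M" by simp
  have N: "abelian_group ?N"
    using M.abelian_group_axioms unfolding abelian_group_def abelian_monoid_def abelian_group_axioms_def am .
  have sub: "additive_subgroup (component ?N n) ?N" for n
    using component_sub[of n] unfolding additive_subgroup_def am by simp
  have "homogeneous_decomposition ?N = homogeneous_decomposition M"
    unfolding homogeneous_decomposition_def finsum_def am by (simp add: fun_eq_iff)
  moreover have "m \<triangleleft>\<^bsub>?N\<^esub> a \<in> component ?N (i + j)" if m: "m \<in> component ?N i" and a: "a \<in> grade (alg f) j" for m a i j
  proof -
    have "m \<in> carrier M" using m additive_subgroup.a_subset[OF component_sub] by auto
    then show ?thesis using m a act_component[of m i _ j] by (auto simp: alg_ops(7) ract_q)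
  qed
  ultimately show ?thesis
    by (intro graded_right_module.intro graded_right_module_axioms.intro)
      (use direct_sum sub N in \<open>auto simp: ring_gwa alg_ops ract_q act_closed act_add_left act_add_right act_mult act_one\<close>)
qed

end

section \<open>Torsion modules\<close>

text \<open>More vectors \<open>c i\<close> than coordinates \<open>B\<close>: Gaussian elimination,
  by induction on the set of coordinates.\<close>

lemma exists_linear_relation:
  fixes c :: "'i \<Rightarrow> 'b \<Rightarrow> 'k::field"
  assumes "finite B" "finite I" "card B < card I"
  shows "\<exists>a. (\<exists>i\<in>I. a i \<noteq> 0) \<and> (\<forall>b\<in>B. (\<Sum>i\<in>I. a i * c i b) = 0)"
  using assms
proof (induction B arbitrary: I c rule: finite_induct)
  case empty
  then obtain i where "i \<in> I" by fastforce
  then show ?case by (intro exI[of _ "\<lambda>_. 1"]) auto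
next
  case (insert b B)
  show ?case
  proof (cases "\<forall>i\<in>I. c i b = 0")
    case True
    obtain a where "\<exists>i\<in>I. a i \<noteq> 0" "\<forall>b\<in>B. (\<Sum>i\<in>I. a i * c i b) = 0"
    proof -
      have "card B < card I" using insert.prems insert.hyps by simp
      then show ?thesis using insert.IH[OF insert.prems(1), of c] that by blast
    qed
    then show ?thesis using True by (intro exI[of _ a]) auto
  next
    case False
    then obtain j where j: "j \<in> I" "c j b \<noteq> 0" by blast
    \<comment> \<open>Row \<open>j\<close> is the pivot for coordinate \<open>b\<close>: subtracting
      its multiples clears \<open>b\<close> in all other rows, and the induction hypothesis handles
      the remaining coordinates.\<close>
    let ?c = "\<lambda>i x. c i x - c i b / c j b * c j x"
    have "card B < card (I - {j})" using insert j by auto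
    then obtain a where a: "\<exists>i\<in>I - {j}. a i \<noteq> 0" "\<forall>x\<in>B. (\<Sum>i\<in>I - {j}. a i * ?c i x) = 0"
      using insert.IH[of "I - {j}" ?c] insert.prems by auto
    define s where "s = (\<Sum>i\<in>I - {j}. a i * c i b)"
    \<comment> \<open>The coefficient of the pivot row collects the multiples subtracted; it is also
      what makes coordinate \<open>b\<close> vanish.\<close>
    let ?a = "a(j := - s / c j b)"
    have split: "(\<Sum>i\<in>I. ?a i * c i x) = - s / c j b * c j x + (\<Sum>i\<in>I - {j}. a i * c i x)" for x
      using insert.prems(1) j(1) by (subst sum.remove[of I j]) auto
    have "(\<Sum>i\<in>I. ?a i * c i x) = 0" if "x \<in> B" for x
    proof -
      have "(\<Sum>i\<in>I - {j}. a i * ?c i x) = (\<Sum>i\<in>I - {j}. a i * c i x) - s / c j b * c j x"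
        unfolding s_def by (simp add: algebra_simps sum_subtractf sum_distrib_left sum_distrib_right sum_divide_distrib)
      then show ?thesis using a(2) that unfolding split by auto
    qed
    moreover have "(\<Sum>i\<in>I. ?a i * c i b) = 0" using split[of b] j by (simp add: s_def[symmetric])
    moreover have "\<exists>i\<in>I. ?a i \<noteq> 0" using a(1) by auto
    ultimately show ?thesis by blast
  qed
qed

context gwa_base
begin

text \<open>Exchanging \<open>x\<close> and \<open>y\<close> amounts to negating \<open>s\<close>,
  so one argument covers both generators in the torsion criterion and later both functors. With it
  go \<open>tw s\<close>, the twist of a coefficient that passes \<open>up s\<close>, and
  \<open>cen s f\<close>, the coefficient by which \<open>up s\<close> followed by
  \<open>up (\<not> s)\<close> acts.\<close>

definition up :: "bool \<Rightarrow> 'r gwa_gen" where "up s = (if s then GenX else GenY)"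

definition tw :: "bool \<Rightarrow> 'r \<Rightarrow> 'r" where "tw s = (if s then \<sigma> else \<tau>)"

definition cen :: "bool \<Rightarrow> 'r \<Rightarrow> 'r" where "cen s f = (if s then f else \<tau> f)"

lemma sigma_tau: "\<sigma> (\<tau> r) = r" using bij_sigma by (simp add: bij_is_surj surj_f_inv_f)

lemma tau_sigma: "\<tau> (\<sigma> r) = r" using bij_sigma by (simp add: bij_is_inj)

lemma tw_tw [simp]: "tw (\<not> s) (tw s r) = r" "tw s (tw (\<not> s) r) = r"
  by (auto simp: tw_def sigma_tau tau_sigma)

lemma tw_add: "tw s (r + t) = tw s r + tw s t" and tw_mult: "tw s (r * t) = tw s r * tw s t"
  using sigma_tau tau_sigma sigma_add sigma_mult by (auto simp: tw_def) metis+

lemma tw_iota: "tw s (\<iota> c) = \<iota> c"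
  using tau_sigma[of "\<iota> c"] by (simp add: tw_def sigma_iota)

lemma tw_one: "tw s 1 = 1" using tw_iota[of s 1] by (simp add: iota_one)

lemma tw_zero: "tw s 0 = 0" using tw_iota[of s 0] by (simp add: iota_zero)

lemma tw_eq_zero: "tw s r = 0 \<longleftrightarrow> r = 0" by (metis tw_zero tw_tw(1))

lemma gen_cases: obtains (Coef) r where "g = Coef r" | (up) "g = up s" | (dn) "g = up (\<not> s)"
  by (cases g; cases s) (auto simp: up_def)

definition mults :: "'r \<Rightarrow> ('k, 'r) gwa_free set set set" where
  "mults f = {{gn f (Coef r) | r. r \<noteq> 0}, range (\<lambda>k::nat. gn f GenX [^]\<^bsub>alg f\<^esub> k), range (\<lambda>k::nat. gn f GenY [^]\<^bsub>alg f\<^esub> k)}"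

end

section \<open>The operators of a given module and the multiplicative criterion\<close>

locale gwa_module = gwa_base \<iota> \<sigma> + graded_right_module "gwa \<iota> \<sigma> f" M
  for \<iota> :: "'k::field \<Rightarrow> 'r::comm_ring_1" and \<sigma> :: "'r \<Rightarrow> 'r" and f :: 'r
    and M :: "('k, 'r, 'm) gwa_gr_module"
begin

definition op :: "'r gwa_gen \<Rightarrow> 'm \<Rightarrow> 'm" where "op g m = m \<triangleleft>\<^bsub>M\<^esub> gn f g"

lemma op_closed: "m \<in> carrier M \<Longrightarrow> op g m \<in> carrier M"
  and op_add: "\<lbrakk>m \<in> carrier M; m' \<in> carrier M\<rbrakk> \<Longrightarrow> op g (m \<oplus>\<^bsub>M\<^esub> m') = op g m \<oplus>\<^bsub>M\<^esub> op g m'"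
  and op_component: "m \<in> component M n \<Longrightarrow> op g m \<in> component M (n + gen_degree g)"
  and op_Coef_add: "m \<in> carrier M \<Longrightarrow> op (Coef (r + t)) m = op (Coef r) m \<oplus>\<^bsub>M\<^esub> op (Coef t) m"
  and op_Coef_mult: "m \<in> carrier M \<Longrightarrow> op (Coef (r * t)) m = op (Coef t) (op (Coef r) m)"
  and op_one: "m \<in> carrier M \<Longrightarrow> op (Coef 1) m = m"
  and op_dn_up: "m \<in> carrier M \<Longrightarrow> op (up (\<not> s)) (op (up s) m) = op (Coef (cen s f)) m"
  and op_Coef_up: "m \<in> carrier M \<Longrightarrow> op (Coef r) (op (up s) m) = op (up s) (op (Coef (tw s r)) m)"
  using gwa_ops_of_module[OF graded_right_module_axioms]
  unfolding gwa_ops_def op_def up_def tw_def cen_def by (auto split: if_splits)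

lemma op_Coef_comm: "m \<in> carrier M \<Longrightarrow> op (Coef r) (op (Coef t) m) = op (Coef t) (op (Coef r) m)"
  by (metis op_Coef_mult mult.commute)

lemma op_zero: "op g \<zero>\<^bsub>M\<^esub> = \<zero>\<^bsub>M\<^esub>"
  unfolding op_def by (rule zero_ract[OF gn_closed])

lemma op_Coef_zero: "m \<in> carrier M \<Longrightarrow> op (Coef 0) m = \<zero>\<^bsub>M\<^esub>"
  unfolding op_def gn_zero by (rule ract_zero)

lemma op_scal: "op (Coef (\<iota> c)) m = m \<triangleleft>\<^bsub>M\<^esub> scal (alg f) c"
  unfolding op_def gn_scal ..

lemma op_Coef_iota: "m \<in> carrier M \<Longrightarrow> op (Coef (\<iota> c)) (op g m) = op g (op (Coef (\<iota> c)) m)"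
  by (cases g rule: gen_cases[where s = True]) (auto simp: op_Coef_comm op_Coef_up tw_iota)

lemma hproj_op: "m \<in> carrier M \<Longrightarrow> hproj M (n + gen_degree g) (op g m) = op g (hproj M n m)"
  unfolding op_def by (rule hproj_ract[OF _ gn_grade gn_closed])

lemma hproj_Coef: "m \<in> carrier M \<Longrightarrow> hproj M n (op (Coef r) m) = op (Coef r) (hproj M n m)"
  using hproj_op[of m n "Coef r"] by simp

lemma pow_closed: "m \<in> carrier M \<Longrightarrow> (op g ^^ k) m \<in> carrier M"
  by (induction k) (auto simp: op_closed)

lemma pow_add: "\<lbrakk>m \<in> carrier M; m' \<in> carrier M\<rbrakk> \<Longrightarrow> (op g ^^ k) (m \<oplus>\<^bsub>M\<^esub> m') = (op g ^^ k) m \<oplus>\<^bsub>M\<^esub> (op g ^^ k) m'"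
  by (induction k) (auto simp: op_add pow_closed)

lemma pow_zero: "(op g ^^ k) \<zero>\<^bsub>M\<^esub> = \<zero>\<^bsub>M\<^esub>"
  by (induction k) (auto simp: op_zero)

lemma hproj_pow: "m \<in> carrier M \<Longrightarrow> hproj M (n + int k * gen_degree g) ((op g ^^ k) m) = (op g ^^ k) (hproj M n m)"
proof (induction k)
  case (Suc k)
  have eq: "n + int (Suc k) * gen_degree g = (n + int k * gen_degree g) + gen_degree g" by (simp add: algebra_simps)
  then have "hproj M (n + int (Suc k) * gen_degree g) ((op g ^^ Suc k) m) =
      hproj M ((n + int k * gen_degree g) + gen_degree g) (op g ((op g ^^ k) m))"
    by (simp only: eq funpow.simps comp_apply)
  also have "\<dots> = op g (hproj M (n + int k * gen_degree g) ((op g ^^ k) m))"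
    by (rule hproj_op[OF pow_closed[OF Suc.prems]])
  also have "\<dots> = (op g ^^ Suc k) (hproj M n m)" using Suc by simp
  finally show ?case .
qed simp

lemma Coef_pow: "m \<in> carrier M \<Longrightarrow> op (Coef r) ((op (up s) ^^ k) m) = (op (up s) ^^ k) (op (Coef ((tw s ^^ k) r)) m)"
  by (induction k arbitrary: r) (auto simp: op_Coef_up pow_closed funpow_swap1[of "tw s"])

lemma pow_Coef: "m \<in> carrier M \<Longrightarrow> (op (up s) ^^ k) (op (Coef r) m) = op (Coef ((tw (\<not> s) ^^ k) r)) ((op (up s) ^^ k) m)"
proof (induction k)
  case (Suc k)
  then show ?case by (simp add: op_Coef_up pow_closed)
qed simp

lemma ract_pow: "m \<in> carrier M \<Longrightarrow> m \<triangleleft>\<^bsub>M\<^esub> (gn f g [^]\<^bsub>alg f\<^esub> (k::nat)) = (op g ^^ k) m"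
proof (induction k)
  case 0
  then show ?case by (simp add: ract_one)
next
  case (Suc k)
  interpret R: ring "alg f" by (rule ring_gwa)
  show ?case using Suc by (simp add: ract_assoc gn_closed op_def)
qed

lemma all_mults:
  "(\<forall>S\<in>mults f. \<forall>m\<in>W. \<exists>s\<in>S. m \<triangleleft>\<^bsub>M\<^esub> s \<in> D) \<longleftrightarrow>
     (\<forall>m\<in>W. (\<exists>r. r \<noteq> 0 \<and> op (Coef r) m \<in> D) \<and> (\<forall>s. \<exists>k. (op (up s) ^^ k) m \<in> D))" if "W \<subseteq> carrier M"
proof -
  have "(\<exists>s\<in>{gn f (Coef r) | r. r \<noteq> 0}. m \<triangleleft>\<^bsub>M\<^esub> s \<in> D) \<longleftrightarrow> (\<exists>r. r \<noteq> 0 \<and> op (Coef r) m \<in> D)" for m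
    unfolding op_def by blast
  moreover have "(\<exists>s\<in>range (\<lambda>k::nat. gn f g [^]\<^bsub>alg f\<^esub> k). m \<triangleleft>\<^bsub>M\<^esub> s \<in> D) \<longleftrightarrow> (\<exists>k. (op g ^^ k) m \<in> D)" if "m \<in> W" for m g
    using \<open>W \<subseteq> carrier M\<close> that by (auto simp: ract_pow subset_iff)
  ultimately show ?thesis
    unfolding mults_def up_def by (simp add: all_bool_eq) blast
qed

lemma mult_dense_iff:
  "mult_dense (mults f) M D \<longleftrightarrow>
     (\<forall>m\<in>carrier M. (\<exists>r. r \<noteq> 0 \<and> op (Coef r) m \<in> D) \<and> (\<forall>s. \<exists>k. (op (up s) ^^ k) m \<in> D))"
  unfolding mult_dense_def by (rule all_mults) simp

lemma mult_torsion_iff: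
  "W \<subseteq> carrier M \<Longrightarrow> mult_torsion (mults f) M W \<longleftrightarrow>
     (\<forall>m\<in>W. (\<exists>r. r \<noteq> 0 \<and> op (Coef r) m = \<zero>\<^bsub>M\<^esub>) \<and> (\<forall>s. \<exists>k. (op (up s) ^^ k) m = \<zero>\<^bsub>M\<^esub>))"
  unfolding mult_torsion_def using all_mults[of W "{\<zero>\<^bsub>M\<^esub>}"] by simp

definition lincomb :: "'m set \<Rightarrow> ('m \<Rightarrow> 'k) \<Rightarrow> 'm" where
  "lincomb B c = (\<Oplus>\<^bsub>M\<^esub>b\<in>B. b \<triangleleft>\<^bsub>M\<^esub> scal (alg f) (c b))"

lemma scal_carrier: "scal (alg f) c \<in> carrier (alg f)" by (simp add: alg_ops)

lemma lincomb_zero: "B \<subseteq> carrier M \<Longrightarrow> lincomb B (\<lambda>b. 0) = \<zero>\<^bsub>M\<^esub>"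
proof -
  assume B: "B \<subseteq> carrier M"
  have "scal (alg f) 0 = \<zero>\<^bsub>alg f\<^esub>" by (simp add: alg_ops)
  then have "lincomb B (\<lambda>b. 0) = (\<Oplus>\<^bsub>M\<^esub>b\<in>B. \<zero>\<^bsub>M\<^esub>)"
    unfolding lincomb_def using B by (intro M.add.finprod_cong') (auto simp: ract_zero subset_iff)
  then show ?thesis by simp
qed

lemma lincomb_add:
  assumes "B \<subseteq> carrier M"
  shows "lincomb B (\<lambda>b. c b + d b) = lincomb B c \<oplus>\<^bsub>M\<^esub> lincomb B d"
proof -
  have Bc: "b \<in> B \<Longrightarrow> b \<in> carrier M" for b using assms by blast
  have "lincomb B (\<lambda>b. c b + d b) = (\<Oplus>\<^bsub>M\<^esub>b\<in>B. op (Coef (\<iota> (c b))) b \<oplus>\<^bsub>M\<^esub> op (Coef (\<iota> (d b))) b)"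
    unfolding lincomb_def
    by (rule M.add.finprod_cong') (auto simp: op_Coef_add iota_add op_closed Bc simp flip: op_scal)
  also have "\<dots> = lincomb B c \<oplus>\<^bsub>M\<^esub> lincomb B d"
    unfolding lincomb_def op_scal[symmetric] by (rule M.add.finprod_multf) (auto simp: op_closed Bc)
  finally show ?thesis .
qed

lemma lincomb_scal:
  assumes "B \<subseteq> carrier M" "finite B"
  shows "lincomb B c \<triangleleft>\<^bsub>M\<^esub> scal (alg f) a = lincomb B (\<lambda>b. a * c b)"
proof -
  have "lincomb B c \<triangleleft>\<^bsub>M\<^esub> scal (alg f) a = (\<Oplus>\<^bsub>M\<^esub>b\<in>B. (b \<triangleleft>\<^bsub>M\<^esub> scal (alg f) (c b)) \<triangleleft>\<^bsub>M\<^esub> scal (alg f) a)"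
    unfolding lincomb_def by (rule ract_finsum) (use assms in \<open>auto simp: ract_closed scal_carrier\<close>)
  also have "\<dots> = lincomb B (\<lambda>b. a * c b)"
    unfolding lincomb_def
    by (rule M.add.finprod_cong')
      (use assms in \<open>auto simp: op_closed iota_mult subset_iff op_Coef_comm[of _ "\<iota> a"] op_Coef_mult simp flip: op_scal\<close>)
  finally show ?thesis .
qed

lemma hproj_lincomb_zero:
  assumes "B \<subseteq> carrier M" "finite B" "\<And>b. b \<in> B \<Longrightarrow> hproj M n b = \<zero>\<^bsub>M\<^esub>"
  shows "hproj M n (lincomb B c) = \<zero>\<^bsub>M\<^esub>"
proof -
  have "hproj M n (lincomb B c) = (\<Oplus>\<^bsub>M\<^esub>b\<in>B. hproj M n (b \<triangleleft>\<^bsub>M\<^esub> scal (alg f) (c b)))"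
    unfolding lincomb_def by (rule hproj_finsum) (use assms in \<open>auto simp: ract_closed scal_carrier\<close>)
  also have "\<dots> = (\<Oplus>\<^bsub>M\<^esub>b\<in>B. \<zero>\<^bsub>M\<^esub>)"
    by (rule M.add.finprod_cong') (use assms in \<open>auto simp: hproj_Coef op_zero subset_iff simp flip: op_scal\<close>)
  finally show ?thesis by simp
qed

lemma eq_zero_if_hproj: "m \<in> carrier M \<Longrightarrow> (\<And>n. hproj M n m = \<zero>\<^bsub>M\<^esub>) \<Longrightarrow> m = \<zero>\<^bsub>M\<^esub>"
  using hproj_sum_superset[of m "{}"] by simp

lemma ract_closed_iff:
  assumes "W \<subseteq> carrier M" "\<zero>\<^bsub>M\<^esub> \<in> W" "\<And>x y. \<lbrakk>x \<in> W; y \<in> W\<rbrakk> \<Longrightarrow> x \<oplus>\<^bsub>M\<^esub> y \<in> W"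
    "\<And>w g. w \<in> W \<Longrightarrow> op g w \<in> W" "w \<in> W" "a \<in> carrier (alg f)"
  shows "w \<triangleleft>\<^bsub>M\<^esub> a \<in> W"
  using assms(6,5)
proof (induction a arbitrary: w rule: alg_induct)
  case (gen g)
  then show ?case using assms(4) by (simp add: op_def)
next
  case (add a b)
  then show ?case using assms(1,3) by (simp add: ract_add_right subset_iff)
next
  case (mult a b)
  then show ?case using assms(1) by (simp add: ract_assoc subset_iff)
qed

text \<open>Linear span in inductive form: stability under an operator is then proved by rule
  induction, while \<open>kspan_lincomb\<close> returns to the linear combinations that
  \<open>finite_dimensional\<close> speaks of.\<close>

inductive_set kspan :: "'m set \<Rightarrow> 'm set" for B where
  zero: "\<zero>\<^bsub>M\<^esub> \<in> kspan B"
| gen: "b \<in> B \<Longrightarrow> op (Coef (\<iota> c)) b \<in> kspan B"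
| add: "\<lbrakk>x \<in> kspan B; y \<in> kspan B\<rbrakk> \<Longrightarrow> x \<oplus>\<^bsub>M\<^esub> y \<in> kspan B"

lemma kspan_carrier:
  assumes "B \<subseteq> carrier M" "x \<in> kspan B"
  shows "x \<in> carrier M"
  using assms(2) by induction (use assms(1) in \<open>auto simp: op_closed\<close>)

lemma kspan_lincomb:
  assumes "B \<subseteq> carrier M" "finite B" "x \<in> kspan B"
  shows "\<exists>c. x = lincomb B c"
  using assms(3)
proof induction
  case zero
  show ?case using lincomb_zero[OF assms(1)] by metis
next
  case (gen b c)
  have "lincomb B (\<lambda>x. if x = b then c else 0) = (\<Oplus>\<^bsub>M\<^esub>x\<in>B. if b = x then op (Coef (\<iota> c)) x else \<zero>\<^bsub>M\<^esub>)"
    unfolding lincomb_def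
    by (rule M.add.finprod_cong')
      (use assms in \<open>auto simp: op_closed iota_zero op_Coef_zero subset_iff simp flip: op_scal\<close>)
  also have "\<dots> = op (Coef (\<iota> c)) b"
    by (rule M.add.finprod_singleton) (use assms gen in \<open>auto simp: op_closed subset_iff\<close>)
  finally show ?case by metis
next
  case (add x y)
  then show ?case using lincomb_add[OF assms(1)] by metis
qed

text \<open>Linear maps preserve the span as soon as they send \<open>B\<close> into it. Applied to
  the generators and to the homogeneous projections, this turns a span into a graded
  submodule.\<close>

lemma kspan_map:
  assumes B: "B \<subseteq> carrier M" and x: "x \<in> kspan B"
    and add: "\<And>x y. \<lbrakk>x \<in> carrier M; y \<in> carrier M\<rbrakk> \<Longrightarrow> h (x \<oplus>\<^bsub>M\<^esub> y) = h x \<oplus>\<^bsub>M\<^esub> h y"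
    and zero: "h \<zero>\<^bsub>M\<^esub> = \<zero>\<^bsub>M\<^esub>"
    and scal: "\<And>c x. x \<in> carrier M \<Longrightarrow> h (op (Coef (\<iota> c)) x) = op (Coef (\<iota> c)) (h x)"
    and gen: "\<And>b. b \<in> B \<Longrightarrow> h b \<in> kspan B"
  shows "h x \<in> kspan B"
proof -
  have sc: "op (Coef (\<iota> c)) x \<in> kspan B" if "x \<in> kspan B" for c x
    using that
  proof induction
    case zero
    then show ?case using kspan.zero by (simp add: op_zero)
  next
    case (gen b d)
    then have "op (Coef (\<iota> c)) (op (Coef (\<iota> d)) b) = op (Coef (\<iota> (d * c))) b"
      using B by (simp add: subset_iff iota_mult op_Coef_mult)
    then show ?case using kspan.gen[OF gen] by simp
  next
    case (add x y)
    then show ?case using kspan.add kspan_carrier[OF B] by (simp add: op_add)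
  qed
  show ?thesis using x
  proof induction
    case zero
    then show ?case using kspan.zero assms(4) by simp
  next
    case (gen b c)
    then show ?case using sc[OF assms(6)[OF gen]] scal B by (simp add: subset_iff)
  next
    case (add x y)
    then show ?case using kspan.add kspan_carrier[OF B] assms(3) by simp
  qed
qed

end

text \<open>The arithmetic of the coefficient ring that enters. The set \<open>T\<close> spans the
  quotient by \<open>r\<close>, so an element killed by \<open>r\<close> has a finite-dimensional
  orbit under coefficients; the powers of \<open>z\<close> provide a nonzero coefficient killing a
  given element of a finite-dimensional submodule; an infinite field makes nonzero modules infinite,
  for the encoding of pairs.\<close>

locale gwa_fin = gwa_base \<iota> \<sigma> for \<iota> :: "'k::field \<Rightarrow> 'r::idom" and \<sigma> :: "'r \<Rightarrow> 'r" +
  fixes z :: 'r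
  assumes finite_codim: "r \<noteq> 0 \<Longrightarrow> \<exists>T. finite T \<and> (\<forall>t. \<exists>c p. t = (\<Sum>u\<in>T. \<iota> (c u) * u) + r * p)"
    and infinite_field: "infinite (UNIV :: 'k set)"
    and powers_independent: "\<lbrakk>(\<Sum>i<n. \<iota> (a i) * z ^ i) = 0; i < n\<rbrakk> \<Longrightarrow> a i = 0"

locale gwa_fin_module = gwa_fin \<iota> \<sigma> z + gwa_module \<iota> \<sigma> f M
  for \<iota> :: "'k::field \<Rightarrow> 'r::idom" and \<sigma> :: "'r \<Rightarrow> 'r" and z f :: 'r
    and M :: "('k, 'r, 'm) gwa_gr_module"
begin

text \<open>The elements \<open>w z^i\<close> are linearly dependent, so a nonzero polynomial in
  \<open>z\<close> kills \<open>w\<close>. Only finitely many degrees occur in \<open>W\<close>, so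
  enough steps of \<open>x\<close> or of \<open>y\<close> leave this range.\<close>

lemma finite_dimensional_mult_torsion:
  assumes W: "graded_submodule (alg f) M W" "finite_dimensional (alg f) M W"
  shows "mult_torsion (mults f) M W"
proof -
  note WD = graded_submoduleD[OF W(1)]
  obtain B where B: "finite B" "B \<subseteq> W" and gen: "\<And>w. w \<in> W \<Longrightarrow> \<exists>c. w = lincomb B c"
    using W(2) unfolding finite_dimensional_def lincomb_def by blast
  have Bc: "B \<subseteq> carrier M" using B WD(1) by blast
  have opW: "op g w \<in> W" if "w \<in> W" for g w unfolding op_def by (rule WD(5)[OF that gn_closed])
  have powW: "(op g ^^ k) w \<in> W" if "w \<in> W" for g k w using that by (induction k) (auto simp: opW)
  show ?thesis
    unfolding mult_torsion_iff[OF WD(1)]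
  proof (intro ballI conjI allI)
    fix w assume w: "w \<in> W"
    then have wc: "w \<in> carrier M" using WD(1) by blast
    \<comment> \<open>One power of \<open>z\<close> more than there are spanning elements forces a
      linear relation.\<close>
    let ?n = "Suc (card B)"
    define c where "c i = (SOME c. op (Coef (z ^ i)) w = lincomb B c)" for i
    have c: "op (Coef (z ^ i)) w = lincomb B (c i)" for i
      unfolding c_def by (rule someI_ex[of "\<lambda>c. op (Coef (z ^ i)) w = lincomb B c"]) (rule gen[OF opW[OF w]])
    obtain a where a: "\<exists>i<?n. a i \<noteq> 0" "\<forall>b\<in>B. (\<Sum>i<?n. a i * c i b) = 0"
      using exists_linear_relation[OF B(1), of "{..<?n}" c] by auto
    have "op (Coef (\<Sum>i<n. \<iota> (a i) * z ^ i)) w = lincomb B (\<lambda>b. \<Sum>i<n. a i * c i b)" for n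
    proof (induction n)
      case 0
      then show ?case using lincomb_zero[OF Bc] by (simp add: op_Coef_zero wc)
    next
      case (Suc n)
      have "op (Coef (\<iota> (a n) * z ^ n)) w = lincomb B (c n) \<triangleleft>\<^bsub>M\<^esub> scal (alg f) (a n)"
        using wc by (simp add: mult.commute[of "\<iota> (a n)"] op_Coef_mult c[symmetric] op_scal)
      then show ?case using Suc wc lincomb_add[OF Bc] lincomb_scal[OF Bc B(1)] by (simp add: op_Coef_add)
    qed
    moreover have "lincomb B (\<lambda>b. \<Sum>i<?n. a i * c i b) = lincomb B (\<lambda>b. 0)"
      unfolding lincomb_def by (rule M.add.finprod_cong') (use a Bc in \<open>auto simp: ract_closed scal_carrier subset_iff\<close>)
    ultimately have "op (Coef (\<Sum>i<?n. \<iota> (a i) * z ^ i)) w = \<zero>\<^bsub>M\<^esub>" by (simp only: lincomb_zero[OF Bc])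
    moreover have "(\<Sum>i<?n. \<iota> (a i) * z ^ i) \<noteq> 0" using a(1) powers_independent[of a ?n] by blast
    ultimately show "\<exists>r. r \<noteq> 0 \<and> op (Coef r) w = \<zero>\<^bsub>M\<^esub>" by blast
  next
    fix w s assume w: "w \<in> W"
    then have wc: "w \<in> carrier M" using WD(1) by blast
    define D where "D = (\<Union>b\<in>B. {n. hproj M n b \<noteq> \<zero>\<^bsub>M\<^esub>})"
    have D: "finite D" unfolding D_def using B Bc finite_hproj by blast
    have supp: "hproj M n v = \<zero>\<^bsub>M\<^esub>" if "v \<in> W" "n \<notin> D" for n v
      using gen[OF that(1)] hproj_lincomb_zero[OF Bc B(1), of n] that(2) unfolding D_def by auto
    obtain N where N: "\<And>n. n \<in> D \<Longrightarrow> \<bar>n\<bar> \<le> int N"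
    proof -
      have "\<bar>n\<bar> \<le> int (nat (Max (abs ` D)))" if "n \<in> D" for n
      proof -
        have "\<bar>n\<bar> \<le> Max (abs ` D)" using D that by (intro Max_ge) auto
        then show ?thesis by linarith
      qed
      then show ?thesis by (rule that)
    qed
    \<comment> \<open>All degrees of \<open>W\<close> lie between \<open>-N\<close> and
      \<open>N\<close> and hence differ by at most \<open>2 * N\<close>; one step more leaves the
      range.\<close>
    define k where "k = 2 * N + 1"
    have "(op (up s) ^^ k) w = \<zero>\<^bsub>M\<^esub>"
    proof (rule eq_zero_if_hproj[OF pow_closed[OF wc]])
      fix n
      let ?d = "gen_degree (up s)"
      define n' where "n' = n - int k * ?d"
      have d: "?d = 1 \<or> ?d = -1" by (simp add: up_def)
      show "hproj M n ((op (up s) ^^ k) w) = \<zero>\<^bsub>M\<^esub>"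
      proof (cases "n \<in> D")
        case False
        then show ?thesis using supp[OF powW[OF w]] by blast
      next
        case True
        then have "n' \<notin> D" using d N[of n] N[of n'] unfolding n'_def k_def by auto
        then have "hproj M n' w = \<zero>\<^bsub>M\<^esub>" by (rule supp[OF w])
        then show ?thesis using hproj_pow[OF wc, of n' k "up s"] pow_zero unfolding n'_def by simp
      qed
    qed
    then show "\<exists>k. (op (up s) ^^ k) w = \<zero>\<^bsub>M\<^esub>" by blast
  qed
qed

text \<open>The set \<open>K\<close> of elements killed in all three ways is closed under addition:
  annihilators in \<open>R\<close> multiply and exponents add. A torsion element is a finite sum
  from finite-dimensional submodules, each of which lies in \<open>K\<close>.\<close>

lemma torsion_imp_mult_torsion:
  assumes "torsion (alg f) M"
  shows "mult_torsion (mults f) M (carrier M)"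
proof -
  have killed_add: "(\<exists>r. r \<noteq> 0 \<and> op (Coef r) (x \<oplus>\<^bsub>M\<^esub> y) = \<zero>\<^bsub>M\<^esub>) \<and> (\<forall>s. \<exists>k. (op (up s) ^^ k) (x \<oplus>\<^bsub>M\<^esub> y) = \<zero>\<^bsub>M\<^esub>)"
    if xy: "x \<in> carrier M" "y \<in> carrier M"
      "(\<exists>r. r \<noteq> 0 \<and> op (Coef r) x = \<zero>\<^bsub>M\<^esub>) \<and> (\<forall>s. \<exists>k. (op (up s) ^^ k) x = \<zero>\<^bsub>M\<^esub>)"
      "(\<exists>r. r \<noteq> 0 \<and> op (Coef r) y = \<zero>\<^bsub>M\<^esub>) \<and> (\<forall>s. \<exists>k. (op (up s) ^^ k) y = \<zero>\<^bsub>M\<^esub>)" for x y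
  proof (intro conjI allI)
    obtain r t where rt: "r \<noteq> 0" "t \<noteq> 0" "op (Coef r) x = \<zero>\<^bsub>M\<^esub>" "op (Coef t) y = \<zero>\<^bsub>M\<^esub>" using xy by blast
    have "op (Coef (r * t)) (x \<oplus>\<^bsub>M\<^esub> y) = \<zero>\<^bsub>M\<^esub>"
      using rt xy by (simp add: op_add op_closed op_Coef_mult op_zero op_Coef_comm[of y t])
    then show "\<exists>r. r \<noteq> 0 \<and> op (Coef r) (x \<oplus>\<^bsub>M\<^esub> y) = \<zero>\<^bsub>M\<^esub>" using rt by (intro exI[of _ "r * t"]) auto
    fix s
    obtain k l where kl: "(op (up s) ^^ k) x = \<zero>\<^bsub>M\<^esub>" "(op (up s) ^^ l) y = \<zero>\<^bsub>M\<^esub>" using xy by blast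
    have "(op (up s) ^^ (k + l)) (x \<oplus>\<^bsub>M\<^esub> y) = (op (up s) ^^ (l + k)) x \<oplus>\<^bsub>M\<^esub> (op (up s) ^^ (k + l)) y"
      using xy by (simp add: pow_add add.commute)
    also have "\<dots> = \<zero>\<^bsub>M\<^esub>" unfolding funpow_add using kl pow_zero by simp
    finally show "\<exists>k. (op (up s) ^^ k) (x \<oplus>\<^bsub>M\<^esub> y) = \<zero>\<^bsub>M\<^esub>" by blast
  qed
  define K where "K = {x \<in> carrier M. (\<exists>r. r \<noteq> 0 \<and> op (Coef r) x = \<zero>\<^bsub>M\<^esub>) \<and> (\<forall>s. \<exists>k. (op (up s) ^^ k) x = \<zero>\<^bsub>M\<^esub>)}"
  have K_add: "x \<oplus>\<^bsub>M\<^esub> y \<in> K" if "x \<in> K" "y \<in> K" for x y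
    using that killed_add unfolding K_def by simp
  have K_zero: "\<zero>\<^bsub>M\<^esub> \<in> K"
    unfolding K_def using op_zero pow_zero by (auto intro: exI[of _ 1])
  have K_sum: "(\<Oplus>\<^bsub>M\<^esub>W\<in>I. w W) \<in> K" if "finite I" "\<And>W. W \<in> I \<Longrightarrow> w W \<in> K" for I and w :: "'m set \<Rightarrow> 'm"
    using that
  proof (induction I rule: finite_induct)
    case (insert W I)
    then have "w \<in> I \<rightarrow> carrier M" "w W \<in> carrier M" unfolding K_def by auto
    then show ?case using insert K_add by simp
  qed (simp add: K_zero)
  have "m \<in> K" if m: "m \<in> carrier M" for m
  proof -
    have "\<exists>\<F> w. finite \<F> \<and> (\<forall>W\<in>\<F>. graded_submodule (alg f) M W \<and> finite_dimensional (alg f) M W \<and> w W \<in> W) \<and>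
        m = (\<Oplus>\<^bsub>M\<^esub>W\<in>\<F>. w W)"
      by (rule bspec[OF assms[unfolded torsion_def] m])
    then obtain \<F> w where Fw: "finite \<F> \<and> (\<forall>W\<in>\<F>. graded_submodule (alg f) M W \<and> finite_dimensional (alg f) M W \<and> w W \<in> W) \<and>
        m = (\<Oplus>\<^bsub>M\<^esub>W\<in>\<F>. w W)"
      by (elim exE)
    note F = Fw[THEN conjunct1] Fw[THEN conjunct2, THEN conjunct2]
      and W = bspec[OF Fw[THEN conjunct2, THEN conjunct1]]
    have "w W \<in> K" if "W \<in> \<F>" for W
      using finite_dimensional_mult_torsion[of W] W[OF that] graded_submoduleD(1)[of W] mult_torsion_iff[of W]
      unfolding K_def by auto
    then show ?thesis unfolding F(2) by (rule K_sum[OF F(1)])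
  qed
  then show ?thesis unfolding mult_torsion_iff[OF subset_refl] K_def by blast
qed

text \<open>The submodule generated by the components of \<open>m\<close> is spanned by words of the
  form coefficient, then power of one generator. The exponent is bounded because powers kill
  \<open>m\<close>, and the coefficient counts only modulo \<open>r\<close> because \<open>r\<close>
  kills \<open>m\<close>. So this one submodule is finite-dimensional and contains
  \<open>m\<close>.\<close>

lemma mult_torsion_imp_torsion:
  assumes "mult_torsion (mults f) M (carrier M)"
  shows "torsion (alg f) M"
  unfolding torsion_def
proof
  fix m assume m: "m \<in> carrier M"
  obtain r where r: "r \<noteq> 0" "op (Coef r) m = \<zero>\<^bsub>M\<^esub>"
    using assms m unfolding mult_torsion_iff[OF subset_refl] by blast
  obtain K where K: "\<And>s. (op (up s) ^^ K s) m = \<zero>\<^bsub>M\<^esub>"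
    using assms m unfolding mult_torsion_iff[OF subset_refl] by metis
  obtain T where T: "finite T" "\<And>t. \<exists>c p. t = (\<Sum>u\<in>T. \<iota> (c u) * u) + r * p" using finite_codim[OF r(1)] by blast
  define I where "I = {n. hproj M n m \<noteq> \<zero>\<^bsub>M\<^esub>}"
  have I: "finite I" unfolding I_def by (rule finite_hproj[OF m])
  \<comment> \<open>The normal form of a word acting on a component: the coefficient acts first,
    then \<open>k\<close> steps in the single direction \<open>s\<close>. Homogeneous components are
    used to make the span graded.\<close>
  define P where "P n s k t = (op (up s) ^^ k) (op (Coef t) (hproj M n m))" for n s k t
  \<comment> \<open>One bound for both directions; exponents beyond the bound \<open>K s\<close> of
    the direction \<open>s\<close> only contribute zero. Coefficients run through representatives
    modulo \<open>r\<close>.\<close>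
  define B where "B = (\<lambda>(n, s, k, t). P n s k t) ` (I \<times> UNIV \<times> {..<max (K True) (K False)} \<times> T)"
  have fB: "finite B" unfolding B_def using I T by auto
  have hc: "hproj M n m \<in> carrier M" for n by (rule hproj_closed[OF m])
  have Pc: "P n s k t \<in> carrier M" for n s k t unfolding P_def by (intro pow_closed op_closed hc)
  have Bc: "B \<subseteq> carrier M" unfolding B_def using Pc by auto
  have hr: "op (Coef r) (hproj M n m) = \<zero>\<^bsub>M\<^esub>" for n using hproj_Coef[OF m, of n r] r hproj_zero by simp
  have hK: "(op (up s) ^^ k) (hproj M n m) = \<zero>\<^bsub>M\<^esub>" if "K s \<le> k" for s k n
  proof -
    have "(op (up s) ^^ k) m = (op (up s) ^^ ((k - K s) + K s)) m" using that by simp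
    also have "\<dots> = \<zero>\<^bsub>M\<^esub>" unfolding funpow_add using K pow_zero by simp
    finally show ?thesis using hproj_pow[OF m, of n k "up s"] hproj_zero by simp
  qed
  have P_span: "P n s k t \<in> kspan B" for n s k t
  proof (cases "K s \<le> k \<or> n \<notin> I")
    case True
    then have "P n s k t = \<zero>\<^bsub>M\<^esub>"
      unfolding P_def using hK[of s k n] pow_Coef[OF hc] op_zero pow_zero by (auto simp: I_def)
    then show ?thesis using kspan.zero by simp
  next
    case False
    then have n: "n \<in> I" and k: "k < max (K True) (K False)" by (cases s; auto)+
    obtain c p where t: "t = (\<Sum>u\<in>T. \<iota> (c u) * u) + r * p" using T(2) by blast
    have part: "(op (up s) ^^ k) (op (Coef (\<Sum>u\<in>U. \<iota> (c u) * u)) (hproj M n m)) \<in> kspan B" if "finite U" "U \<subseteq> T" for U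
      using that
    proof (induction U rule: finite_induct)
      case empty
      then show ?case using kspan.zero by (simp add: op_Coef_zero[OF hc] pow_zero)
    next
      case (insert u U)
      have "op (Coef (\<iota> (c u) * u)) (hproj M n m) = op (Coef (\<iota> (c u))) (op (Coef u) (hproj M n m))"
        using hc by (simp add: mult.commute[of "\<iota> (c u)"] op_Coef_mult)
      then have "(op (up s) ^^ k) (op (Coef (\<iota> (c u) * u)) (hproj M n m)) = op (Coef ((tw (\<not> s) ^^ k) (\<iota> (c u)))) (P n s k u)"
        unfolding P_def by (simp add: pow_Coef op_closed hc)
      also have "(tw (\<not> s) ^^ k) (\<iota> (c u)) = \<iota> (c u)" by (induction k) (auto simp: tw_iota)
      finally have "(op (up s) ^^ k) (op (Coef (\<iota> (c u) * u)) (hproj M n m)) \<in> kspan B"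
        using kspan.gen[of "P n s k u" B "c u"] n k insert.prems unfolding B_def by force
      then show ?case
        using insert kspan.add by (simp add: op_Coef_add hc pow_add op_closed)
    qed
    \<comment> \<open>The multiple of \<open>r\<close> in \<open>t\<close> dies on the component,
      which leaves a combination of the representatives in \<open>T\<close>.\<close>
    have "op (Coef t) (hproj M n m) = op (Coef (\<Sum>u\<in>T. \<iota> (c u) * u)) (hproj M n m)"
      unfolding t by (simp add: op_Coef_add op_Coef_mult hc hr op_zero op_closed)
    then show ?thesis using part[OF T(1) subset_refl] unfolding P_def by simp
  qed
  \<comment> \<open>Generators preserve the normal form: a coefficient moves inward through the
    power with a twist, a step in direction \<open>s\<close> lengthens the power, and an opposite
    step cancels one step to a coefficient, or starts the other direction when
    \<open>k = 0\<close>.\<close>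
  have P_op: "op g (P n s k t) \<in> kspan B" for g n s k t
  proof -
    have C: "op (Coef u) (P n s k t) \<in> kspan B" for u n s k t
    proof -
      have "op (Coef u) (P n s k t) = P n s k (t * (tw s ^^ k) u)"
        unfolding P_def by (simp add: Coef_pow op_closed hc op_Coef_mult)
      then show ?thesis using P_span by simp
    qed
    show ?thesis
    proof (cases g rule: gen_cases[where s = s])
      case (Coef u)
      then show ?thesis using C by simp
    next
      case up
      then have "op g (P n s k t) = P n s (Suc k) t" unfolding P_def by simp
      then show ?thesis using P_span by simp
    next
      case dn
      show ?thesis
      proof (cases k)
        case 0
        then have "op g (P n s k t) = P n (\<not> s) 1 t" unfolding P_def dn by simp
        then show ?thesis using P_span by simp
      next
        case (Suc k')
        then have "op g (P n s k t) = op (Coef (cen s f)) (P n s k' t)"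
          unfolding dn P_def by (simp add: op_dn_up pow_closed op_closed hc)
        then show ?thesis using C by simp
      qed
    qed
  qed
  have B_op: "op g b \<in> kspan B" if "b \<in> B" for g b using that P_op unfolding B_def by auto
  have P_hproj: "hproj M i (P n s k t) \<in> kspan B" for i n s k t
  proof -
    define j where "j = i - int k * gen_degree (up s)"
    have "hproj M i (P n s k t) = P' " if "P' = (op (up s) ^^ k) (op (Coef t) (hproj M j (hproj M n m)))" for P'
      using that hproj_pow[OF op_closed[OF hc[of n], of "Coef t"], of j k "up s"] hproj_Coef[OF hc[of n]]
      unfolding P_def j_def by simp
    then have *: "hproj M i (P n s k t) = (op (up s) ^^ k) (op (Coef t) (hproj M j (hproj M n m)))" by blast
    show ?thesis
    proof (cases "j = n")
      case True
      then have "hproj M i (P n s k t) = P n s k t"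
        by (subst *) (simp add: P_def hproj_same[OF hproj_component[OF m]])
      then show ?thesis using P_span by simp
    next
      case False
      then show ?thesis unfolding * using kspan.zero
        by (simp add: hproj_diff[OF hproj_component[OF m]] op_zero pow_zero)
    qed
  qed
  have B_hproj: "hproj M i b \<in> kspan B" if "b \<in> B" for i b using that P_hproj unfolding B_def by auto
  let ?W = "kspan B"
  have W: "graded_submodule (alg f) M ?W"
  proof (rule graded_submoduleI)
    show sub: "?W \<subseteq> carrier M" using kspan_carrier[OF Bc] by blast
    show "\<zero>\<^bsub>M\<^esub> \<in> ?W" by (rule kspan.zero)
    show "\<And>x y. \<lbrakk>x \<in> ?W; y \<in> ?W\<rbrakk> \<Longrightarrow> x \<oplus>\<^bsub>M\<^esub> y \<in> ?W" by (rule kspan.add)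
    have op_span: "op g w \<in> ?W" if "w \<in> ?W" for g w
      by (rule kspan_map[OF Bc that]) (auto simp: op_add op_zero B_op op_Coef_iota)
    show "w \<triangleleft>\<^bsub>M\<^esub> a \<in> ?W" if "w \<in> ?W" "a \<in> carrier (alg f)" for w a
      by (rule ract_closed_iff[OF sub kspan.zero kspan.add op_span that])
    show "hproj M n w \<in> ?W" if "w \<in> ?W" for n w
      by (rule kspan_map[OF Bc that]) (auto simp: hproj_add hproj_zero hproj_Coef B_hproj)
  qed
  have fd: "finite_dimensional (alg f) M ?W"
  proof -
    have "B \<subseteq> ?W"
    proof
      fix b assume "b \<in> B"
      then show "b \<in> ?W" using kspan.gen[of b B 1] Bc by (simp add: iota_one op_one subset_iff)
    qed
    then show ?thesis unfolding finite_dimensional_def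
      using fB kspan_lincomb[OF Bc fB] unfolding lincomb_def by blast
  qed
  have "(\<Oplus>\<^bsub>M\<^esub>n\<in>J. hproj M n m) \<in> ?W" if "finite J" for J
    using that
  proof (induction J rule: finite_induct)
    case (insert n J)
    have "hproj M n m \<in> ?W" using P_span[of n True 0 1] unfolding P_def by (simp add: op_one hc)
    then show ?case using insert hc kspan.add by simp
  qed (simp add: kspan.zero)
  then have "m \<in> ?W" using hproj_sum[OF m] I unfolding I_def by metis
  then show "\<exists>\<F> w. finite \<F> \<and> (\<forall>W\<in>\<F>. graded_submodule (alg f) M W \<and> finite_dimensional (alg f) M W \<and> w W \<in> W) \<and>
      m = (\<Oplus>\<^bsub>M\<^esub>W\<in>\<F>. w W)"
    using W fd m by (intro exI[of _ "{?W}"] exI[of _ "\<lambda>_. m"]) simp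
qed

end

context gwa_fin
begin

lemma torsion_iff:
  assumes "graded_right_module (alg f) M"
  shows "torsion (alg f) M \<longleftrightarrow> mult_torsion (mults f) M (carrier M)"
proof -
  interpret gwa_fin_module \<iota> \<sigma> z f M
    using assms by (intro gwa_fin_module.intro gwa_module.intro gwa_fin_axioms gwa_base_axioms)
  show ?thesis using torsion_imp_mult_torsion mult_torsion_imp_torsion by blast
qed

text \<open>The algebra is not commutative, but each of the three sets is: coefficients come from a
  commutative ring, and powers of one generator commute. Nonzero coefficients are closed under
  products because \<open>R\<close> is a domain.\<close>

lemma torsion_theory: "torsion_theory TYPE('m) (alg f) (mults f)"
proof -
  interpret R: ring "alg f" by (rule ring_gwa)
  have nz: "1 \<noteq> (0::'r)" by simp
  show ?thesis
  proof (intro torsion_theory.intro torsion_theory_axioms.intro ring_gwa)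
    show "S \<subseteq> carrier (alg f)" if "S \<in> mults f" for S
      using that gn_closed unfolding mults_def by auto
    show "\<one>\<^bsub>alg f\<^esub> \<in> S" if S: "S \<in> mults f" for S
    proof -
      have "\<one>\<^bsub>alg f\<^esub> \<in> {gn f (Coef r) | r. r \<noteq> 0}" using gn_one[of f, symmetric] nz by blast
      moreover have "\<one>\<^bsub>alg f\<^esub> \<in> range (\<lambda>k::nat. gn f g [^]\<^bsub>alg f\<^esub> k)" for g
        using R.nat_pow_0[of "gn f g"] by (metis rangeI)
      ultimately show ?thesis using S unfolding mults_def by auto
    qed
    show "s \<otimes>\<^bsub>alg f\<^esub> t \<in> S" if S: "S \<in> mults f" "s \<in> S" "t \<in> S" for S s t
    proof -
      consider (c) "S = {gn f (Coef r) | r. r \<noteq> 0}" | (p) g where "S = range (\<lambda>k::nat. gn f g [^]\<^bsub>alg f\<^esub> k)"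
        using S(1) unfolding mults_def by auto
      then show ?thesis
      proof cases
        case c
        then obtain r t' where "s = gn f (Coef r)" "t = gn f (Coef t')" "r \<noteq> 0" "t' \<noteq> 0" using S(2,3) by auto
        then have "s \<otimes>\<^bsub>alg f\<^esub> t = gn f (Coef (r * t'))" "r * t' \<noteq> 0" by (auto simp: gn_mult)
        then show ?thesis unfolding c by blast
      next
        case p
        then show ?thesis using S(2,3) by (auto simp: R.nat_pow_mult gn_closed)
      qed
    qed
    show "s \<otimes>\<^bsub>alg f\<^esub> t = t \<otimes>\<^bsub>alg f\<^esub> s" if S: "S \<in> mults f" "s \<in> S" "t \<in> S" for S s t
    proof -
      consider (c) "S = {gn f (Coef r) | r. r \<noteq> 0}" | (p) g where "S = range (\<lambda>k::nat. gn f g [^]\<^bsub>alg f\<^esub> k)"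
        using S(1) unfolding mults_def by auto
      then show ?thesis
      proof cases
        case c
        then show ?thesis using S(2,3) by (auto simp flip: gn_mult simp: mult.commute)
      next
        case p
        then show ?thesis using S(2,3) by (auto simp: R.nat_pow_mult gn_closed add.commute)
      qed
    qed
    show "grade (alg f) j \<subseteq> carrier (alg f)" for j by (rule grade_alg)
    show "scal (alg f) c \<in> carrier (alg f)" for c by (simp add: alg_ops)
    show "scal (alg f) c \<otimes>\<^bsub>alg f\<^esub> a = a \<otimes>\<^bsub>alg f\<^esub> scal (alg f) c" if "a \<in> carrier (alg f)" for a c
      by (rule scal_central_alg[OF that])
    show "scal (alg f) c \<in> grade (alg f) 0" for c by (rule scal_grade_alg)
  next
    fix M :: "('k, 'r, 'm) gwa_gr_module" and W
    assume M: "graded_right_module (alg f) M" and W: "graded_submodule (alg f) M W"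
    interpret M: graded_right_module "alg f" M by fact
    interpret Q: graded_quotient "alg f" M W
      using M W grade_alg by (simp add: graded_quotient_def graded_quotient_axioms_def)
    show "torsion (alg f) (sub_gr_module M W) \<longleftrightarrow> mult_torsion (mults f) M W"
      using torsion_iff[OF M.graded_right_module_sub[OF W grade_alg]]
      unfolding mult_torsion_def by (simp add: sub_gr_module_simps)
    \<comment> \<open>A coset is killed by \<open>s\<close> exactly if \<open>s\<close> carries its
      representative into \<open>W\<close>, so torsion of the quotient is density of
      \<open>W\<close>.\<close>
    have "mult_torsion (mults f) Q.Q (carrier Q.Q) \<longleftrightarrow> mult_dense (mults f) M W"
    proof -
      have sub: "S \<in> mults f \<Longrightarrow> s \<in> S \<Longrightarrow> s \<in> carrier (alg f)" for S s
        using gn_closed unfolding mults_def by auto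
      have "(Q.coset m \<triangleleft>\<^bsub>Q.Q\<^esub> s = \<zero>\<^bsub>Q.Q\<^esub>) \<longleftrightarrow> m \<triangleleft>\<^bsub>M\<^esub> s \<in> W" if "S \<in> mults f" "s \<in> S" "m \<in> carrier M" for S s m
        using that sub[OF that(1,2)] by (simp add: Q.coset_ract Q.coset_eq_zero M.ract_closed)
      then show ?thesis unfolding mult_torsion_def mult_dense_def Q.coset_carrier by simp
    qed
    then show "torsion (alg f) (quot_gr_module M W) \<longleftrightarrow> mult_dense (mults f) M W"
      using torsion_iff[OF Q.graded_right_module_quot] by simp
  qed
qed

end

section \<open>Moving a factor of \<open>f\<close> along the grading\<close>

definition transport :: "('m \<Rightarrow> 'n) \<Rightarrow> ('a, 'm) gr_module \<Rightarrow> ('a, 'n) gr_module" where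
  "transport e P = \<lparr>carrier = e ` carrier P, monoid.mult = (\<lambda>_ _. undefined), one = undefined,
     ring.zero = e \<zero>\<^bsub>P\<^esub>, add = (\<lambda>u v. e (inv_into (carrier P) e u \<oplus>\<^bsub>P\<^esub> inv_into (carrier P) e v)),
     ract = (\<lambda>u a. e (inv_into (carrier P) e u \<triangleleft>\<^bsub>P\<^esub> a)), component = (\<lambda>n. e ` component P n)\<rparr>"

lemma transport_simps:
  assumes "inj_on e (carrier P)"
  shows "carrier (transport e P) = e ` carrier P" "\<zero>\<^bsub>transport e P\<^esub> = e \<zero>\<^bsub>P\<^esub>"
    "component (transport e P) n = e ` component P n"
    "\<lbrakk>p \<in> carrier P; p' \<in> carrier P\<rbrakk> \<Longrightarrow> e p \<oplus>\<^bsub>transport e P\<^esub> e p' = e (p \<oplus>\<^bsub>P\<^esub> p')"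
    "p \<in> carrier P \<Longrightarrow> e p \<triangleleft>\<^bsub>transport e P\<^esub> a = e (p \<triangleleft>\<^bsub>P\<^esub> a)"
  using assms by (simp_all add: transport_def)

lemma graded_right_module_transport:
  assumes P: "graded_right_module A P" and e: "inj_on e (carrier P)"
    and grade_carrier: "\<And>j. grade A j \<subseteq> carrier A"
  shows "graded_right_module A (transport e P)"
proof -
  interpret P: graded_right_module A P by (rule P)
  let ?N = "transport e P"
  note simps = transport_simps[OF e]
  have N: "abelian_group ?N"
  proof (rule abelian_groupI)
    show "\<exists>y\<in>carrier ?N. y \<oplus>\<^bsub>?N\<^esub> x = \<zero>\<^bsub>?N\<^esub>" if x: "x \<in> carrier ?N" for x
    proof -
      obtain p where p: "p \<in> carrier P" "x = e p" using x by (auto simp: simps)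
      then have "e (\<ominus>\<^bsub>P\<^esub> p) \<oplus>\<^bsub>?N\<^esub> x = \<zero>\<^bsub>?N\<^esub>" by (simp add: simps P.M.l_neg)
      then show ?thesis using p by (auto simp: simps)
    qed
  qed (auto simp: simps P.M.a_ac)
  interpret N: abelian_group ?N by (rule N)
  have sub: "additive_subgroup (component ?N n) ?N" for n
  proof (intro additive_subgroupI group.subgroupI)
    show "group (add_monoid ?N)" using N.a_group .
    show "inv\<^bsub>add_monoid ?N\<^esub> a \<in> component ?N n" if a: "a \<in> component ?N n" for a
    proof -
      obtain p where p: "p \<in> component P n" "p \<in> carrier P" "a = e p"
        using a P.component_carrier by (auto simp: simps)
      have "\<ominus>\<^bsub>?N\<^esub> a = e (\<ominus>\<^bsub>P\<^esub> p)" by (rule N.minus_equality) (use p in \<open>auto simp: simps P.M.l_neg\<close>)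
      then show ?thesis using p additive_subgroup.a_inv_closed[OF P.component_subgroup]
        by (auto simp: a_inv_def simps)
    qed
    show "a \<otimes>\<^bsub>add_monoid ?N\<^esub> b \<in> component ?N n" if "a \<in> component ?N n" "b \<in> component ?N n" for a b
      using that P.component_carrier P.component_add by (auto simp: simps)
  qed (use P.component_carrier P.component_zero in \<open>auto simp: simps\<close>)
  define \<pi> where "\<pi> n u = e (hproj P n (inv_into (carrier P) e u))" for n u
  have pi: "\<pi> n (e p) = e (hproj P n p)" if "p \<in> carrier P" for n p
    unfolding \<pi>_def using e that by simp
  show ?thesis
  proof (intro graded_right_module.intro graded_right_module_axioms.intro)
    show "\<exists>!c. homogeneous_decomposition ?N c m" if "m \<in> carrier ?N" for m
    proof (rule direct_sumI[OF N sub, where p = \<pi>])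
      fix m assume "m \<in> carrier ?N"
      then obtain p where p: "p \<in> carrier P" "m = e p" by (auto simp: simps)
      let ?I = "{n. hproj P n p \<noteq> \<zero>\<^bsub>P\<^esub>}"
      have "m = e (\<Oplus>\<^bsub>P\<^esub>n\<in>?I. hproj P n p)" using p P.hproj_sum by simp
      also have "\<dots> = (\<Oplus>\<^bsub>?N\<^esub>n\<in>?I. e (hproj P n p))"
        by (rule additive_map_finsum[OF P.M.abelian_group_axioms N])
          (use p in \<open>auto simp: simps P.finite_hproj P.hproj_closed\<close>)
      also have "(\<lambda>n. e (hproj P n p)) = (\<lambda>n. \<pi> n m)" using p pi by auto
      finally have "m = (\<Oplus>\<^bsub>?N\<^esub>n\<in>?I. \<pi> n m)" .
      moreover have "\<pi> n m = \<zero>\<^bsub>?N\<^esub>" if "n \<notin> ?I" for n using that p by (simp add: pi simps)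
      moreover have "finite ?I" by (rule P.finite_hproj[OF p(1)])
      ultimately show "\<exists>I. finite I \<and> (\<forall>n. n \<notin> I \<longrightarrow> \<pi> n m = \<zero>\<^bsub>?N\<^esub>) \<and> m = (\<Oplus>\<^bsub>?N\<^esub>n\<in>I. \<pi> n m)"
        by blast
    next
      show "\<pi> k m = \<zero>\<^bsub>?N\<^esub>" if "m \<in> component ?N n" "k \<noteq> n" for n k m
        using that P.component_carrier P.hproj_diff by (auto simp: simps pi)
    qed (use that P.component_carrier in
        \<open>auto simp: simps pi P.hproj_component P.hproj_add P.hproj_same P.hproj_closed\<close>)
    show "m \<triangleleft>\<^bsub>?N\<^esub> a \<in> component ?N (i + j)" if "m \<in> component ?N i" "a \<in> grade A j" for m a i j
      using that P.component_carrier P.component_ract grade_carrier by (auto simp: simps)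
  qed (use N sub in \<open>auto simp: simps P.ract_closed P.ract_add_left P.ract_add_right P.ract_assoc P.ract_one P.A.ring_axioms\<close>)
qed

text \<open>
  The functor has to produce modules whose elements lie in the same type \<open>'m\<close>. Since a graded module is
  either zero or infinite, pairs of elements can be encoded as elements.
\<close>

definition enc :: "('a, 'm) gr_module \<Rightarrow> 'm \<times> 'm \<Rightarrow> 'm" where
  "enc M = (SOME e. inj_on e (carrier M \<times> carrier M))"

text \<open>If \<open>m\<close> is nonzero, \<open>c \<mapsto> m c\<close> embeds the infinite field
  into the module, as a nonzero scalar acts invertibly. An infinite set is in bijection with its
  square, and for the zero module any map is injective.\<close>

lemma (in gwa_fin) inj_enc:
  fixes M :: "('k, 'r, 'm) gwa_gr_module"
  assumes "graded_right_module (alg f) M"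
  shows "inj_on (enc M) (carrier M \<times> carrier M)"
proof -
  interpret gwa_fin_module \<iota> \<sigma> z f M
    using assms by (intro gwa_fin_module.intro gwa_module.intro gwa_fin_axioms gwa_base_axioms)
  have "\<exists>e :: 'm \<times> 'm \<Rightarrow> 'm. inj_on e (carrier M \<times> carrier M)"
  proof (cases "carrier M = {\<zero>\<^bsub>M\<^esub>}")
    case True
    then show ?thesis by (auto simp: inj_on_def)
  next
    case False
    then obtain m where m: "m \<in> carrier M" "m \<noteq> \<zero>\<^bsub>M\<^esub>" by blast
    have "inj (\<lambda>c. op (Coef (\<iota> c)) m)"
    proof (rule injI, rule ccontr)
      fix c c' assume eq: "op (Coef (\<iota> c)) m = op (Coef (\<iota> c')) m" and "c \<noteq> c'"
      have "op (Coef (\<iota> (c - c'))) m \<oplus>\<^bsub>M\<^esub> op (Coef (\<iota> c')) m = op (Coef (\<iota> c')) m"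
        using op_Coef_add[OF m(1), of "\<iota> (c - c')" "\<iota> c'"] eq by (simp flip: iota_add)
      then have "op (Coef (\<iota> (c - c'))) m = \<zero>\<^bsub>M\<^esub>"
        using m(1) by (simp add: op_closed M.add.r_cancel_one)
      then have "op (Coef (\<iota> (c - c') * \<iota> (inverse (c - c')))) m = \<zero>\<^bsub>M\<^esub>"
        using m(1) by (simp add: op_Coef_mult op_zero)
      then show False using \<open>c \<noteq> c'\<close> m by (simp add: iota_one op_one flip: iota_mult)
    qed
    moreover have "range (\<lambda>c. op (Coef (\<iota> c)) m) \<subseteq> carrier M" using m(1) op_closed by blast
    ultimately have "infinite (carrier M)"
      using infinite_field finite_imageD finite_subset by blast
    then have "\<exists>e. bij_betw e (carrier M \<times> carrier M) (carrier M)"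
      using card_of_Times_same_infinite card_of_ordIso by blast
    then show ?thesis by (auto simp: bij_betw_def)
  qed
  then show ?thesis unfolding enc_def by (rule someI_ex)
qed

context gwa_base
begin

text \<open>
  In \<open>alg (par s \<phi>)\<close> the generator \<open>up s\<close> followed by \<open>up (\<not> s)\<close> is \<open>\<phi>\<close>; exchanging \<open>x\<close> and \<open>y\<close>
  amounts to negating \<open>s\<close>.
\<close>

definition par :: "bool \<Rightarrow> 'r \<Rightarrow> 'r" where "par s \<phi> = (if s then \<phi> else \<sigma> \<phi>)"

lemma cen_par: "cen s (par s \<phi>) = \<phi>" "cen (\<not> s) (par s \<phi>) = tw (\<not> s) \<phi>"
  by (auto simp: cen_def par_def tw_def tau_sigma)

lemma par_not: "par (\<not> s) \<phi> = par s (tw s \<phi>)"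
  by (auto simp: par_def tw_def sigma_tau)

lemma gwa_opsI:
  assumes "\<And>\<gamma> m. m \<in> carrier M \<Longrightarrow> op \<gamma> m \<in> carrier M"
    and "\<And>\<gamma> m m'. \<lbrakk>m \<in> carrier M; m' \<in> carrier M\<rbrakk> \<Longrightarrow> op \<gamma> (m \<oplus>\<^bsub>M\<^esub> m') = op \<gamma> m \<oplus>\<^bsub>M\<^esub> op \<gamma> m'"
    and "\<And>\<gamma> n m. m \<in> component M n \<Longrightarrow> op \<gamma> m \<in> component M (n + gen_degree \<gamma>)"
    and "\<And>m r t. m \<in> carrier M \<Longrightarrow> op (Coef (r + t)) m = op (Coef r) m \<oplus>\<^bsub>M\<^esub> op (Coef t) m"
    and "\<And>m r t. m \<in> carrier M \<Longrightarrow> op (Coef (r * t)) m = op (Coef t) (op (Coef r) m)"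
    and "\<And>m. m \<in> carrier M \<Longrightarrow> op (Coef 1) m = m"
    and "\<And>m. m \<in> carrier M \<Longrightarrow> op (up (\<not> s)) (op (up s) m) = op (Coef \<phi>) m"
    and "\<And>m. m \<in> carrier M \<Longrightarrow> op (up s) (op (up (\<not> s)) m) = op (Coef (tw (\<not> s) \<phi>)) m"
    and "\<And>m r. m \<in> carrier M \<Longrightarrow> op (Coef r) (op (up s) m) = op (up s) (op (Coef (tw s r)) m)"
    and "\<And>m r. m \<in> carrier M \<Longrightarrow> op (Coef r) (op (up (\<not> s)) m) = op (up (\<not> s)) (op (Coef (tw (\<not> s) r)) m)"
  shows "gwa_ops (par s \<phi>) M op"
  using assms unfolding gwa_ops_def by (cases s) (simp_all add: up_def par_def tw_def tau_sigma)

text \<open>Closure under the generators spreads to the whole algebra by \<open>alg_induct\<close>: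
  sums are handled by additivity of the relation, products by acting twice.\<close>

lemma graded_relation_gensI:
  assumes M: "graded_right_module (alg f) M" and N: "graded_right_module (alg f) N"
    and sub: "\<And>m n. (m, n) \<in> \<Gamma> \<Longrightarrow> m \<in> carrier M \<and> n \<in> carrier N" and zero: "(\<zero>\<^bsub>M\<^esub>, \<zero>\<^bsub>N\<^esub>) \<in> \<Gamma>"
    and add: "\<And>m n m' n'. \<lbrakk>(m, n) \<in> \<Gamma>; (m', n') \<in> \<Gamma>\<rbrakk> \<Longrightarrow> (m \<oplus>\<^bsub>M\<^esub> m', n \<oplus>\<^bsub>N\<^esub> n') \<in> \<Gamma>"
    and gen: "\<And>m n \<gamma>. (m, n) \<in> \<Gamma> \<Longrightarrow> (m \<triangleleft>\<^bsub>M\<^esub> gn f \<gamma>, n \<triangleleft>\<^bsub>N\<^esub> gn f \<gamma>) \<in> \<Gamma>"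
    and hproj: "\<And>m n i. (m, n) \<in> \<Gamma> \<Longrightarrow> (hproj M i m, hproj N i n) \<in> \<Gamma>"
  shows "graded_relation (alg f) M N \<Gamma>"
proof (rule graded_relationI[OF sub zero add _ hproj])
  interpret M: graded_right_module "alg f" M by fact
  interpret N: graded_right_module "alg f" N by fact
  fix m n a assume mn: "(m, n) \<in> \<Gamma>" and a: "a \<in> carrier (alg f)"
  show "(m \<triangleleft>\<^bsub>M\<^esub> a, n \<triangleleft>\<^bsub>N\<^esub> a) \<in> \<Gamma>"
    using a mn
  proof (induction a arbitrary: m n rule: alg_induct)
    case (gen \<gamma>)
    then show ?case by (rule assms(6))
  next
    case (add a b)
    then show ?case using sub assms(5) by (simp add: M.ract_add_right N.ract_add_right)
  next
    case (mult a b)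
    then show ?case using sub by (simp add: M.ract_assoc N.ract_assoc)
  qed
qed

end

section \<open>The module of pairs\<close>

locale shift_module = gwa_fin_module \<iota> \<sigma> z f M
  for \<iota> :: "'k::field \<Rightarrow> 'r::idom" and \<sigma> :: "'r \<Rightarrow> 'r" and z f :: 'r
    and M :: "('k, 'r, 'm) gwa_gr_module" +
  fixes s :: bool and h g :: 'r
  assumes f: "f = par s (h * g)"
begin

abbreviation "U \<equiv> op (up s)"
abbreviation "D \<equiv> op (up (\<not> s))"
abbreviation "C r \<equiv> op (Coef r)"

lemma C_C: "m \<in> carrier M \<Longrightarrow> C r (C t m) = C (r * t) m"
  by (metis op_Coef_mult mult.commute)

lemma U_C: "m \<in> carrier M \<Longrightarrow> U (C r m) = C (tw (\<not> s) r) (U m)"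
  by (simp add: op_Coef_up)

lemma D_C: "m \<in> carrier M \<Longrightarrow> D (C r m) = C (tw s r) (D m)"
  by (simp add: op_Coef_up[of _ _ "\<not> s"])

lemma cen_f: "cen s f = h * g" "cen (\<not> s) f = tw (\<not> s) h * tw (\<not> s) g"
  by (simp_all add: f cen_par tw_mult)

lemma D_U: "m \<in> carrier M \<Longrightarrow> D (U m) = C (h * g) m"
  by (simp add: op_dn_up cen_f)

lemma U_D: "m \<in> carrier M \<Longrightarrow> U (D m) = C (tw (\<not> s) h * tw (\<not> s) g) m"
  using op_dn_up[of m "\<not> s"] by (simp add: cen_f)

text \<open>A normalization: coefficients are moved outward past \<open>U\<close> and
  \<open>D\<close>, and adjacent \<open>U\<close> and \<open>D\<close> merge into a coefficient. The
  remaining identities hold by commutativity of \<open>R\<close>.\<close>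

lemmas rules = C_C U_C D_C D_U U_D op_closed tw_mult

text \<open>The second equation is the first with \<open>h\<close> cancelled: applying
  \<open>D\<close> to the first gives \<open>C h (D b) = C h (C g a)\<close>. Since \<open>h\<close>
  may kill elements, both are required. The coordinate \<open>b\<close> sits one step further along
  \<open>up s\<close>, which explains the shift \<open>eps\<close> of its degree and the twist of
  its coefficients in \<open>pop\<close>.\<close>

definition pairs :: "('m \<times> 'm) set" where
  "pairs = {(a, b). a \<in> carrier M \<and> b \<in> carrier M \<and> U a = C (tw (\<not> s) h) b \<and> D b = C g a}"

definition pop :: "'r gwa_gen \<Rightarrow> 'm \<times> 'm \<Rightarrow> 'm \<times> 'm" where
  "pop \<gamma> p = (case \<gamma> of Coef r \<Rightarrow> (C r (fst p), C (tw (\<not> s) r) (snd p))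
     | _ \<Rightarrow> if \<gamma> = up s then (C h (snd p), U (snd p)) else (D (fst p), C (tw (\<not> s) g) (fst p)))"

lemma pop_Coef: "pop (Coef r) p = (C r (fst p), C (tw (\<not> s) r) (snd p))"
  and pop_up: "pop (up s) p = (C h (snd p), U (snd p))"
  and pop_dn: "pop (up (\<not> s)) p = (D (fst p), C (tw (\<not> s) g) (fst p))"
  by (auto simp: pop_def up_def)

definition padd :: "'m \<times> 'm \<Rightarrow> 'm \<times> 'm \<Rightarrow> 'm \<times> 'm" where
  "padd p p' = (fst p \<oplus>\<^bsub>M\<^esub> fst p', snd p \<oplus>\<^bsub>M\<^esub> snd p')"

definition eps :: int where "eps = gen_degree (up s)"

definition pair_module :: "('k, 'r, 'm \<times> 'm) gwa_gr_module" where
  "pair_module = \<lparr>carrier = pairs, monoid.mult = (\<lambda>_ _. undefined), one = undefined,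
     ring.zero = (\<zero>\<^bsub>M\<^esub>, \<zero>\<^bsub>M\<^esub>), add = padd, ract = (\<lambda>_ _. undefined),
     component = (\<lambda>n. {p \<in> pairs. fst p \<in> component M n \<and> snd p \<in> component M (n + eps)})\<rparr>"

lemma pairsD:
  assumes "p \<in> pairs"
  shows "fst p \<in> carrier M" "snd p \<in> carrier M" "U (fst p) = C (tw (\<not> s) h) (snd p)" "D (snd p) = C g (fst p)"
  using assms unfolding pairs_def by auto

lemma pairs_carrier: "(a, b) \<in> pairs \<Longrightarrow> a \<in> carrier M" "(a, b) \<in> pairs \<Longrightarrow> b \<in> carrier M"
  unfolding pairs_def by auto

lemma pairsI:
  "\<lbrakk>a \<in> carrier M; b \<in> carrier M; U a = C (tw (\<not> s) h) b; D b = C g a\<rbrakk> \<Longrightarrow> (a, b) \<in> pairs"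
  unfolding pairs_def by auto

lemma zero_pairs: "(\<zero>\<^bsub>M\<^esub>, \<zero>\<^bsub>M\<^esub>) \<in> pairs"
  by (intro pairsI) (auto simp: op_zero)

lemma padd_pairs: "\<lbrakk>p \<in> pairs; p' \<in> pairs\<rbrakk> \<Longrightarrow> padd p p' \<in> pairs"
  unfolding padd_def by (intro pairsI) (simp_all add: op_add pairsD)

text \<open>Any element \<open>b\<close> yields a pair, not only the second coordinate of one;
  dually for \<open>dn_pairs\<close>. So a step in direction \<open>s\<close> needs control of one
  coordinate only, which keeps powers and density manageable.\<close>

lemma up_pairs: "b \<in> carrier M \<Longrightarrow> (C h b, U b) \<in> pairs"
  by (intro pairsI) (simp_all add: rules mult_ac)

lemma dn_pairs: "a \<in> carrier M \<Longrightarrow> (D a, C (tw (\<not> s) g) a) \<in> pairs"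
  by (intro pairsI) (simp_all add: rules mult_ac)

lemma pop_pairs: "p \<in> pairs \<Longrightarrow> pop \<gamma> p \<in> pairs"
proof (cases \<gamma> rule: gen_cases[where s = s])
  case (Coef r)
  assume p: "p \<in> pairs"
  have "U (C r (fst p)) = C (tw (\<not> s) h) (C (tw (\<not> s) r) (snd p))"
    "D (C (tw (\<not> s) r) (snd p)) = C g (C r (fst p))"
    using pairsD[OF p] by (simp_all add: rules mult_ac)
  then show ?thesis unfolding Coef pop_Coef using pairsD[OF p] by (intro pairsI op_closed)
qed (simp_all add: pop_up pop_dn up_pairs dn_pairs pairsD)

lemma hproj_pairs:
  assumes "p \<in> pairs"
  shows "(hproj M n (fst p), hproj M (n + eps) (snd p)) \<in> pairs"
proof -
  note p = pairsD[OF assms]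
  have "hproj M (n + eps) (U (fst p)) = U (hproj M n (fst p))"
    using hproj_op[OF p(1), of n "up s"] by (simp add: eps_def)
  moreover have "hproj M (n + eps + gen_degree (up (\<not> s))) (D (snd p)) = D (hproj M (n + eps) (snd p))"
    by (rule hproj_op[OF p(2)])
  moreover have "n + eps + gen_degree (up (\<not> s)) = n" by (simp add: eps_def up_def)
  ultimately show ?thesis
    using p by (intro pairsI) (simp_all add: hproj_closed hproj_Coef)
qed

lemma pair_module_simps:
  "carrier pair_module = pairs" "\<zero>\<^bsub>pair_module\<^esub> = (\<zero>\<^bsub>M\<^esub>, \<zero>\<^bsub>M\<^esub>)" "p \<oplus>\<^bsub>pair_module\<^esub> p' = padd p p'"
  "component pair_module n = {p \<in> pairs. fst p \<in> component M n \<and> snd p \<in> component M (n + eps)}"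
  by (simp_all add: pair_module_def)

lemma abelian_group_pair_module: "abelian_group pair_module"
proof (rule abelian_groupI)
  show "\<exists>y\<in>carrier pair_module. y \<oplus>\<^bsub>pair_module\<^esub> x = \<zero>\<^bsub>pair_module\<^esub>" if x: "x \<in> carrier pair_module" for x
  proof -
    have p: "x \<in> pairs" using x by (simp add: pair_module_simps)
    \<comment> \<open>Negation by the coefficient -1, for which membership in \<open>pairs\<close>
      is already known.\<close>
    let ?y = "pop (Coef (- 1)) x"
    have "C (- 1) m \<oplus>\<^bsub>M\<^esub> m = \<zero>\<^bsub>M\<^esub>" if "m \<in> carrier M" for m
      using op_Coef_add[OF that, of "- 1" 1] that by (simp add: op_one op_Coef_zero)
    moreover have "tw (\<not> s) (- 1) = - 1"
      using tw_add[of "\<not> s" "- 1" 1] by (simp add: tw_one tw_zero eq_neg_iff_add_eq_0)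
    ultimately have "padd ?y x = (\<zero>\<^bsub>M\<^esub>, \<zero>\<^bsub>M\<^esub>)"
      using pairsD[OF p] by (simp add: padd_def pop_Coef)
    then show ?thesis using pop_pairs[OF p] by (auto simp: pair_module_simps)
  qed
qed (auto simp: pair_module_simps padd_pairs zero_pairs, auto simp: padd_def pairs_carrier M.a_ac)

text \<open>Here the factor moves. In the first coordinate, up and then down gives
  \<open>D (C h b) = C (tw s h) (D b)\<close>, and the pair condition \<open>D b = C g a\<close>
  turns this into the action of \<open>tw s h * g\<close> on \<open>a\<close>. In the second
  coordinate the product of \<open>h\<close> and \<open>tw (\<not> s) g\<close> is the twist of the
  same coefficient.\<close>

lemma gwa_ops_pairs: "gwa_ops (par s (tw s h * g)) pair_module pop"
proof (rule gwa_opsI)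
  fix \<gamma> p p' assume p: "p \<in> carrier pair_module" "p' \<in> carrier pair_module"
  then have q: "p \<in> pairs" "p' \<in> pairs" by (auto simp: pair_module_simps)
  show "pop \<gamma> p \<in> carrier pair_module" using pop_pairs q by (simp add: pair_module_simps)
  show "pop \<gamma> (p \<oplus>\<^bsub>pair_module\<^esub> p') = pop \<gamma> p \<oplus>\<^bsub>pair_module\<^esub> pop \<gamma> p'"
    by (cases \<gamma> rule: gen_cases[where s = s])
      (use pairsD[OF q(1)] pairsD[OF q(2)] in \<open>simp_all add: pair_module_simps padd_def pop_Coef pop_up pop_dn op_add\<close>)
next
  fix p and r t :: 'r assume "p \<in> carrier pair_module"
  then have "p \<in> pairs" by (auto simp: pair_module_simps)
  note p = pairsD[OF this]
  show "pop (Coef (r + t)) p = pop (Coef r) p \<oplus>\<^bsub>pair_module\<^esub> pop (Coef t) p"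
    using p by (simp add: pair_module_simps padd_def pop_Coef op_Coef_add tw_add)
  show "pop (Coef (r * t)) p = pop (Coef t) (pop (Coef r) p)"
    using p by (simp add: pop_Coef rules mult_ac)
  show "pop (Coef 1) p = p"
    using p by (simp add: pop_Coef tw_one op_one)
  show "pop (up (\<not> s)) (pop (up s) p) = pop (Coef (tw s h * g)) p"
    using p by (simp add: pop_Coef pop_up pop_dn rules mult_ac)
  show "pop (up s) (pop (up (\<not> s)) p) = pop (Coef (tw (\<not> s) (tw s h * g))) p"
    using p by (simp add: pop_Coef pop_up pop_dn rules mult_ac)
  show "pop (Coef r) (pop (up s) p) = pop (up s) (pop (Coef (tw s r)) p)"
    using p by (simp add: pop_Coef pop_up pop_dn rules mult_ac)
  show "pop (Coef r) (pop (up (\<not> s)) p) = pop (up (\<not> s)) (pop (Coef (tw (\<not> s) r)) p)"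
    using p by (simp add: pop_Coef pop_up pop_dn rules mult_ac)
next
  fix \<gamma> n p assume p: "p \<in> component pair_module n"
  then have q: "p \<in> pairs" "fst p \<in> component M n" "snd p \<in> component M (n + eps)" by (auto simp: pair_module_simps)
  have d: "gen_degree (up s) = eps" "gen_degree (up (\<not> s)) = - eps" by (auto simp: eps_def up_def)
  have "fst (pop \<gamma> p) \<in> component M (n + gen_degree \<gamma>) \<and> snd (pop \<gamma> p) \<in> component M (n + gen_degree \<gamma> + eps)"
    using op_component[OF q(2), of "up (\<not> s)"] op_component[OF q(2), of "Coef r" for r]
      op_component[OF q(3), of "up s"] op_component[OF q(3), of "Coef r" for r]
    by (cases \<gamma> rule: gen_cases[where s = s]) (simp_all add: pop_Coef pop_up pop_dn d)
  then show "pop \<gamma> p \<in> component pair_module (n + gen_degree \<gamma>)"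
    using pop_pairs[OF q(1)] by (simp add: pair_module_simps)
qed

lemma gwa_operators_pairs: "gwa_operators \<iota> \<sigma> pair_module (par s (tw s h * g)) pop"
proof -
  interpret P: abelian_group pair_module by (rule abelian_group_pair_module)
  have sub: "additive_subgroup (component pair_module n) pair_module" for n
  proof (intro additive_subgroupI group.subgroupI)
    show "group (add_monoid pair_module)" using P.a_group .
    show "inv\<^bsub>add_monoid pair_module\<^esub> p \<in> component pair_module n" if p: "p \<in> component pair_module n" for p
    proof -
      have q: "p \<in> pairs" "fst p \<in> component M n" "snd p \<in> component M (n + eps)"
        using p by (auto simp: pair_module_simps)
      have i: "\<ominus>\<^bsub>pair_module\<^esub> p \<in> pairs" "padd (\<ominus>\<^bsub>pair_module\<^esub> p) p = (\<zero>\<^bsub>M\<^esub>, \<zero>\<^bsub>M\<^esub>)"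
        using P.a_inv_closed[of p] P.l_neg[of p] q by (auto simp: pair_module_simps)
      then have eq: "fst (\<ominus>\<^bsub>pair_module\<^esub> p) = \<ominus>\<^bsub>M\<^esub> fst p" "snd (\<ominus>\<^bsub>pair_module\<^esub> p) = \<ominus>\<^bsub>M\<^esub> snd p"
        using pairsD[OF i(1)] pairsD[OF q(1)] by (auto simp: padd_def intro!: M.minus_equality[symmetric])
      have "\<ominus>\<^bsub>pair_module\<^esub> p \<in> component pair_module n"
        using i(1) q additive_subgroup.a_inv_closed[OF component_subgroup] by (simp add: pair_module_simps eq)
      then show ?thesis by (simp only: a_inv_def)
    qed
    show "component pair_module n \<noteq> {}"
      using zero_pairs component_zero by (auto simp: pair_module_simps)
    show "p \<otimes>\<^bsub>add_monoid pair_module\<^esub> p' \<in> component pair_module n"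
      if "p \<in> component pair_module n" "p' \<in> component pair_module n" for p p'
      using that by (simp add: pair_module_simps padd_pairs) (simp add: padd_def component_add)
  qed (auto simp: pair_module_simps)
  have "\<exists>!c. homogeneous_decomposition pair_module c p" if "p \<in> carrier pair_module" for p
  proof (rule direct_sumI[OF abelian_group_pair_module sub, where p = "\<lambda>n p. (hproj M n (fst p), hproj M (n + eps) (snd p))"])
    fix p assume "p \<in> carrier pair_module"
    then have q: "p \<in> pairs" by (simp add: pair_module_simps)
    note p = pairsD[OF q]
    let ?\<pi> = "\<lambda>n. (hproj M n (fst p), hproj M (n + eps) (snd p))"
    let ?J = "{n. hproj M n (snd p) \<noteq> \<zero>\<^bsub>M\<^esub>}"
    \<comment> \<open>A pair has degree \<open>n\<close> when its second coordinate has degree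
      \<open>n + eps\<close>, so the support of the second coordinate is shifted back by
      \<open>eps\<close>.\<close>
    let ?I = "{n. hproj M n (fst p) \<noteq> \<zero>\<^bsub>M\<^esub>} \<union> (\<lambda>n. n - eps) ` ?J"
    have fin: "finite ?I" using p finite_hproj by auto
    have z: "hproj M n (fst p) = \<zero>\<^bsub>M\<^esub> \<and> hproj M (n + eps) (snd p) = \<zero>\<^bsub>M\<^esub>" if "n \<notin> ?I" for n
      using that by (auto simp: image_iff)
    have comp: "fst (\<Oplus>\<^bsub>pair_module\<^esub>n\<in>?I. ?\<pi> n) = (\<Oplus>\<^bsub>M\<^esub>n\<in>?I. hproj M n (fst p))"
      "snd (\<Oplus>\<^bsub>pair_module\<^esub>n\<in>?I. ?\<pi> n) = (\<Oplus>\<^bsub>M\<^esub>n\<in>?I. hproj M (n + eps) (snd p))"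
      using additive_map_finsum[OF abelian_group_pair_module M.abelian_group_axioms, of fst ?I ?\<pi>]
        additive_map_finsum[OF abelian_group_pair_module M.abelian_group_axioms, of snd ?I ?\<pi>]
        fin hproj_pairs[OF q] by (auto simp: pair_module_simps padd_def pairsD)
    have "(\<Oplus>\<^bsub>M\<^esub>n\<in>?I. hproj M n (fst p)) = fst p"
      by (rule hproj_sum_superset[OF p(1) fin]) (use z in blast)
    moreover have "(\<Oplus>\<^bsub>M\<^esub>n\<in>?I. hproj M (n + eps) (snd p)) = (\<Oplus>\<^bsub>M\<^esub>n\<in>(\<lambda>n. n + eps) ` ?I. hproj M n (snd p))"
      by (rule M.add.finprod_reindex[symmetric]) (use p hproj_closed in auto)
    moreover have "(\<Oplus>\<^bsub>M\<^esub>n\<in>(\<lambda>n. n + eps) ` ?I. hproj M n (snd p)) = snd p"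
    proof (rule hproj_sum_superset[OF p(2)])
      show "hproj M n (snd p) = \<zero>\<^bsub>M\<^esub>" if n: "n \<notin> (\<lambda>n. n + eps) ` ?I" for n
      proof -
        have n': "n - eps \<notin> ?I" using n by (metis (no_types, lifting) diff_add_cancel imageI)
        have "hproj M (n - eps + eps) (snd p) = \<zero>\<^bsub>M\<^esub>" by (rule conjunct2[OF z[OF n']])
        then show ?thesis by simp
      qed
    qed (use fin in auto)
    ultimately have "p = (\<Oplus>\<^bsub>pair_module\<^esub>n\<in>?I. ?\<pi> n)" using comp by (simp add: prod_eq_iff)
    moreover have "?\<pi> n = \<zero>\<^bsub>pair_module\<^esub>" if "n \<notin> ?I" for n
      using z[OF that] by (simp add: pair_module_simps)
    ultimately show "\<exists>I. finite I \<and> (\<forall>n. n \<notin> I \<longrightarrow> ?\<pi> n = \<zero>\<^bsub>pair_module\<^esub>) \<and> p = (\<Oplus>\<^bsub>pair_module\<^esub>n\<in>I. ?\<pi> n)"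
      using fin by blast
  qed (use that in \<open>auto simp: pair_module_simps padd_def hproj_pairs pairsD hproj_component hproj_add hproj_same hproj_diff\<close>)
  then show ?thesis
    using abelian_group_pair_module sub gwa_ops_pairs
    by (intro gwa_operators.intro gwa_operators_axioms.intro gwa_base_axioms)
qed

definition Pm :: "('k, 'r, 'm \<times> 'm) gwa_gr_module" where
  "Pm = pair_module\<lparr>ract := gwa_ract pair_module pop\<rparr>"

lemma Pm_module: "graded_right_module (alg (par s (tw s h * g))) Pm"
  unfolding Pm_def by (rule gwa_operators.graded_right_module_ops[OF gwa_operators_pairs])

lemma Pm_simps:
  "carrier Pm = pairs" "\<zero>\<^bsub>Pm\<^esub> = (\<zero>\<^bsub>M\<^esub>, \<zero>\<^bsub>M\<^esub>)" "p \<oplus>\<^bsub>Pm\<^esub> p' = padd p p'"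
  "component Pm n = {p \<in> pairs. fst p \<in> component M n \<and> snd p \<in> component M (n + eps)}"
  "p \<in> pairs \<Longrightarrow> p \<triangleleft>\<^bsub>Pm\<^esub> gn (par s (tw s h * g)) \<gamma> = pop \<gamma> p"
  using gwa_operators.ract_gn[OF gwa_operators_pairs]
  by (simp_all add: Pm_def pair_module_simps)

lemma hproj_Pm:
  assumes "p \<in> pairs"
  shows "hproj Pm n p = (hproj M n (fst p), hproj M (n + eps) (snd p))"
proof -
  have "hproj M n (fst p) = fst (hproj Pm n p)"
    by (rule hproj_map[OF Pm_module graded_right_module_axioms])
      (use assms in \<open>auto simp: Pm_simps pairsD padd_def\<close>)
  moreover have "hproj M (n + eps) (snd p) = snd (hproj Pm n p)"
    by (rule hproj_map_shift[OF Pm_module graded_right_module_axioms])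
      (use assms in \<open>auto simp: Pm_simps pairsD padd_def\<close>)
  ultimately show ?thesis by simp
qed

definition Fo :: "('k, 'r, 'm) gwa_gr_module" where "Fo = transport (enc M) Pm"

abbreviation "e \<equiv> enc M"

lemma inj_e: "inj_on e (carrier Pm)"
  by (rule inj_on_subset[OF inj_enc[OF graded_right_module_axioms]]) (auto simp: Pm_simps pairs_def)

lemma e_eq: "\<lbrakk>p \<in> pairs; p' \<in> pairs\<rbrakk> \<Longrightarrow> e p = e p' \<longleftrightarrow> p = p'"
  using inj_e by (auto simp: Pm_simps dest: inj_onD)

lemma Fo_module: "graded_right_module (alg (par s (tw s h * g))) Fo"
  unfolding Fo_def by (rule graded_right_module_transport[OF Pm_module inj_e grade_alg])

lemma Fo_simps:
  "carrier Fo = e ` pairs" "\<zero>\<^bsub>Fo\<^esub> = e (\<zero>\<^bsub>M\<^esub>, \<zero>\<^bsub>M\<^esub>)"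
  "\<lbrakk>p \<in> pairs; p' \<in> pairs\<rbrakk> \<Longrightarrow> e p \<oplus>\<^bsub>Fo\<^esub> e p' = e (padd p p')"
  "p \<in> pairs \<Longrightarrow> e p \<triangleleft>\<^bsub>Fo\<^esub> gn (par s (tw s h * g)) \<gamma> = e (pop \<gamma> p)"
  using transport_simps[OF inj_e] by (simp_all add: Fo_def Pm_simps)

lemma hproj_Fo:
  assumes "p \<in> pairs"
  shows "hproj Fo n (e p) = e (hproj M n (fst p), hproj M (n + eps) (snd p))"
proof -
  have "hproj Fo n (e p) = e (hproj Pm n p)"
    by (rule hproj_map[OF Pm_module Fo_module])
      (use assms transport_simps[OF inj_e] in \<open>auto simp: Fo_def Pm_simps\<close>)
  then show ?thesis by (simp add: hproj_Pm[OF assms])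
qed

end

lemma (in gwa_module) op_eq_if_minus:
  assumes "x \<in> carrier M" "y \<in> carrier M" "op \<gamma> (x \<ominus>\<^bsub>M\<^esub> y) = \<zero>\<^bsub>M\<^esub>"
  shows "op \<gamma> x = op \<gamma> y"
proof -
  have "x = (x \<ominus>\<^bsub>M\<^esub> y) \<oplus>\<^bsub>M\<^esub> y" using assms by (simp add: M.minus_eq M.a_assoc M.l_neg)
  then have "op \<gamma> x = op \<gamma> (x \<ominus>\<^bsub>M\<^esub> y) \<oplus>\<^bsub>M\<^esub> op \<gamma> y"
    using assms(1,2) by (metis op_add M.minus_closed)
  then show ?thesis using assms by (simp add: op_closed)
qed

context gwa_fin
begin

lemma gwa_fin_moduleI: "graded_right_module (alg f) M \<Longrightarrow> gwa_fin_module \<iota> \<sigma> z f M"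
  by (intro gwa_fin_module.intro gwa_module.intro gwa_fin_axioms gwa_base_axioms)

lemma shift_moduleI:
  "\<lbrakk>graded_right_module (alg f) M; f = par s (h * g)\<rbrakk> \<Longrightarrow> shift_module \<iota> \<sigma> z f M s h g"
  by (intro shift_module.intro shift_module_axioms.intro gwa_fin_moduleI)

text \<open>A functor needs the construction as a function of the module, whereas the locale fixes
  \<open>M\<close>. The parameters stay free because the functor back is the same construction at
  \<open>\<not> s\<close>, \<open>h\<close> and \<open>tw (\<not> s) g\<close>.\<close>

definition Fob :: "bool \<Rightarrow> 'r \<Rightarrow> 'r \<Rightarrow> ('k, 'r, 'm) gwa_gr_module \<Rightarrow> ('k, 'r, 'm) gwa_gr_module" where
  "Fob s h g M = shift_module.Fo \<iota> \<sigma> (par s (h * g)) M s h g"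

definition prs :: "bool \<Rightarrow> 'r \<Rightarrow> 'r \<Rightarrow> ('k, 'r, 'm) gwa_gr_module \<Rightarrow> ('m \<times> 'm) set" where
  "prs s h g M = shift_module.pairs \<iota> \<sigma> (par s (h * g)) M s h g"

definition Frel :: "bool \<Rightarrow> 'r \<Rightarrow> 'r \<Rightarrow> ('k, 'r, 'm) gwa_gr_module \<Rightarrow> ('k, 'r, 'm) gwa_gr_module \<Rightarrow>
    ('m \<times> 'm) set \<Rightarrow> ('m \<times> 'm) set" where
  "Frel s h g M N \<Gamma> = {(enc M p, enc N p') | p p'. p \<in> prs s h g M \<and> p' \<in> prs s h g N \<and>
     (fst p, fst p') \<in> \<Gamma> \<and> (snd p, snd p') \<in> \<Gamma>}"

definition eta :: "bool \<Rightarrow> 'r \<Rightarrow> 'r \<Rightarrow> ('k, 'r, 'm) gwa_gr_module \<Rightarrow> 'm \<Rightarrow> 'm" where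
  "eta s h g M m = (let op = gwa_module.op \<iota> \<sigma> (par s (h * g)) M in
     enc (Fob s h g M) (enc M (op (Coef h) m, op (up s) m), enc M (op (up (\<not> s)) m, op (Coef (tw (\<not> s) g)) m)))"

end

context shift_module
begin

abbreviation "f' \<equiv> par s (tw s h * g)"

lemma Fo_fin: "gwa_fin_module \<iota> \<sigma> z f' Fo"
  by (rule gwa_fin_moduleI[OF Fo_module])

abbreviation "Fop \<equiv> gwa_module.op \<iota> \<sigma> f' Fo"

lemma Fop: "p \<in> pairs \<Longrightarrow> Fop \<gamma> (e p) = e (pop \<gamma> p)"
proof -
  interpret FM: gwa_fin_module \<iota> \<sigma> z f' Fo by (rule Fo_fin)
  show "p \<in> pairs \<Longrightarrow> Fop \<gamma> (e p) = e (pop \<gamma> p)" unfolding FM.op_def by (rule Fo_simps(4))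
qed

text \<open>The first step forgets the first coordinate, hence \<open>Suc k\<close>; from then on
  every step is \<open>U\<close> on the second coordinate, and the first one is carried along as its
  multiple by \<open>h\<close>.\<close>

lemma Fop_pow_up:
  "p \<in> pairs \<Longrightarrow> (Fop (up s) ^^ Suc k) (e p) = e (C h ((U ^^ k) (snd p)), U ((U ^^ k) (snd p)))"
proof (induction k)
  case 0
  then show ?case by (simp add: Fop pop_up)
next
  case (Suc k)
  have "(U ^^ k) (snd p) \<in> carrier M" using pow_closed pairsD Suc.prems by blast
  then have "(C h ((U ^^ k) (snd p)), U ((U ^^ k) (snd p))) \<in> pairs" by (rule up_pairs)
  then have "Fop (up s) (e (C h ((U ^^ k) (snd p)), U ((U ^^ k) (snd p)))) =
      e (C h ((U ^^ Suc k) (snd p)), U ((U ^^ Suc k) (snd p)))" by (simp add: Fop pop_up)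
  then show ?case using Suc by simp
qed

lemma Fop_pow_dn:
  "p \<in> pairs \<Longrightarrow> (Fop (up (\<not> s)) ^^ Suc k) (e p) = e (D ((D ^^ k) (fst p)), C (tw (\<not> s) g) ((D ^^ k) (fst p)))"
proof (induction k)
  case 0
  then show ?case by (simp add: Fop pop_dn)
next
  case (Suc k)
  have "(D ^^ k) (fst p) \<in> carrier M" using pow_closed pairsD Suc.prems by blast
  then have "(D ((D ^^ k) (fst p)), C (tw (\<not> s) g) ((D ^^ k) (fst p))) \<in> pairs" by (rule dn_pairs)
  then have "Fop (up (\<not> s)) (e (D ((D ^^ k) (fst p)), C (tw (\<not> s) g) ((D ^^ k) (fst p)))) =
      e (D ((D ^^ Suc k) (fst p)), C (tw (\<not> s) g) ((D ^^ Suc k) (fst p)))" by (simp add: Fop pop_dn)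
  then show ?case using Suc by simp
qed

end

section \<open>The functor on relations\<close>

locale shift_relation = M: shift_module \<iota> \<sigma> z f M s h g + N: shift_module \<iota> \<sigma> z f N s h g
  for \<iota> :: "'k::field \<Rightarrow> 'r::idom" and \<sigma> :: "'r \<Rightarrow> 'r" and z f :: 'r
    and M :: "('k, 'r, 'm) gwa_gr_module" and N :: "('k, 'r, 'm) gwa_gr_module"
    and s :: bool and h g :: 'r +
  fixes \<Gamma> :: "('m \<times> 'm) set"
  assumes qmor: "qmor (gwa \<iota> \<sigma> f) (M.mults f) M N \<Gamma>"
begin

abbreviation "t \<equiv> M.tw (\<not> s)"

lemma graded: "graded_relation (M.alg f) M N \<Gamma>"
  using qmor unfolding qmor_def by blast

lemmas gD = graded_relationD[OF graded]

lemma op_rel: "(m, n) \<in> \<Gamma> \<Longrightarrow> (M.op \<gamma> m, N.op \<gamma> n) \<in> \<Gamma>"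
  unfolding M.op_def N.op_def by (rule gD(5)[OF _ M.gn_closed])

lemma Frel_eq: "M.Frel s h g M N \<Gamma> = {(M.e p, N.e p') | p p'. p \<in> M.pairs \<and> p' \<in> N.pairs \<and>
     (fst p, fst p') \<in> \<Gamma> \<and> (snd p, snd p') \<in> \<Gamma>}"
  unfolding M.Frel_def M.prs_def by (simp add: M.f)

lemma FrelI: "\<lbrakk>p \<in> M.pairs; p' \<in> N.pairs; (fst p, fst p') \<in> \<Gamma>; (snd p, snd p') \<in> \<Gamma>\<rbrakk> \<Longrightarrow>
    (M.e p, N.e p') \<in> M.Frel s h g M N \<Gamma>"
  unfolding Frel_eq by blast

lemma FrelE:
  assumes "(x, y) \<in> M.Frel s h g M N \<Gamma>"
  obtains p p' where "x = M.e p" "y = N.e p'" "p \<in> M.pairs" "p' \<in> N.pairs" "(fst p, fst p') \<in> \<Gamma>" "(snd p, snd p') \<in> \<Gamma>"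
  using assms unfolding Frel_eq by blast

lemma pop_rel:
  assumes "(fst p, fst p') \<in> \<Gamma>" "(snd p, snd p') \<in> \<Gamma>"
  shows "(fst (M.pop \<gamma> p), fst (N.pop \<gamma> p')) \<in> \<Gamma>" "(snd (M.pop \<gamma> p), snd (N.pop \<gamma> p')) \<in> \<Gamma>"
  using op_rel[OF assms(1)] op_rel[OF assms(2)]
  by (cases \<gamma> rule: M.gen_cases[where s = s]; simp add: M.pop_Coef M.pop_up M.pop_dn N.pop_Coef N.pop_up N.pop_dn)+

lemma graded_Frel: "graded_relation (M.alg M.f') M.Fo N.Fo (M.Frel s h g M N \<Gamma>)"
proof (rule M.graded_relation_gensI[OF M.Fo_module N.Fo_module])
  show "x \<in> carrier M.Fo \<and> y \<in> carrier N.Fo" if "(x, y) \<in> M.Frel s h g M N \<Gamma>" for x y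
    using that by (auto elim!: FrelE simp: M.Fo_simps N.Fo_simps)
  show "(\<zero>\<^bsub>M.Fo\<^esub>, \<zero>\<^bsub>N.Fo\<^esub>) \<in> M.Frel s h g M N \<Gamma>"
    unfolding M.Fo_simps N.Fo_simps by (rule FrelI) (simp_all add: M.zero_pairs N.zero_pairs gD(3))
next
  fix x y x' y' assume "(x, y) \<in> M.Frel s h g M N \<Gamma>" "(x', y') \<in> M.Frel s h g M N \<Gamma>"
  then obtain p p' w w' where *: "x = M.e p" "y = N.e p'" "x' = M.e w" "y' = N.e w'"
    "p \<in> M.pairs" "p' \<in> N.pairs" "w \<in> M.pairs" "w' \<in> N.pairs" "(fst p, fst p') \<in> \<Gamma>" "(snd p, snd p') \<in> \<Gamma>"
    "(fst w, fst w') \<in> \<Gamma>" "(snd w, snd w') \<in> \<Gamma>" by (elim FrelE)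
  have "(M.e (M.padd p w), N.e (N.padd p' w')) \<in> M.Frel s h g M N \<Gamma>"
    by (rule FrelI[OF M.padd_pairs[OF *(5,7)] N.padd_pairs[OF *(6,8)]])
      (simp_all add: M.padd_def N.padd_def gD(4)[OF *(9,11)] gD(4)[OF *(10,12)])
  then show "(x \<oplus>\<^bsub>M.Fo\<^esub> x', y \<oplus>\<^bsub>N.Fo\<^esub> y') \<in> M.Frel s h g M N \<Gamma>"
    using * by (simp add: M.Fo_simps N.Fo_simps)
next
  fix x y \<gamma> assume "(x, y) \<in> M.Frel s h g M N \<Gamma>"
  then obtain p p' where *: "x = M.e p" "y = N.e p'" "p \<in> M.pairs" "p' \<in> N.pairs"
    "(fst p, fst p') \<in> \<Gamma>" "(snd p, snd p') \<in> \<Gamma>" by (elim FrelE)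
  show "(x \<triangleleft>\<^bsub>M.Fo\<^esub> M.gn M.f' \<gamma>, y \<triangleleft>\<^bsub>N.Fo\<^esub> M.gn M.f' \<gamma>) \<in> M.Frel s h g M N \<Gamma>"
    using * FrelI[OF M.pop_pairs[OF *(3)] N.pop_pairs[OF *(4)] pop_rel[OF *(5,6)]]
    by (simp add: M.Fo_simps N.Fo_simps)
next
  fix x y i assume "(x, y) \<in> M.Frel s h g M N \<Gamma>"
  then obtain p p' where *: "x = M.e p" "y = N.e p'" "p \<in> M.pairs" "p' \<in> N.pairs"
    "(fst p, fst p') \<in> \<Gamma>" "(snd p, snd p') \<in> \<Gamma>" by (elim FrelE)
  have "M.eps = N.eps" by (simp add: M.eps_def N.eps_def)
  then show "(hproj M.Fo i x, hproj N.Fo i y) \<in> M.Frel s h g M N \<Gamma>"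
    using * FrelI[OF M.hproj_pairs[OF *(3)] N.hproj_pairs[OF *(4)]] gD(6)
    by (simp add: M.hproj_Fo N.hproj_Fo)
qed

lemma rel_minus_zero:
  assumes "(m, n) \<in> \<Gamma>" "(m, n') \<in> \<Gamma>"
  shows "(\<zero>\<^bsub>M\<^esub>, n \<ominus>\<^bsub>N\<^esub> n') \<in> \<Gamma>"
proof -
  have "(m \<ominus>\<^bsub>M\<^esub> m, n \<ominus>\<^bsub>N\<^esub> n') \<in> \<Gamma>"
    by (rule graded_relation_minus[OF M.graded_right_module_axioms N.graded_right_module_axioms graded assms])
  then show ?thesis using gD(1)[OF assms(1)] by (simp add: M.M.minus_eq M.M.r_neg)
qed

lemma dense: "m \<in> carrier M \<Longrightarrow> \<exists>r. r \<noteq> 0 \<and> M.op (Coef r) m \<in> Domain \<Gamma>"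
    "m \<in> carrier M \<Longrightarrow> \<exists>k. (M.op (M.up s') ^^ k) m \<in> Domain \<Gamma>"
  and tors: "(\<zero>\<^bsub>M\<^esub>, n) \<in> \<Gamma> \<Longrightarrow> \<exists>r. r \<noteq> 0 \<and> N.op (Coef r) n = \<zero>\<^bsub>N\<^esub>"
    "(\<zero>\<^bsub>M\<^esub>, n) \<in> \<Gamma> \<Longrightarrow> \<exists>k. (N.op (M.up s') ^^ k) n = \<zero>\<^bsub>N\<^esub>"
proof -
  have 1: "mult_dense (M.mults f) M (Domain \<Gamma>)" and 2: "mult_torsion (M.mults f) N (\<Gamma> `` {\<zero>\<^bsub>M\<^esub>})"
    using qmor unfolding qmor_def by auto
  have sub: "\<Gamma> `` {\<zero>\<^bsub>M\<^esub>} \<subseteq> carrier N" using gD(2) by auto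
  show "m \<in> carrier M \<Longrightarrow> \<exists>r. r \<noteq> 0 \<and> M.op (Coef r) m \<in> Domain \<Gamma>"
    "m \<in> carrier M \<Longrightarrow> \<exists>k. (M.op (M.up s') ^^ k) m \<in> Domain \<Gamma>"
    using 1 unfolding M.mult_dense_iff by auto
  show "(\<zero>\<^bsub>M\<^esub>, n) \<in> \<Gamma> \<Longrightarrow> \<exists>r. r \<noteq> 0 \<and> N.op (Coef r) n = \<zero>\<^bsub>N\<^esub>"
    "(\<zero>\<^bsub>M\<^esub>, n) \<in> \<Gamma> \<Longrightarrow> \<exists>k. (N.op (M.up s') ^^ k) n = \<zero>\<^bsub>N\<^esub>"
    using 2 unfolding N.mult_torsion_iff[OF sub] by auto
qed

text \<open>A coefficient brings both coordinates into the domain of \<Gamma>, with values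
  \<open>c\<close> and \<open>d\<close>, but \<open>(c, d)\<close> need not be a pair. The pair
  equations hold for the source, so their defects for \<open>(c, d)\<close> are partners of zero and
  hence torsion; a further coefficient kills them.\<close>

lemma Frel_dense_Coef:
  assumes p: "p \<in> M.pairs"
  shows "\<exists>r. r \<noteq> 0 \<and> M.Fop (Coef r) (M.e p) \<in> Domain (M.Frel s h g M N \<Gamma>)"
proof -
  note pD = M.pairsD[OF p]
  obtain r1 c1 where r1: "r1 \<noteq> 0" "(M.C r1 (fst p), c1) \<in> \<Gamma>" using dense(1)[OF pD(1)] by blast
  obtain r2 d2 where r2: "r2 \<noteq> 0" "(M.C r2 (snd p), d2) \<in> \<Gamma>" using dense(1)[OF pD(2)] by blast
  \<comment> \<open>A coefficient acts on the second coordinate through \<open>t\<close>, and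
    \<open>t r = t r1 * r2\<close>. So \<open>r\<close> is a multiple of \<open>r1\<close> on the
    first coordinate and of \<open>r2\<close> on the second.\<close>
  define r where "r = r1 * M.tw s r2"
  define c where "c = N.C (M.tw s r2) c1"
  define d where "d = N.C (t r1) d2"
  have c: "(M.C r (fst p), c) \<in> \<Gamma>"
    using op_rel[OF r1(2), of "Coef (M.tw s r2)"] pD unfolding r_def c_def by (simp add: M.C_C mult.commute)
  have d: "(M.C (t r) (snd p), d) \<in> \<Gamma>"
    using op_rel[OF r2(2), of "Coef (t r1)"] pD unfolding r_def d_def by (simp add: M.C_C M.tw_mult mult.commute)
  have cc: "c \<in> carrier N" "d \<in> carrier N" using c d gD(2) by blast+
  have "M.U (M.C r (fst p)) = M.C (t h) (M.C (t r) (snd p))" "M.D (M.C (t r) (snd p)) = M.C g (M.C r (fst p))"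
    using pD by (simp_all add: M.rules mult_ac)
  then have "(M.U (M.C r (fst p)), N.C (t h) d) \<in> \<Gamma>" "(M.D (M.C (t r) (snd p)), N.C g c) \<in> \<Gamma>"
    using op_rel[OF d, of "Coef (t h)"] op_rel[OF c, of "Coef g"] by auto
  then have z: "(\<zero>\<^bsub>M\<^esub>, N.U c \<ominus>\<^bsub>N\<^esub> N.C (t h) d) \<in> \<Gamma>" "(\<zero>\<^bsub>M\<^esub>, N.D d \<ominus>\<^bsub>N\<^esub> N.C g c) \<in> \<Gamma>"
    using rel_minus_zero[OF op_rel[OF c]] rel_minus_zero[OF op_rel[OF d]] by blast+
  obtain r3 where r3: "r3 \<noteq> 0" "N.C r3 (N.U c \<ominus>\<^bsub>N\<^esub> N.C (t h) d) = \<zero>\<^bsub>N\<^esub>" using tors(1)[OF z(1)] by blast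
  obtain r4 where r4: "r4 \<noteq> 0" "N.C r4 (N.D d \<ominus>\<^bsub>N\<^esub> N.C g c) = \<zero>\<^bsub>N\<^esub>" using tors(1)[OF z(2)] by blast
  \<comment> \<open>The first equation lives at the level of the second coordinate, where
    \<open>v\<close> acts as \<open>t v = r3 * t r4\<close>, and the second equation at that of the
    first. So \<open>v\<close> kills both defects.\<close>
  define v where "v = M.tw s r3 * r4"
  have 3: "N.C r3 (N.U c) = N.C r3 (N.C (t h) d)" and 4: "N.C r4 (N.D d) = N.C r4 (N.C g c)"
    using N.op_eq_if_minus[OF _ _ r3(2)] N.op_eq_if_minus[OF _ _ r4(2)] cc by (simp_all add: N.op_closed)
  have "(N.C v c, N.C (t v) d) \<in> N.pairs"
  proof (rule N.pairsI)
    have "N.U (N.C v c) = N.C (t r4) (N.C r3 (N.U c))" using cc by (simp add: v_def N.rules mult_ac)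
    also have "\<dots> = N.C (t h) (N.C (t v) d)" unfolding 3 using cc by (simp add: v_def N.rules mult_ac)
    finally show "N.U (N.C v c) = N.C (t h) (N.C (t v) d)" .
    have "N.D (N.C (t v) d) = N.C (M.tw s r3) (N.C r4 (N.D d))" using cc by (simp add: v_def N.rules mult_ac)
    also have "\<dots> = N.C g (N.C v c)" unfolding 4 using cc by (simp add: v_def N.rules mult_ac)
    finally show "N.D (N.C (t v) d) = N.C g (N.C v c)" .
  qed (simp_all add: N.op_closed cc)
  moreover have "(M.C (r * v) (fst p), N.C v c) \<in> \<Gamma>" "(M.C (t (r * v)) (snd p), N.C (t v) d) \<in> \<Gamma>"
    using op_rel[OF c, of "Coef v"] op_rel[OF d, of "Coef (t v)"] pD by (simp_all add: M.C_C M.tw_mult mult.commute)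
  ultimately have "(M.e (M.pop (Coef (r * v)) p), N.e (N.C v c, N.C (t v) d)) \<in> M.Frel s h g M N \<Gamma>"
    by (intro FrelI M.pop_pairs p) (simp_all add: M.pop_Coef)
  then have "M.Fop (Coef (r * v)) (M.e p) \<in> Domain (M.Frel s h g M N \<Gamma>)" using M.Fop[OF p] by auto
  moreover have "r * v \<noteq> 0" using r1(1) r2(1) r3(1) r4(1) by (simp add: r_def v_def M.tw_eq_zero)
  ultimately show ?thesis by blast
qed

lemma side_cases: obtains "s' = s" | "s' = (\<not> s)" by blast

text \<open>No correction by torsion is needed here: after one step a pair is of the form in
  \<open>up_pairs\<close> or \<open>dn_pairs\<close>, and every value \<open>n\<close> of \<Gamma>
  produces such a pair in the target.\<close>

lemma Frel_dense_up:
  assumes p: "p \<in> M.pairs"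
  shows "\<exists>k. (M.Fop (M.up s') ^^ k) (M.e p) \<in> Domain (M.Frel s h g M N \<Gamma>)"
proof (cases rule: side_cases[of s'])
  case 1
  obtain k n where n: "((M.U ^^ k) (snd p), n) \<in> \<Gamma>" using dense(2)[OF M.pairsD(2)[OF p]] by blast
  have "(M.e (M.C h ((M.U ^^ k) (snd p)), M.U ((M.U ^^ k) (snd p))), N.e (N.C h n, N.U n)) \<in> M.Frel s h g M N \<Gamma>"
    using gD(1,2)[OF n] op_rel[OF n] by (intro FrelI M.up_pairs N.up_pairs) simp_all
  then have "(M.Fop (M.up s') ^^ Suc k) (M.e p) \<in> Domain (M.Frel s h g M N \<Gamma>)"
    unfolding 1 M.Fop_pow_up[OF p] by blast
  then show ?thesis by blast
next
  case 2
  obtain k n where n: "((M.D ^^ k) (fst p), n) \<in> \<Gamma>" using dense(2)[OF M.pairsD(1)[OF p]] by blast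
  have "(M.e (M.D ((M.D ^^ k) (fst p)), M.C (t g) ((M.D ^^ k) (fst p))), N.e (N.D n, N.C (t g) n)) \<in> M.Frel s h g M N \<Gamma>"
    using gD(1,2)[OF n] op_rel[OF n] by (intro FrelI M.dn_pairs N.dn_pairs) simp_all
  then have "(M.Fop (M.up s') ^^ Suc k) (M.e p) \<in> Domain (M.Frel s h g M N \<Gamma>)"
    unfolding 2 M.Fop_pow_dn[OF p] by blast
  then show ?thesis by blast
qed

text \<open>Injectivity of the encoding makes both coordinates of \<open>p\<close> partners of zero,
  hence torsion. The coefficient combines the two annihilators as in \<open>Frel_dense_Coef\<close>;
  for powers one coordinate suffices.\<close>

lemma Frel_torsion:
  assumes "y \<in> M.Frel s h g M N \<Gamma> `` {\<zero>\<^bsub>M.Fo\<^esub>}"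
  shows "\<exists>r. r \<noteq> 0 \<and> N.Fop (Coef r) y = \<zero>\<^bsub>N.Fo\<^esub>" "\<exists>k. (N.Fop (M.up s') ^^ k) y = \<zero>\<^bsub>N.Fo\<^esub>"
proof -
  have "(\<zero>\<^bsub>M.Fo\<^esub>, y) \<in> M.Frel s h g M N \<Gamma>" using assms by blast
  then obtain w p where *: "M.e (\<zero>\<^bsub>M\<^esub>, \<zero>\<^bsub>M\<^esub>) = M.e w" "y = N.e p" "w \<in> M.pairs" "p \<in> N.pairs"
    "(fst w, fst p) \<in> \<Gamma>" "(snd w, snd p) \<in> \<Gamma>" unfolding M.Fo_simps(2) by (elim FrelE)
  then have "w = (\<zero>\<^bsub>M\<^esub>, \<zero>\<^bsub>M\<^esub>)" using M.e_eq[OF M.zero_pairs *(3)] by simp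
  then have g: "(\<zero>\<^bsub>M\<^esub>, fst p) \<in> \<Gamma>" "(\<zero>\<^bsub>M\<^esub>, snd p) \<in> \<Gamma>" using * by auto
  note pD = N.pairsD[OF *(4)]
  obtain r1 r2 where r: "r1 \<noteq> 0" "r2 \<noteq> 0" "N.C r1 (fst p) = \<zero>\<^bsub>N\<^esub>" "N.C r2 (snd p) = \<zero>\<^bsub>N\<^esub>"
    using tors(1)[OF g(1)] tors(1)[OF g(2)] by blast
  have "N.C (r1 * M.tw s r2) (fst p) = N.C (M.tw s r2) (N.C r1 (fst p))"
    "N.C (t (r1 * M.tw s r2)) (snd p) = N.C (t r1) (N.C r2 (snd p))"
    using pD by (simp_all add: N.rules mult_ac)
  then have "N.Fop (Coef (r1 * M.tw s r2)) y = \<zero>\<^bsub>N.Fo\<^esub>"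
    unfolding *(2) N.Fop[OF *(4)] N.pop_Coef N.Fo_simps(2) using r by (simp add: N.op_zero)
  moreover have "r1 * M.tw s r2 \<noteq> 0" using r by (simp add: M.tw_eq_zero)
  ultimately show "\<exists>r. r \<noteq> 0 \<and> N.Fop (Coef r) y = \<zero>\<^bsub>N.Fo\<^esub>" by blast
  show "\<exists>k. (N.Fop (M.up s') ^^ k) y = \<zero>\<^bsub>N.Fo\<^esub>"
  proof (cases rule: side_cases[of s'])
    case 1
    obtain k where "(N.U ^^ k) (snd p) = \<zero>\<^bsub>N\<^esub>" using tors(2)[OF g(2)] by blast
    then have "(N.Fop (M.up s') ^^ Suc k) y = \<zero>\<^bsub>N.Fo\<^esub>"
      unfolding 1 *(2) N.Fop_pow_up[OF *(4)] N.Fo_simps(2) by (simp add: N.op_zero)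
    then show ?thesis by blast
  next
    case 2
    obtain k where "(N.D ^^ k) (fst p) = \<zero>\<^bsub>N\<^esub>" using tors(2)[OF g(1)] by blast
    then have "(N.Fop (M.up s') ^^ Suc k) y = \<zero>\<^bsub>N.Fo\<^esub>"
      unfolding 2 *(2) N.Fop_pow_dn[OF *(4)] N.Fo_simps(2) by (simp add: N.op_zero)
    then show ?thesis by blast
  qed
qed

lemma qmor_Frel: "qmor (M.alg M.f') (M.mults M.f') M.Fo N.Fo (M.Frel s h g M N \<Gamma>)"
proof -
  interpret FM: gwa_fin_module \<iota> \<sigma> z M.f' M.Fo by (rule M.Fo_fin)
  interpret FN: gwa_fin_module \<iota> \<sigma> z M.f' N.Fo by (rule N.Fo_fin)
  have "M.Frel s h g M N \<Gamma> `` {\<zero>\<^bsub>M.Fo\<^esub>} \<subseteq> carrier N.Fo"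
    using graded_relationD(2)[OF graded_Frel] by auto
  then show ?thesis
    unfolding qmor_def FM.mult_dense_iff
    using graded_Frel Frel_dense_Coef Frel_dense_up Frel_torsion FN.mult_torsion_iff[of "M.Frel s h g M N \<Gamma> `` {\<zero>\<^bsub>M.Fo\<^esub>}"]
    by (simp add: M.Fo_simps(1))
qed

end

context gwa_fin
begin

text \<open>In a sum, a multiple or a composite, the two relations meet in a common encoded element.
  Injectivity of \<open>enc\<close> identifies the two pairs behind it, and the inclusions then hold
  in each coordinate.\<close>

lemma relation_functor_shift:
  fixes ty :: "'m itself"
  shows "relation_functor (alg (par s (h * g))) (mults (par s (h * g))) (alg (par s (tw s h * g))) (mults (par s (tw s h * g)))
    (Fob s h g :: ('k, 'r, 'm) gwa_gr_module \<Rightarrow> _) (Frel s h g)"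
proof (intro relation_functor.intro relation_functor_axioms.intro torsion_theory)
  let ?f = "par s (h * g)" and ?f' = "par s (tw s h * g)"
  have I: "shift_module \<iota> \<sigma> z ?f M s h g" if "graded_right_module (alg ?f) M" for M :: "('k, 'r, 'm) gwa_gr_module"
    by (rule shift_moduleI[OF that refl])
  fix M :: "('k, 'r, 'm) gwa_gr_module"
  assume M: "graded_right_module (alg ?f) M"
  interpret M: shift_module \<iota> \<sigma> z ?f M s h g by (rule I[OF M])
  show "graded_right_module (alg ?f') (Fob s h g M)"
    unfolding Fob_def by (rule M.Fo_module)
  show "Id_on (carrier (Fob s h g M)) \<subseteq> Frel s h g M M (Id_on (carrier M))"
    unfolding Fob_def M.Fo_simps Frel_def prs_def using M.pairsD(1,2) by fastforce
  fix N :: "('k, 'r, 'm) gwa_gr_module"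
  assume N: "graded_right_module (alg ?f) N"
  interpret N: shift_module \<iota> \<sigma> z ?f N s h g by (rule I[OF N])
  show "qmor (alg ?f') (mults ?f') (Fob s h g M) (Fob s h g N) (Frel s h g M N \<Gamma>)"
    if "qmor (alg ?f) (mults ?f) M N \<Gamma>" for \<Gamma>
  proof -
    interpret shift_relation \<iota> \<sigma> z ?f M N s h g \<Gamma>
      using that by (intro shift_relation.intro shift_relation_axioms.intro M.shift_module_axioms N.shift_module_axioms)
    show ?thesis unfolding Fob_def by (rule qmor_Frel)
  qed
  show "rel_add (Fob s h g N) (Frel s h g M N \<Gamma>) (Frel s h g M N \<Delta>) \<subseteq> Frel s h g M N (rel_add N \<Gamma> \<Delta>)" for \<Gamma> \<Delta>
  proof (clarsimp simp: rel_add_def[of "Fob s h g N"])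
    fix x y y' assume "(x, y) \<in> Frel s h g M N \<Gamma>" "(x, y') \<in> Frel s h g M N \<Delta>"
    then obtain p p' w w' where *: "x = M.e p" "y = N.e p'" "x = M.e w" "y' = N.e w'"
      "p \<in> M.pairs" "p' \<in> N.pairs" "w \<in> M.pairs" "w' \<in> N.pairs"
      "(fst p, fst p') \<in> \<Gamma>" "(snd p, snd p') \<in> \<Gamma>" "(fst w, fst w') \<in> \<Delta>" "(snd w, snd w') \<in> \<Delta>"
      unfolding Frel_def prs_def by blast
    then have "w = p" using M.e_eq[of w p] by simp
    then have "(M.e p, N.e (N.padd p' w')) \<in> Frel s h g M N (rel_add N \<Gamma> \<Delta>)"
      using * N.padd_pairs[of p' w'] unfolding Frel_def prs_def rel_add_def N.padd_def by fastforce
    then show "(x, y \<oplus>\<^bsub>Fob s h g N\<^esub> y') \<in> Frel s h g M N (rel_add N \<Gamma> \<Delta>)"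
      using * unfolding Fob_def by (simp add: N.Fo_simps)
  qed
  show "rel_scale (alg ?f') (Fob s h g M) c (Frel s h g M N \<Gamma>) \<subseteq> Frel s h g M N (rel_scale (alg ?f) M c \<Gamma>)" for c \<Gamma>
  proof (clarsimp simp: rel_scale_def[of "alg ?f'"])
    fix x y y' assume 1: "(x \<triangleleft>\<^bsub>Fob s h g M\<^esub> scal (alg ?f') c, y) \<in> Frel s h g M N \<Gamma>" and 2: "(x, y') \<in> Frel s h g M N \<Gamma>"
    obtain p p' where *: "x = M.e p" "p \<in> M.pairs" "p' \<in> N.pairs" "(fst p, fst p') \<in> \<Gamma>" "(snd p, snd p') \<in> \<Gamma>"
      using 2 unfolding Frel_def prs_def by blast
    have eq: "x \<triangleleft>\<^bsub>Fob s h g M\<^esub> scal (alg ?f') c = M.e (M.pop (Coef (\<iota> c)) p)"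
      unfolding *(1) Fob_def gn_scal[symmetric] by (rule M.Fo_simps(4)[OF *(2)])
    obtain v w where vw: "M.e (M.pop (Coef (\<iota> c)) p) = M.e v" "y = N.e w" "v \<in> M.pairs" "w \<in> N.pairs"
      "(fst v, fst w) \<in> \<Gamma>" "(snd v, snd w) \<in> \<Gamma>"
      using 1 unfolding eq Frel_def prs_def by blast
    have "v = M.pop (Coef (\<iota> c)) p" using vw(1) M.e_eq[OF M.pop_pairs[OF *(2)] vw(3)] by simp
    then have "fst v = fst p \<triangleleft>\<^bsub>M\<^esub> scal (alg ?f) c" "snd v = snd p \<triangleleft>\<^bsub>M\<^esub> scal (alg ?f) c"
      by (simp_all add: M.pop_Coef tw_iota M.op_scal)
    then have "(fst p, fst w) \<in> rel_scale (alg ?f) M c \<Gamma>" "(snd p, snd w) \<in> rel_scale (alg ?f) M c \<Gamma>"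
      using vw * unfolding rel_scale_def by auto
    then show "(x, y) \<in> Frel s h g M N (rel_scale (alg ?f) M c \<Gamma>)"
      using vw * unfolding Frel_def prs_def by blast
  qed
  fix P :: "('k, 'r, 'm) gwa_gr_module"
  assume "graded_right_module (alg ?f) P"
  show "Frel s h g M N \<Gamma> O Frel s h g N P \<Delta> \<subseteq> Frel s h g M P (\<Gamma> O \<Delta>)" for \<Gamma> \<Delta>
  proof (clarsimp)
    fix x y y' assume "(x, y) \<in> Frel s h g M N \<Gamma>" "(y, y') \<in> Frel s h g N P \<Delta>"
    then obtain p p' w w' where *: "x = M.e p" "y = N.e p'" "y = N.e w" "y' = enc P w'"
      "p \<in> M.pairs" "p' \<in> N.pairs" "w \<in> N.pairs" "w' \<in> prs s h g P"
      "(fst p, fst p') \<in> \<Gamma>" "(snd p, snd p') \<in> \<Gamma>" "(fst w, fst w') \<in> \<Delta>" "(snd w, snd w') \<in> \<Delta>"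
      unfolding Frel_def prs_def by blast
    then have "w = p'" using N.e_eq[of w p'] by simp
    then show "(x, y') \<in> Frel s h g M P (\<Gamma> O \<Delta>)"
      using * unfolding Frel_def prs_def by blast
  qed
next
  show "Frel s h g M N \<Gamma> \<subseteq> Frel s h g M N \<Delta>" if "\<Gamma> \<subseteq> \<Delta>"
    for \<Gamma> \<Delta> and M N :: "('k, 'r, 'm) gwa_gr_module"
    using that unfolding Frel_def by blast
qed

end

section \<open>The unit of the equivalence\<close>

context shift_module
begin

abbreviation "g' \<equiv> tw (\<not> s) g"

text \<open>\<open>f'\<close> is also \<open>par (\<not> s) (h * g')\<close>: seen from the other
  generator, its moved factor is again \<open>h\<close> itself. The construction therefore applies
  to \<open>Fo\<close> with the same \<open>h\<close>.\<close>

lemma shift_back: "shift_module \<iota> \<sigma> z f' Fo (\<not> s) h g'"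
  by (rule shift_moduleI[OF Fo_module]) (simp add: par_not tw_mult)

lemma eta_eq: "eta s h g M m = enc Fo (e (C h m, U m), e (D m, C g' m))"
  unfolding eta_def Fob_def Let_def f[symmetric] ..

lemma Fob_Fob: "Fob (\<not> s) h g' (Fob s h g M) = shift_module.Fo \<iota> \<sigma> f' Fo (\<not> s) h g'"
  unfolding Fob_def f[symmetric] by (simp add: par_not tw_mult)

lemma prs_back: "prs (\<not> s) h g' Fo = shift_module.pairs \<iota> \<sigma> f' Fo (\<not> s) h g'"
  unfolding prs_def by (simp add: par_not tw_mult)

lemma eta_pairs:
  assumes m: "m \<in> carrier M"
  shows "(e (C h m, U m), e (D m, C g' m)) \<in> prs (\<not> s) h g' Fo"
proof -
  interpret G: shift_module \<iota> \<sigma> z f' Fo "\<not> s" h g' by (rule shift_back)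
  show ?thesis
    unfolding prs_back
  proof (rule G.pairsI)
    \<comment> \<open>The pair conditions for \<open>Fo\<close> compare encoded pairs, so they are
      checked on the pairs before encoding.\<close>
    have 1: "pop (up (\<not> s)) (C h m, U m) = pop (Coef (tw s h)) (D m, C g' m)"
      using m by (simp add: pop_dn pop_Coef rules mult_ac)
    show "G.U (e (C h m, U m)) = G.C (tw (\<not> \<not> s) h) (e (D m, C g' m))"
      using 1 by (simp add: Fop[OF up_pairs[OF m]] Fop[OF dn_pairs[OF m]])
    have 2: "pop (up s) (D m, C g' m) = pop (Coef g') (C h m, U m)"
      using m by (simp add: pop_up pop_Coef rules mult_ac)
    show "G.D (e (D m, C g' m)) = G.C g' (e (C h m, U m))"
      using 2 by (simp add: Fop[OF up_pairs[OF m]] Fop[OF dn_pairs[OF m]])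
  qed (use up_pairs[OF m] dn_pairs[OF m] in \<open>auto simp: Fo_simps\<close>)
qed

text \<open>The coordinates of \<open>J m\<close> include the images of \<open>m\<close> under
  \<open>h\<close>, \<open>U\<close> and \<open>D\<close>, so an element of the kernel is killed by
  all three. For the cokernel, \<open>h\<close>, \<open>U\<close> and \<open>D\<close> carry any
  pair of pairs to \<open>J\<close> of one of its entries. Hence \<open>h\<close> and first powers
  are enough multipliers throughout.\<close>

lemma eta_qmor:
  assumes h: "h \<noteq> 0"
  defines "E \<equiv> {(m, eta s h g M m) | m. m \<in> carrier M}" and "H \<equiv> Fob (\<not> s) h g' (Fob s h g M)"
  shows "qmor (alg f) (mults f) M H E" "qmor (alg f) (mults f) H M (E\<inverse>)"
proof -
  interpret G: shift_module \<iota> \<sigma> z f' Fo "\<not> s" h g' by (rule shift_back)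
  have H: "H = G.Fo" unfolding H_def Fob_Fob ..
  \<comment> \<open>Moving the factor forth and back ends at the original algebra, so
    \<open>M\<close> and \<open>G.Fo\<close> are modules over the same one.\<close>
  have ff: "par (\<not> s) (tw (\<not> s) h * g') = f" by (simp add: par_not tw_mult f)
  have GFm: "graded_right_module (alg f) G.Fo" using G.Fo_module unfolding ff .
  interpret GF: gwa_fin_module \<iota> \<sigma> z f G.Fo by (rule gwa_fin_moduleI[OF GFm])
  define J where "J m = (e (C h m, U m), e (D m, C g' m))" for m
  have eta: "eta s h g M m = G.e (J m)" for m unfolding eta_eq J_def ..
  have J: "J m \<in> G.pairs" if "m \<in> carrier M" for m
    using eta_pairs[OF that] unfolding J_def prs_back .
  have GFop: "GF.op \<gamma> (G.e p) = G.e (G.pop \<gamma> p)" if "p \<in> G.pairs" for \<gamma> p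
    using G.Fop[OF that] unfolding ff .
  have fst_J: "fst (J m) = e (C h m, U m)" and snd_J: "snd (J m) = e (D m, C g' m)" for m
    by (simp_all add: J_def)
  have J_gen: "G.pop \<gamma> (J m) = J (op \<gamma> m)" if m: "m \<in> carrier M" for \<gamma> m
  proof (cases \<gamma> rule: gen_cases[where s = s])
    case (Coef r)
    have "pop (Coef r) (C h m, U m) = (C h (C r m), U (C r m))" "pop (Coef (tw s r)) (D m, C g' m) = (D (C r m), C g' (C r m))"
      using m by (simp_all add: pop_Coef rules mult_ac)
    then show ?thesis unfolding Coef G.pop_Coef fst_J snd_J
      by (simp add: Fop[OF up_pairs[OF m]] Fop[OF dn_pairs[OF m]] J_def)
  next
    case up
    have "G.pop (up s) (J m) = (G.D (fst (J m)), G.C (tw (\<not> \<not> s) g') (fst (J m)))" using G.pop_dn[of "J m"] by simp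
    moreover have "pop (up s) (C h m, U m) = (C h (U m), U (U m))" "pop (Coef g) (C h m, U m) = (D (U m), C g' (U m))"
      using m by (simp_all add: pop_up pop_Coef rules mult_ac)
    ultimately show ?thesis unfolding up fst_J
      by (simp add: Fop[OF up_pairs[OF m]] J_def)
  next
    case dn
    have "pop (Coef h) (D m, C g' m) = (C h (D m), U (D m))" "pop (up (\<not> s)) (D m, C g' m) = (D (D m), C g' (D m))"
      using m by (simp_all add: pop_dn pop_Coef rules mult_ac)
    then show ?thesis unfolding dn G.pop_up snd_J
      by (simp add: Fop[OF dn_pairs[OF m]] J_def)
  qed
  have J_add: "G.padd (J m) (J m') = J (m \<oplus>\<^bsub>M\<^esub> m')" if "m \<in> carrier M" "m' \<in> carrier M" for m m'
    using that by (simp add: G.padd_def J_def Fo_simps up_pairs dn_pairs) (simp add: padd_def op_add op_closed)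
  have J_zero: "J \<zero>\<^bsub>M\<^esub> = (\<zero>\<^bsub>Fo\<^esub>, \<zero>\<^bsub>Fo\<^esub>)" by (simp add: J_def op_zero Fo_simps)
  have J_hproj: "(hproj Fo i (fst (J m)), hproj Fo (i + G.eps) (snd (J m))) = J (hproj M i m)" if m: "m \<in> carrier M" for i m
  proof -
    have d: "gen_degree (up s) = eps" "gen_degree (up (\<not> s)) = - eps" "G.eps = - eps"
      by (auto simp: eps_def G.eps_def up_def)
    have "hproj M (i + eps) (U m) = U (hproj M i m)" "hproj M (i + - eps) (D m) = D (hproj M i m)"
      using hproj_op[OF m, of i "up s"] hproj_op[OF m, of i "up (\<not> s)"] by (simp_all add: d)
    then show ?thesis
      using m by (simp add: J_def hproj_Fo up_pairs dn_pairs d hproj_Coef)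
  qed
  have gr: "graded_relation (alg f) M G.Fo E"
  proof (rule graded_relation_gensI[OF graded_right_module_axioms GFm])
    show "m \<in> carrier M \<and> n \<in> carrier G.Fo" if "(m, n) \<in> E" for m n
      using that J unfolding E_def eta by (auto simp: G.Fo_simps)
    show "(\<zero>\<^bsub>M\<^esub>, \<zero>\<^bsub>G.Fo\<^esub>) \<in> E"
      unfolding E_def eta G.Fo_simps J_zero[symmetric] by auto
    show "(m \<oplus>\<^bsub>M\<^esub> m', n \<oplus>\<^bsub>G.Fo\<^esub> n') \<in> E" if "(m, n) \<in> E" "(m', n') \<in> E" for m n m' n'
      using that J unfolding E_def eta by (auto simp: G.Fo_simps J_add)
    show "(m \<triangleleft>\<^bsub>M\<^esub> gn f \<gamma>, n \<triangleleft>\<^bsub>G.Fo\<^esub> gn f \<gamma>) \<in> E" if "(m, n) \<in> E" for m n \<gamma>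
    proof -
      have "m \<in> carrier M" "n = G.e (J m)" using that unfolding E_def eta by auto
      then show ?thesis
        using GFop[OF J, of m \<gamma>] J_gen[of m \<gamma>] op_closed[of m \<gamma>] unfolding E_def eta GF.op_def op_def by auto
    qed
    show "(hproj M i m, hproj G.Fo i n) \<in> E" if "(m, n) \<in> E" for m n i
    proof -
      have "m \<in> carrier M" "n = G.e (J m)" using that unfolding E_def eta by auto
      then show ?thesis using J_hproj[of m i] hproj_closed[of m i] unfolding E_def eta by (auto simp: G.hproj_Fo J)
    qed
  qed
  have dom: "Domain E = carrier M" unfolding E_def by auto
  have im: "Domain (E\<inverse>) = {G.e (J m) | m. m \<in> carrier M}" unfolding E_def eta by auto
  have zero_iff: "(\<zero>\<^bsub>M\<^esub>, x) \<in> E \<Longrightarrow> x = \<zero>\<^bsub>G.Fo\<^esub>" for x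
    unfolding E_def eta by (auto simp: J_zero G.Fo_simps)
  show "qmor (alg f) (mults f) M H E"
    unfolding qmor_def H
  proof (intro conjI gr)
    show "mult_dense (mults f) M (Domain E)"
      unfolding mult_dense_iff dom
    proof (intro ballI conjI allI)
      fix x s' assume x: "x \<in> carrier M"
      show "\<exists>r. r \<noteq> 0 \<and> C r x \<in> carrier M" using op_closed[OF x] by (intro exI[of _ 1]) simp
      show "\<exists>k. (op (up s') ^^ k) x \<in> carrier M" using x by (intro exI[of _ 0]) simp
    qed
    have "E `` {\<zero>\<^bsub>M\<^esub>} \<subseteq> carrier G.Fo" using graded_relationD(2)[OF gr] by auto
    then show "mult_torsion (mults f) G.Fo (E `` {\<zero>\<^bsub>M\<^esub>})"
    proof (subst GF.mult_torsion_iff, simp, intro ballI conjI allI)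
      fix x s' assume "x \<in> E `` {\<zero>\<^bsub>M\<^esub>}"
      then have x: "x = \<zero>\<^bsub>G.Fo\<^esub>" using zero_iff by blast
      show "\<exists>r. r \<noteq> 0 \<and> GF.op (Coef r) x = \<zero>\<^bsub>G.Fo\<^esub>" unfolding x GF.op_zero by (intro exI[of _ 1]) simp
      show "\<exists>k. (GF.op (up s') ^^ k) x = \<zero>\<^bsub>G.Fo\<^esub>" unfolding x by (intro exI[of _ 0]) simp
    qed
  qed
  have kernel: "C h m = \<zero>\<^bsub>M\<^esub> \<and> op (up s') m = \<zero>\<^bsub>M\<^esub>" if "(m, \<zero>\<^bsub>G.Fo\<^esub>) \<in> E" for m s'
  proof -
    have m: "m \<in> carrier M" "G.e (J m) = G.e (\<zero>\<^bsub>Fo\<^esub>, \<zero>\<^bsub>Fo\<^esub>)" using that unfolding E_def eta by (auto simp: G.Fo_simps)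
    then have "J m = (\<zero>\<^bsub>Fo\<^esub>, \<zero>\<^bsub>Fo\<^esub>)" using G.e_eq[OF J[OF m(1)] G.zero_pairs] by simp
    then have "(C h m, U m) = (\<zero>\<^bsub>M\<^esub>, \<zero>\<^bsub>M\<^esub>)" "(D m, C g' m) = (\<zero>\<^bsub>M\<^esub>, \<zero>\<^bsub>M\<^esub>)"
      unfolding J_def Fo_simps using e_eq[OF up_pairs[OF m(1)] zero_pairs] e_eq[OF dn_pairs[OF m(1)] zero_pairs] by auto
    then show ?thesis by (cases "s' = s") auto
  qed
  have cokernel: "GF.op (Coef h) x \<in> Domain (E\<inverse>) \<and> GF.op (up s') x \<in> Domain (E\<inverse>)" if x: "x \<in> carrier G.Fo" for x s'
  proof -
    obtain v where v: "x = G.e v" "v \<in> G.pairs" using x unfolding G.Fo_simps by blast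
    note vD = G.pairsD[OF v(2)]
    obtain p where p: "p \<in> pairs" "fst v = e p" using vD(1) unfolding Fo_simps by blast
    obtain w where w: "w \<in> pairs" "snd v = e w" using vD(2) unfolding Fo_simps by blast
    note pD = pairsD[OF p(1)] and wD = pairsD[OF w(1)]
    have "e (pop (up (\<not> s)) p) = e (pop (Coef (tw s h)) w)" "e (pop (up s) w) = e (pop (Coef g') p)"
      using vD(3,4) unfolding p(2) w(2) by (simp_all add: Fop p(1) w(1))
    then have "pop (up (\<not> s)) p = pop (Coef (tw s h)) w" "pop (up s) w = pop (Coef g') p"
      using e_eq[OF pop_pairs[OF p(1)] pop_pairs[OF w(1)]] e_eq[OF pop_pairs[OF w(1)] pop_pairs[OF p(1)]] by auto
    then have eqs: "D (fst p) = C (tw s h) (fst w)" "C g' (fst p) = C h (snd w)" "U (snd w) = C (tw (\<not> s) g') (snd p)"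
      by (simp_all add: pop_dn pop_up pop_Coef)
    \<comment> \<open>Preimages of the three multiples of \<open>v = (p, w)\<close>, without any
      division: the first coordinate of \<open>p\<close> for \<open>h\<close>, the second of
      \<open>p\<close> for \<open>up s\<close>, the first of \<open>w\<close> for
      \<open>up (\<not> s)\<close>. The relations \<open>eqs\<close> and the pair conditions of
      \<open>p\<close> and \<open>w\<close> match the remaining entries.\<close>
    have "G.pop (Coef h) v = J (fst p)"
      using pD wD eqs by (simp add: G.pop_Coef p w Fop J_def pop_Coef)
    moreover have "G.pop (up s) v = J (snd p)"
      using pD wD eqs G.pop_dn[of v] by (simp add: p w Fop J_def pop_Coef pop_up)
    moreover have "G.pop (up (\<not> s)) v = J (fst w)"
      using pD wD eqs by (simp add: G.pop_up p w Fop J_def pop_Coef pop_dn)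
    ultimately show ?thesis
      unfolding im v(1) using pD wD by (cases "s' = s") (auto simp: GFop[OF v(2)])
  qed
  show "qmor (alg f) (mults f) H M (E\<inverse>)"
    unfolding qmor_def H
  proof (intro conjI graded_relation_converse gr)
    show "mult_dense (mults f) G.Fo (Domain (E\<inverse>))"
      unfolding GF.mult_dense_iff
    proof (intro ballI conjI allI)
      fix x s' assume x: "x \<in> carrier G.Fo"
      show "\<exists>r. r \<noteq> 0 \<and> GF.op (Coef r) x \<in> Domain (E\<inverse>)" using cokernel[OF x] h by (intro exI[of _ h]) simp
      show "\<exists>k. (GF.op (up s') ^^ k) x \<in> Domain (E\<inverse>)" using cokernel[OF x] by (intro exI[of _ 1]) simp
    qed
    have "(E\<inverse>) `` {\<zero>\<^bsub>G.Fo\<^esub>} \<subseteq> carrier M" using graded_relationD(1)[OF gr] by auto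
    then show "mult_torsion (mults f) M (E\<inverse> `` {\<zero>\<^bsub>G.Fo\<^esub>})"
      using kernel h
    proof (subst mult_torsion_iff, simp, intro ballI conjI allI)
      fix x s' assume "x \<in> E\<inverse> `` {\<zero>\<^bsub>G.Fo\<^esub>}"
      then have x: "(x, \<zero>\<^bsub>G.Fo\<^esub>) \<in> E" by blast
      show "\<exists>r. r \<noteq> 0 \<and> C r x = \<zero>\<^bsub>M\<^esub>" using kernel[OF x] h by (intro exI[of _ h]) simp
      show "\<exists>k. (op (up s') ^^ k) x = \<zero>\<^bsub>M\<^esub>" using kernel[OF x] by (intro exI[of _ 1]) simp
    qed
  qed
qed

end

text \<open>Every entry of \<open>eta\<close> is an operator of the algebra applied to the element,
  and \<Gamma> is closed under operators.\<close>

lemma (in shift_relation) eta_natural: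
  assumes mn: "(m, n) \<in> \<Gamma>"
  shows "(M.eta s h g M m, M.eta s h g N n) \<in>
    M.Frel (\<not> s) h (t g) (M.Fob s h g M) (M.Fob s h g N) (M.Frel s h g M N \<Gamma>)"
proof -
  have c: "m \<in> carrier M" "n \<in> carrier N" using gD(1,2)[OF mn] .
  have F: "M.Fob s h g M = M.Fo" "M.Fob s h g N = N.Fo" unfolding M.Fob_def by (simp_all add: M.f)
  have "(M.e (M.C h m, M.U m), N.e (N.C h n, N.U n)) \<in> M.Frel s h g M N \<Gamma>"
    "(M.e (M.D m, M.C (t g) m), N.e (N.D n, N.C (t g) n)) \<in> M.Frel s h g M N \<Gamma>"
    using c op_rel[OF mn] by (intro FrelI M.up_pairs N.up_pairs M.dn_pairs N.dn_pairs; simp)+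
  then show ?thesis
    unfolding M.eta_eq N.eta_eq F M.Frel_def[of "\<not> s"] using M.eta_pairs[OF c(1)] N.eta_pairs[OF c(2)] by fastforce
qed

context gwa_fin
begin

theorem linear_equivalent_QGrMod:
  assumes h: "h \<noteq> 0"
  shows "linear_equivalent (QGrMod TYPE('m) (alg (par s (h * g)))) (QGrMod TYPE('m) (alg (par s (tw s h * g))))"
proof -
  let ?f = "par s (h * g)" and ?f' = "par s (tw s h * g)" and ?g = "tw (\<not> s) g"
  \<comment> \<open>The functor back is the construction for \<open>\<not> s\<close>,
    \<open>h\<close> and \<open>?g\<close>; these equations say that it starts at the second algebra
    and ends at the first.\<close>
  have f': "par (\<not> s) (h * ?g) = ?f'" and f: "par (\<not> s) (tw (\<not> s) h * ?g) = ?f"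
    by (simp_all add: par_not tw_mult)
  interpret F: relation_functor "alg ?f" "mults ?f" "alg ?f'" "mults ?f'" "TYPE('m)" "Fob s h g" "Frel s h g"
    by (rule relation_functor_shift)
  interpret G: relation_functor "alg ?f'" "mults ?f'" "alg ?f" "mults ?f" "TYPE('m)" "Fob (\<not> s) h ?g" "Frel (\<not> s) h ?g"
    using relation_functor_shift[of "\<not> s" h ?g] unfolding f f' .
  define E where "E s g M = {(m, eta s h g M m) | m. m \<in> carrier M}" for s g and M :: "('k, 'r, 'm) gwa_gr_module"
  have E: "qmor (alg (par b (h * k))) (mults (par b (h * k))) M (Fob (\<not> b) h (tw (\<not> b) k) (Fob b h k M)) (E b k M) \<and>
      qmor (alg (par b (h * k))) (mults (par b (h * k))) (Fob (\<not> b) h (tw (\<not> b) k) (Fob b h k M)) M ((E b k M)\<inverse>) \<and>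
      Domain (E b k M) = carrier M \<and> single_valued (E b k M)"
    if "graded_right_module (alg (par b (h * k))) M" for b k and M :: "('k, 'r, 'm) gwa_gr_module"
    using shift_module.eta_qmor[OF shift_moduleI[OF that refl] h] unfolding E_def by (auto simp: single_valued_def)
  have nat: "(m', n') \<in> Frel (\<not> b) h (tw (\<not> b) k) (Fob b h k M) (Fob b h k N) (Frel b h k M N \<Gamma>)"
    if M: "graded_right_module (alg (par b (h * k))) M" and N: "graded_right_module (alg (par b (h * k))) N"
      and q: "qmor (alg (par b (h * k))) (mults (par b (h * k))) M N \<Gamma>"
      and mn: "(m, n) \<in> \<Gamma>" "(m, m') \<in> E b k M" "(n, n') \<in> E b k N"
    for b k \<Gamma> m n m' n' and M N :: "('k, 'r, 'm) gwa_gr_module"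
  proof -
    interpret shift_relation \<iota> \<sigma> z "par b (h * k)" M N b h k \<Gamma>
      by (intro shift_relation.intro shift_relation_axioms.intro shift_moduleI M N refl q)
    show ?thesis using eta_natural[OF mn(1)] mn(2,3) unfolding E_def by simp
  qed
  \<comment> \<open>Twisting twice is the identity, so the counit is the converse of the same map
    \<open>eta\<close>, taken at \<open>\<not> s\<close> and \<open>?g\<close>.\<close>
  have nn: "(\<not> \<not> s) = s" "tw (\<not> \<not> s) ?g = g" by simp_all
  note E' = E[of "\<not> s" ?g, unfolded f' nn] and nat' = nat[of "\<not> s" ?g, unfolded f' nn]
  have eta: "natural_isomorphism (QGrMod TYPE('m) (alg ?f)) (QGrMod TYPE('m) (alg ?f)) (\<lambda>U. U) (\<lambda>U V f. f)
      (\<lambda>U. Fob (\<not> s) h ?g (Fob s h g U)) (\<lambda>U V \<Phi>. G.Fm (Fob s h g U) (Fob s h g V) (F.Fm U V \<Phi>))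
      (\<lambda>M. cls (alg ?f) M (Fob (\<not> s) h ?g (Fob s h g M)) (E s g M))"
    by (rule F.T.natural_isomorphism_of_relations(1)[where
          Hr = "\<lambda>M N \<Gamma>. Frel (\<not> s) h ?g (Fob s h g M) (Fob s h g N) (Frel s h g M N \<Gamma>)"])
      (use E nat in \<open>simp_all add: F.Fo G.Fo F.Fr G.Fr F.Fm_cls G.Fm_cls\<close>)
  have eps: "natural_isomorphism (QGrMod TYPE('m) (alg ?f')) (QGrMod TYPE('m) (alg ?f'))
      (\<lambda>U. Fob s h g (Fob (\<not> s) h ?g U)) (\<lambda>U V \<Phi>. F.Fm (Fob (\<not> s) h ?g U) (Fob (\<not> s) h ?g V) (G.Fm U V \<Phi>))
      (\<lambda>U. U) (\<lambda>U V f. f)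
      (\<lambda>M. cls (alg ?f') (Fob s h g (Fob (\<not> s) h ?g M)) M ((E (\<not> s) ?g M)\<inverse>))"
    by (rule F.T'.natural_isomorphism_of_relations(2)[where
          Hr = "\<lambda>M N \<Gamma>. Frel s h g (Fob (\<not> s) h ?g M) (Fob (\<not> s) h ?g N) (Frel (\<not> s) h ?g M N \<Gamma>)"])
      (use E' nat' in \<open>simp_all add: F.Fo G.Fo F.Fr G.Fr F.Fm_cls G.Fm_cls\<close>)
  show ?thesis
    unfolding linear_equivalent_def using F.linear_functor G.linear_functor eta eps by blast
qed

end

section \<open>The two coefficient rings\<close>

lemma poly_additive_induct:
  fixes p :: "'a::comm_monoid_add poly"
  assumes "P 0" "\<And>c n. P (monom c n)" "\<And>p q. \<lbrakk>P p; P q\<rbrakk> \<Longrightarrow> P (p + q)"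
  shows "P p"
proof -
  have "P (\<Sum>i\<in>I. monom (Polynomial.coeff p i) i)" if "finite I" for I
    using that by (induction I rule: finite_induct) (auto simp: assms)
  from this[of "{..Polynomial.degree p}"] show ?thesis by (simp add: poly_as_sum_of_monoms)
qed

text \<open>Finite codimension is division with remainder, with the monomials of degree below that
  of \<open>r\<close> as \<open>T\<close>. Coefficients are indexed by elements of \<open>T\<close>,
  so a monomial is matched with its coefficient through its degree.\<close>

lemma gwa_fin_shift: "gwa_fin (\<lambda>c :: 'k::field_char_0. [:c:]) shift_aut [:0, 1:]"
proof
  fix r :: "'k poly" assume r: "r \<noteq> 0"
  let ?m = "\<lambda>i. monom (1::'k) i"
  have "t = (\<Sum>u\<in>?m ` {..<Polynomial.degree r}. [:Polynomial.coeff (t mod r) (Polynomial.degree u):] * u) + r * (t div r)" for t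
  proof -
    have inj: "inj_on ?m {..<Polynomial.degree r}" by (auto simp: inj_on_def monom_eq_iff')
    have "(\<Sum>u\<in>?m ` {..<Polynomial.degree r}. [:Polynomial.coeff (t mod r) (Polynomial.degree u):] * u) =
        (\<Sum>i<Polynomial.degree r. monom (Polynomial.coeff (t mod r) i) i)"
      by (subst sum.reindex[OF inj]) (simp add: degree_monom_eq smult_monom)
    also have "\<dots> = t mod r"
    proof (intro poly_eqI)
      fix n
      have "Polynomial.coeff (t mod r) n = 0" if "\<not> n < Polynomial.degree r"
        using degree_mod_less[OF r, of t] that by (auto intro: coeff_eq_0)
      then show "Polynomial.coeff (\<Sum>i<Polynomial.degree r. monom (Polynomial.coeff (t mod r) i) i) n = Polynomial.coeff (t mod r) n"
        by (auto simp: coeff_sum sum.delta)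
    qed
    finally show ?thesis by simp
  qed
  then show "\<exists>T. finite T \<and> (\<forall>t. \<exists>c p. t = (\<Sum>u\<in>T. [:c u:] * u) + r * p)"
    by (intro exI[of _ "?m ` {..<Polynomial.degree r}"] conjI allI exI) simp_all
next
  fix a :: "nat \<Rightarrow> 'k" and n i :: nat
  assume *: "(\<Sum>i<n. [:a i:] * [:0, 1:] ^ i) = 0" "i < n"
  have "(\<Sum>i<n. [:a i:] * [:0, 1:] ^ i) = (\<Sum>i<n. monom (a i) i)"
    by (intro sum.cong) (simp_all add: monom_altdef)
  then have "Polynomial.coeff (\<Sum>i<n. monom (a i) i) i = 0" using * by simp
  then show "a i = 0" using *(2) by (simp add: coeff_sum sum.delta)
qed (auto simp: shift_aut_def pcompose_add pcompose_mult bij_shift_aut infinite_UNIV_char_0 one_pCons)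

section \<open>Laurent polynomials\<close>

lemma poly_mapping_sum: "(\<Sum>k\<in>Poly_Mapping.keys p. Poly_Mapping.single k (Poly_Mapping.lookup p k)) = p"
  by (intro poly_mapping_eqI) (auto simp: lookup_sum lookup_single when_def in_keys_iff)

text \<open>Reduction modulo \<open>r\<close> works from both ends: the highest term of
  \<open>r\<close> lowers large exponents and the lowest term raises small ones, until every
  exponent lies in an interval of length \<open>d\<close>.\<close>

lemma laurent_finite_codim:
  fixes r :: "'k::field laurent"
  assumes r: "r \<noteq> 0"
  shows "\<exists>T. finite T \<and> (\<forall>t. \<exists>c p. t = (\<Sum>u\<in>T. Poly_Mapping.single 0 (c u) * u) + r * p)"
proof -
  let ?K = "Poly_Mapping.keys r"
  have K: "finite ?K" "?K \<noteq> {}" using r by auto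
  define lo hi where "lo = Min ?K" and "hi = Max ?K"
  define d where "d = hi - lo"
  have lo: "lo \<in> ?K" "\<And>k. k \<in> ?K \<Longrightarrow> lo \<le> k" and hi: "hi \<in> ?K" "\<And>k. k \<in> ?K \<Longrightarrow> k \<le> hi"
    using K by (auto simp: lo_def hi_def)
  let ?m = "\<lambda>i. Poly_Mapping.single i (1::'k)"
  \<comment> \<open>As many consecutive monomials as the width of \<open>r\<close>. For a single
    term, where \<open>r\<close> is a unit, the set is empty.\<close>
  define T where "T = ?m ` {0..<d}"
  have T: "finite T" by (simp add: T_def)
  define V where "V = {t. \<exists>c p. t = (\<Sum>u\<in>T. Poly_Mapping.single 0 (c u) * u) + r * p}"
  have V_add: "x + y \<in> V" if "x \<in> V" "y \<in> V" for x y
  proof -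
    obtain c p where "x = (\<Sum>u\<in>T. Poly_Mapping.single 0 (c u) * u) + r * p" using \<open>x \<in> V\<close> unfolding V_def by auto
    moreover obtain c' p' where "y = (\<Sum>u\<in>T. Poly_Mapping.single 0 (c' u) * u) + r * p'" using \<open>y \<in> V\<close> unfolding V_def by auto
    ultimately have "x + y = (\<Sum>u\<in>T. Poly_Mapping.single 0 (c u + c' u) * u) + r * (p + p')"
      by (simp add: single_add algebra_simps sum.distrib)
    then show ?thesis unfolding V_def by (intro CollectI exI)
  qed
  have V_r: "r * p \<in> V" for p
    unfolding V_def by (intro CollectI exI[of _ "\<lambda>_. 0"] exI[of _ p]) simp
  have V_zero: "0 \<in> V" using V_r[of 0] by simp
  have V_sum: "sum w I \<in> V" if "finite I" "\<And>i. i \<in> I \<Longrightarrow> w i \<in> V" for w and I :: "int set"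
    using that by (induction I rule: finite_induct) (auto simp: V_zero V_add)
  have V_base: "Poly_Mapping.single j c \<in> V" if "0 \<le> j" "j < d" for j c
  proof -
    have "(\<Sum>u\<in>T. Poly_Mapping.single 0 (if u = ?m j then c else 0) * u) = (\<Sum>u\<in>T. if u = ?m j then Poly_Mapping.single 0 c * u else 0)"
      by (intro sum.cong) auto
    also have "\<dots> = Poly_Mapping.single j c" using that T by (subst sum.delta) (auto simp: T_def mult_single)
    finally show ?thesis unfolding V_def by (intro CollectI exI[of _ "\<lambda>u. if u = ?m j then c else 0"] exI[of _ 0]) simp
  qed
  \<comment> \<open>Multiplying \<open>r\<close> by a monomial that moves its term at
    \<open>k\<close> to exponent \<open>j\<close> solves for that monomial in terms of the other
    shifted terms of \<open>r\<close>.\<close>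
  have step: "Poly_Mapping.single j c \<in> V"
    if k: "k \<in> ?K" and others: "\<And>k' c. k' \<in> ?K - {k} \<Longrightarrow> Poly_Mapping.single (j - k + k') c \<in> V" for j k c
  proof -
    let ?b = "c / Poly_Mapping.lookup r k"
    have nz: "Poly_Mapping.lookup r k \<noteq> 0" using k by (simp add: in_keys_iff)
    have "r * Poly_Mapping.single (j - k) ?b = (\<Sum>k'\<in>?K. Poly_Mapping.single k' (Poly_Mapping.lookup r k')) * Poly_Mapping.single (j - k) ?b"
      by (simp add: poly_mapping_sum)
    also have "\<dots> = (\<Sum>k'\<in>?K. Poly_Mapping.single (j - k + k') (Poly_Mapping.lookup r k' * ?b))"
      by (simp add: sum_distrib_right mult_single algebra_simps)
    also have "\<dots> = Poly_Mapping.single j c + (\<Sum>k'\<in>?K - {k}. Poly_Mapping.single (j - k + k') (Poly_Mapping.lookup r k' * ?b))"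
      using K(1) k nz by (subst sum.remove[of _ k]) auto
    finally have "Poly_Mapping.single j c = r * Poly_Mapping.single (j - k) ?b +
        (\<Sum>k'\<in>?K - {k}. Poly_Mapping.single (j - k + k') (- (Poly_Mapping.lookup r k' * ?b)))"
      by (simp add: single_uminus sum_negf)
    also have "\<dots> \<in> V" by (intro V_add V_r V_sum others) (use K in auto)
    finally show ?thesis .
  qed
  \<comment> \<open>The interval of exponents known to lie in \<open>V\<close> grows by one on each
    side. Eliminating \<open>d + int n\<close> with the term at \<open>hi\<close>, or
    \<open>- int n - 1\<close> with the term at \<open>lo\<close>, leaves exponents inside the
    previous interval, since the terms of \<open>r\<close> spread over the width
    \<open>d\<close>.\<close>
  have range: "Poly_Mapping.single j c \<in> V" if "- int n \<le> j" "j < d + int n" for n j c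
    using that
  proof (induction n arbitrary: j c)
    case 0
    then show ?case using V_base by simp
  next
    case (Suc n)
    consider "- int n \<le> j \<and> j < d + int n" | "j = d + int n" | "j = - int n - 1" using Suc.prems by force
    then show ?case
    proof cases
      case 1
      then show ?thesis using Suc.IH by blast
    next
      case 2
      show ?thesis
      proof (rule step[OF hi(1)])
        fix k' c assume "k' \<in> ?K - {hi}"
        then have "lo \<le> k'" "k' < hi" using lo(2) hi(2) by force+
        then show "Poly_Mapping.single (j - hi + k') c \<in> V" using 2 by (intro Suc.IH) (auto simp: d_def)
      qed
    next
      case 3
      show ?thesis
      proof (rule step[OF lo(1)])
        fix k' c assume "k' \<in> ?K - {lo}"
        then have "lo < k'" "k' \<le> hi" using lo(2) hi(2) by force+
        then show "Poly_Mapping.single (j - lo + k') c \<in> V" using 3 by (intro Suc.IH) (auto simp: d_def)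
      qed
    qed
  qed
  have "0 \<le> d" using lo hi by (simp add: d_def)
  then have "Poly_Mapping.single j c \<in> V" for j c using range[of "nat (\<bar>j\<bar> + 1)" j c] by auto
  then have "t \<in> V" for t
    by (induction t rule: poly_mapping_additive_induct) (auto simp: V_zero V_add)
  then show ?thesis using T unfolding V_def by blast
qed

lemma scale_aut_add: "scale_aut \<xi> (p + p') = scale_aut \<xi> p + scale_aut \<xi> p'"
  by (intro poly_mapping_eqI) (simp add: lookup_scale_aut lookup_add distrib_left)

lemma scale_aut_single: "scale_aut \<xi> (Poly_Mapping.single n c) = Poly_Mapping.single n (\<xi> powi n * c)"
  by (intro poly_mapping_eqI) (auto simp: lookup_scale_aut lookup_single when_def)

lemma scale_aut_zero: "scale_aut \<xi> 0 = 0"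
  by (intro poly_mapping_eqI) (simp add: lookup_scale_aut)

lemma scale_aut_mult:
  assumes "\<xi> \<noteq> 0"
  shows "scale_aut \<xi> (p * p') = scale_aut \<xi> p * scale_aut \<xi> p'"
proof (induction p rule: poly_mapping_additive_induct)
  case (2 n c)
  show ?case
    by (induction p' rule: poly_mapping_additive_induct)
      (use assms in \<open>simp_all add: scale_aut_zero scale_aut_add scale_aut_single mult_single distrib_left distrib_right power_int_add mult_ac\<close>)
qed (simp_all add: scale_aut_zero scale_aut_add distrib_right)

lemma gwa_fin_scale:
  fixes \<xi> :: "'k::field_char_0"
  assumes \<xi>: "\<xi> \<noteq> 0"
  shows "gwa_fin (\<lambda>c. Poly_Mapping.single 0 c) (scale_aut \<xi>) (Poly_Mapping.single 1 1)"
proof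
  fix r :: "'k laurent" assume "r \<noteq> 0"
  then show "\<exists>T. finite T \<and> (\<forall>t. \<exists>c p. t = (\<Sum>u\<in>T. Poly_Mapping.single 0 (c u) * u) + r * p)"
    by (rule laurent_finite_codim)
next
  fix a :: "nat \<Rightarrow> 'k" and n i :: nat
  assume *: "(\<Sum>i<n. Poly_Mapping.single 0 (a i) * Poly_Mapping.single (1::int) 1 ^ i) = 0" "i < n"
  have "Poly_Mapping.single (1::int) (1::'k) ^ i = Poly_Mapping.single (int i) 1" for i
    by (induction i) (simp_all add: mult_single)
  then have "Poly_Mapping.lookup (\<Sum>i<n. Poly_Mapping.single (int i) (a i)) (int i) = 0"
    using *(1) by (simp add: mult_single)
  moreover have "Poly_Mapping.lookup (\<Sum>i<n. Poly_Mapping.single (int i) (a i)) (int i) = (\<Sum>j<n. if j = i then a j else 0)"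
    by (auto simp: lookup_sum lookup_single when_def intro!: sum.cong)
  ultimately show "a i = 0" using *(2) by simp
qed (use \<xi> in \<open>auto simp: scale_aut_add scale_aut_mult scale_aut_single bij_scale_aut infinite_UNIV_char_0 single_add mult_single\<close>)

lemma lookup_laurent_of_poly:
  "Poly_Mapping.lookup (laurent_of_poly p) n = (if 0 \<le> n then Polynomial.coeff p (nat n) else 0)"
proof -
  have "Poly_Mapping.lookup (laurent_of_poly p) n = (\<Sum>i\<le>Polynomial.degree p. if int i = n then Polynomial.coeff p i else 0)"
    by (simp add: laurent_of_poly_def lookup_sum lookup_single when_def)
  also have "\<dots> = (\<Sum>i\<le>Polynomial.degree p. if i = nat n then (if 0 \<le> n then Polynomial.coeff p (nat n) else 0) else 0)"
    by (intro sum.cong) auto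
  also have "\<dots> = (if 0 \<le> n then Polynomial.coeff p (nat n) else 0)"
    by (simp add: coeff_eq_0)
  finally show ?thesis .
qed

lemma laurent_of_poly_add: "laurent_of_poly (p + q) = laurent_of_poly p + laurent_of_poly q"
  by (intro poly_mapping_eqI) (simp add: lookup_laurent_of_poly lookup_add)

lemma laurent_of_poly_zero: "laurent_of_poly 0 = 0"
  by (intro poly_mapping_eqI) (simp add: lookup_laurent_of_poly)

lemma laurent_of_poly_monom: "laurent_of_poly (monom c n) = Poly_Mapping.single (int n) c"
  by (intro poly_mapping_eqI) (auto simp: lookup_laurent_of_poly lookup_single when_def)

lemma laurent_of_poly_mult: "laurent_of_poly (p * q) = laurent_of_poly p * laurent_of_poly q"
proof (induction p rule: poly_additive_induct)
  case (2 c n)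
  show ?case
    by (induction q rule: poly_additive_induct)
      (simp_all add: laurent_of_poly_zero laurent_of_poly_add laurent_of_poly_monom mult_single mult_monom distrib_left)
qed (simp_all add: laurent_of_poly_zero laurent_of_poly_add distrib_right)

lemma laurent_of_poly_eq_zero: "laurent_of_poly p = 0 \<longleftrightarrow> p = 0"
proof
  assume "laurent_of_poly p = 0"
  then have "Polynomial.coeff p n = 0" for n using lookup_laurent_of_poly[of p "int n"] by simp
  then show "p = 0" by (intro poly_eqI) simp
qed (simp add: laurent_of_poly_zero)

text \<open>Both cases are instances with \<open>s = True\<close>, where \<open>par\<close> returns
  its argument and \<open>tw\<close> is \<sigma>, with \<open>h\<close> the factor z - \<beta> and
  \<open>g\<close> the cofactor.\<close>

theorem theorem3p8:
  fixes f :: "'k :: {alg_closed_field, field_char_0} poly" and \<beta> :: 'k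
  assumes "Polynomial.lead_coeff f = 1" and "poly f \<beta> = 0"
  shows
    "linear_equivalent
       (QGrMod TYPE('m) (gwa_shift f))
       (QGrMod TYPE('m) (gwa_shift (shift_aut [:- \<beta>, 1:] * (f div [:- \<beta>, 1:]))))
     \<and>
     (\<forall>\<xi>. \<xi> \<noteq> 0 \<longrightarrow> (\<forall>n>0. \<xi> ^ n \<noteq> 1) \<longrightarrow> poly f 0 \<noteq> 0 \<longrightarrow>
       linear_equivalent
         (QGrMod TYPE('m) (gwa_scale \<xi> (laurent_of_poly f)))
         (QGrMod TYPE('m) (gwa_scale \<xi>
            (scale_aut \<xi> (laurent_of_poly [:- \<beta>, 1:]) * laurent_of_poly (f div [:- \<beta>, 1:])))))"
proof (intro conjI allI impI)
  let ?h = "[:- \<beta>, 1:]"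
  have f: "?h * (f div ?h) = f" using assms(2) by (intro dvd_mult_div_cancel) (simp add: poly_eq_0_iff_dvd)
  interpret S: gwa_fin "\<lambda>c :: 'k. [:c:]" shift_aut "[:0, 1:]" by (rule gwa_fin_shift)
  show "linear_equivalent
       (QGrMod TYPE('m) (gwa_shift f))
       (QGrMod TYPE('m) (gwa_shift (shift_aut ?h * (f div ?h))))"
    using S.linear_equivalent_QGrMod[where s = True and h = ?h and g = "f div ?h"]
    unfolding gwa_shift_def S.par_def S.tw_def f by simp
  fix \<xi> :: 'k assume \<xi>: "\<xi> \<noteq> 0"
  interpret L: gwa_fin "\<lambda>c :: 'k. Poly_Mapping.single 0 c" "scale_aut \<xi>" "Poly_Mapping.single 1 1"
    by (rule gwa_fin_scale[OF \<xi>])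
  \<comment> \<open>The map from polynomials to Laurent polynomials is multiplicative and injective,
    so the factorization of \<open>f\<close> and the nonvanishing of \<open>h\<close> carry
    over.\<close>
  have lf: "laurent_of_poly ?h * laurent_of_poly (f div ?h) = laurent_of_poly f"
    unfolding laurent_of_poly_mult[symmetric] f ..
  have "laurent_of_poly ?h \<noteq> 0" by (simp add: laurent_of_poly_eq_zero)
  from L.linear_equivalent_QGrMod[OF this, where s = True and g = "laurent_of_poly (f div ?h)"]
  show "linear_equivalent
         (QGrMod TYPE('m) (gwa_scale \<xi> (laurent_of_poly f)))
         (QGrMod TYPE('m) (gwa_scale \<xi>
            (scale_aut \<xi> (laurent_of_poly ?h) * laurent_of_poly (f div ?h))))"
    unfolding gwa_scale_def L.par_def L.tw_def lf by simp
qed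

end
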